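(* One has $$\sup_{P\in\mathcal P_3}\frac{\sigma^3(P)}{\beta_3(P)}\lim_{n\to\infty}\sqrt n\,\sup_{I\in\mathfrak I}|P_n(I)-\mathrm N_{0,1}(I)|=\frac{2}{\sqrt{2\pi}},$$ and the supremum over $P\in\mathcal P_3$ is attained precisely for $P\in\{(\delta_x+\delta_y)/2 : x,y\in\mathbb R,\ x\ne y\}$.
   Context: $\mathrm{Prob}(\mathbb R)$ is the set of all (Borel) probability laws on $\mathbb R$, $\mathbb N=\{1,2,3,\dots\}$, $\delta_x$ is the unit mass at $x\in\mathbb R$, and $\mathrm N_{0,1}$ is the standard normal law. For $P\in\mathrm{Prob}(\mathbb R)$ and $s\in[1,\infty)$, let $\mu(P)=\int x\,P(\mathrm dx)$ and $\beta_s(P)=\int|x-\mu(P)|^s\,P(\mathrm dx)$ if $\int|x|\,P(\mathrm dx)<\infty$, and $\beta_s(P)=\infty$ otherwise. Let $\sigma^2(P)=\beta_2(P)$ with $\sigma(P)\ge 0$, and $\sigma^3(P)=(\sigma(P))^3$. Let $\mathcal P_3=\{P\in\mathrm{Prob}(\mathbb R):0<\beta_3(P)<\infty\}$. For $P\in\mathcal P_3$ and $n\in\mathbb N$, $P_n\in\mathrm{Prob}(\mathbb R)$ is defined by $P_n(A)=P^{*n}(\sigma\sqrt n\,A+n\mu)$ for Borel $A\subseteq\mathbb R$, where $\mu=\mu(P)$, $\sigma=\sigma(P)$ and $P^{*n}$ is the $n$-fold convolution power; that is, $P_n$ is the law of the standardized sum $(X_1+\dots+X_n-n\mu)/(\sigma\sqrt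 n)$ of independent random variables $X_1,\dots,X_n$ with law $P$. $\mathfrak I$ denotes the system of all intervals in $\mathbb R$ (bounded or unbounded; open, closed or half-open). The limit as $n\to\infty$ in the claim exists for every $P\in\mathcal P_3$. *)

theory Defs
  imports "HOL-Probability.Probability"
begin

text \<open>Laws on \<open>\<real>\<close> are Borel probability measures, i.e. measures satisfying
  \<^locale>\<open>real_distribution\<close>.\<close>

definition law_mean :: "real measure \<Rightarrow> real"
  where "law_mean P = (\<integral>x. x \<partial>P)"

definition abs_central_moment :: "real \<Rightarrow> real measure \<Rightarrow> ennreal"
  where "abs_central_moment s P =
    (if (\<integral>\<^sup>+x. ennreal \<bar>x\<bar> \<partial>P) < \<infinity>
     then \<integral>\<^sup>+x. ennreal (\<bar>x - law_mean P\<bar> powr s) \<partial>P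
     else \<infinity>)"

text \<open>The real-valued standard deviation; \<^const>\<open>enn2real\<close> sends \<open>\<infinity>\<close> to \<open>0\<close>, which is
  irrelevant on the class \<open>P3\<close> below, where the second moment is finite.\<close>

definition law_sd :: "real measure \<Rightarrow> real"
  where "law_sd P = sqrt (enn2real (abs_central_moment 2 P))"

definition P3 :: "real measure set"
  where "P3 = {P. real_distribution P \<and>
    0 < abs_central_moment 3 P \<and> abs_central_moment 3 P < \<infinity>}"

primrec conv_power :: "real measure \<Rightarrow> nat \<Rightarrow> real measure"
  where
    "conv_power P 0 = return borel 0"
  | "conv_power P (Suc n) = (P \<star> conv_power P n)"

text \<open>For \<open>\<sigma> \<surd>n > 0\<close> the preimage of \<open>A\<close> under the standardizing map is
  \<open>\<sigma> \<surd>n A + n \<mu>\<close>.\<close>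

definition standardized_conv_power :: "real measure \<Rightarrow> nat \<Rightarrow> real measure"
  where "standardized_conv_power P n =
    distr (conv_power P n) borel
      (\<lambda>x. (x - real n * law_mean P) / (law_sd P * sqrt (real n)))"

definition interval_distance :: "real measure \<Rightarrow> real measure \<Rightarrow> real"
  where "interval_distance P Q =
    (SUP I\<in>{I :: real set. is_interval I}. \<bar>measure P I - measure Q I\<bar>)"

definition scaled_interval_error :: "real measure \<Rightarrow> nat \<Rightarrow> real"
  where "scaled_interval_error P n =
    sqrt (real n) * interval_distance (standardized_conv_power P n) std_normal_distribution"

definition asymptotic_ratio :: "real measure \<Rightarrow> real"
  where "asymptotic_ratio P =
    law_sd P ^ 3 / enn2real (abs_central_moment 3 P) * lim (scaled_interval_error P)"

definition half_sum_dirac :: "real \<Rightarrow> real \<Rightarrow> real measure"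
  where "half_sum_dirac x y =
    measure_of UNIV (sets borel)
      (\<lambda>A. (emeasure (return borel x) A + emeasure (return borel y) A) / 2)"

text \<open>The set function above is countably additive, so \<^const>\<open>measure_of\<close> does not
  fall back to the zero measure.\<close>

lemma sets_half_sum_dirac [simp]: "sets (half_sum_dirac x y) = sets borel"
  unfolding half_sum_dirac_def by (metis sets.sigma_sets_eq sets_measure_of space_borel subset_UNIV Pow_UNIV)

lemma emeasure_half_sum_dirac:
  assumes "A \<in> sets borel"
  shows "emeasure (half_sum_dirac x y) A =
    (emeasure (return borel x) A + emeasure (return borel y) A) / 2"
proof (rule emeasure_measure_of[OF half_sum_dirac_def])
  show "countably_additive (sets (half_sum_dirac x y))
     (\<lambda>A. (emeasure (return borel x) A + emeasure (return borel y) A) / 2)"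
  proof (rule countably_additiveI)
    fix A :: "nat \<Rightarrow> real set"
    assume A: "range A \<subseteq> sets (half_sum_dirac x y)" "disjoint_family A"
    have s: "(\<Sum>i. emeasure (return borel z) (A i)) = emeasure (return borel z) (\<Union>i. A i)" for z
      using A by (intro suminf_emeasure) auto
    have "(\<Sum>i. (emeasure (return borel x) (A i) + emeasure (return borel y) (A i)) / 2)
        = (\<Sum>i. emeasure (return borel x) (A i) + emeasure (return borel y) (A i)) / 2"
      by (simp add: ennreal_suminf_divide)
    also have "\<dots> = ((\<Sum>i. emeasure (return borel x) (A i)) + (\<Sum>i. emeasure (return borel y) (A i))) / 2"
      by (simp add: suminf_add[symmetric])
    finally show "(\<Sum>i. (emeasure (return borel x) (A i) + emeasure (return borel y) (A i)) / 2)
        = (emeasure (return borel x) (\<Union>i. A i) + emeasure (return borel y) (\<Union>i. A i)) / 2"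
      by (simp add: s)
  qed
qed (use assms in \<open>auto simp: positive_def\<close>)

end

theory Submission
  imports Defs "HOL-Real_Asymp.Real_Asymp"
begin

text \<open>
  Both sides of the claim are invariant under affine maps, so let \<open>X\<close> be standardized with
  characteristic function \<open>f\<close>, \<open>m = E X\<^sup>3\<close> and \<open>\<beta> = E \<bar>X\<bar>\<^sup>3\<close>. Write \<open>\<phi>\<close> and
  \<open>\<Phi>\<close> for the standard normal density and distribution function, \<open>\<psi> x = (1 - x\<^sup>2) \<phi> x\<close>, and
  \<open>h\<close> for the maximal span of \<open>X\<close> if \<open>X\<close> has a lattice law, \<open>h = 0\<close> otherwise. The limit of
  \<open>sqrt n\<close> times the interval distance is

    \<open>L = sup {\<bar>m/6 (\<psi> b - \<psi> a)\<bar> + h/2 (\<phi> a + \<phi> b) | a b}\<close>,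

  and the corollary is an optimization of \<open>L / \<beta>\<close>.

  \<^emph>\<open>The limit.\<close> Add to the sum of \<open>n\<close> copies of \<open>X\<close> an independent variable that is uniform on
  \<open>[-h/2, h/2]\<close>. The smoothed sum has the one-term Edgeworth expansion
  \<open>\<Phi> + m / (6 sqrt n) \<psi> + o (1 / sqrt n)\<close>, uniformly and with no lattice correction
  (\<open>smoothed_edgeworth_expansion\<close>): by a smoothing inequality of Esseen type (\<open>esseen_smoothing\<close>)
  this is a statement about characteristic functions on \<open>[0, T]\<close> for a fixed \<open>T\<close>. Near \<open>0\<close> they
  are controlled by the third order expansion of \<open>f\<close>. Away from \<open>0\<close> the power \<open>f\<^sup>n\<close> is
  negligible except near the points where \<open>\<bar>f\<bar> = 1\<close>, and there the characteristic function \<open>u\<close>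
  of the uniform variable vanishes. Quantitatively, \<open>\<bar>u\<bar>\<^sup>2 \<le> C (1 - \<bar>f\<bar>\<^sup>2)\<close>, which is the predicate
  \<open>smoothing_span\<close>; it unites lattice and nonlattice laws, and a suitable \<open>h\<close> always exists
  (\<open>exists_smoothing_span\<close>). Since the uniform variable moves points by at most \<open>h/2\<close>,
  the mass of an interval is trapped between masses of intervals for the smoothed sum whose end points
  are moved by \<open>h/2\<close>, and at lattice end points the outer or inner trap is exact. This gives
  \<open>L\<close> (\<open>interval_error_tendsto\<close>).

  \<^emph>\<open>The optimization.\<close> The supremum in \<open>L\<close> is increasing in \<open>\<bar>m\<bar>\<close> and \<open>h\<close>, and for \<open>\<bar>m\<bar> = h\<close> it is
  attained at \<open>a = b = 0\<close> by \<open>1 + t \<le> exp t\<close>; hence \<open>L \<le> max h \<bar>m\<bar> \<phi> 0\<close>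
  (\<open>interval_defect_le\<close>). Now \<open>\<bar>m\<bar> \<le> \<beta> < 2 \<beta>\<close>, and \<open>h \<le> 2 \<beta>\<close> with equality only if \<open>\<bar>X\<bar> = 1\<close> almost
  surely (\<open>lattice_span_le_beta3\<close>), since on the lattice \<open>\<bar>x\<bar>\<^sup>3\<close> lies above a parabola that meets it
  at the two lattice points enclosing \<open>0\<close>. So \<open>L / \<beta> \<le> 2 \<phi> 0 = 2 / sqrt (2 \<pi>)\<close> with equality
  exactly for the symmetric two-point laws, for which \<open>h = 2\<close>, \<open>m = 0\<close> and \<open>\<beta> = 1\<close>.
\<close>

section \<open>Interchanging integrals\<close>

lemma integrable_mult_pair:
  fixes f :: "'a \<Rightarrow> real" and g :: "'b \<Rightarrow> real"
  assumes "sigma_finite_measure M" "sigma_finite_measure N"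
    and f: "integrable M f" and g: "integrable N g"
  shows "integrable (M \<Otimes>\<^sub>M N) (\<lambda>(x, y). f x * g y)"
proof -
  interpret M: sigma_finite_measure M by fact
  interpret N: sigma_finite_measure N by fact
  interpret pair_sigma_finite M N ..
  have [measurable]: "f \<in> borel_measurable M" "g \<in> borel_measurable N"
    using f g by auto
  show ?thesis
  proof (rule Fubini_integrable)
    show "(\<lambda>(x, y). f x * g y) \<in> borel_measurable (M \<Otimes>\<^sub>M N)" by measurable
    show "integrable M (\<lambda>x. \<integral>y. norm (case (x, y) of (x, y) \<Rightarrow> f x * g y) \<partial>N)"
      using f by (simp add: abs_mult)
    show "AE x in M. integrable N (\<lambda>y. case (x, y) of (x, y) \<Rightarrow> f x * g y)"
      using g by simp
  qed
qed

lemma integrable_pair_dominated: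
  fixes F :: "'a \<Rightarrow> 'b \<Rightarrow> 'c::{banach, second_countable_topology}"
  assumes "sigma_finite_measure M" "sigma_finite_measure N"
    and F: "case_prod F \<in> borel_measurable (M \<Otimes>\<^sub>M N)"
    and f: "integrable M f" and g: "integrable N g"
    and le: "\<And>x y. norm (F x y) \<le> f x * g y"
  shows "integrable (M \<Otimes>\<^sub>M N) (case_prod F)"
  by (rule Bochner_Integration.integrable_bound[OF integrable_mult_pair[OF assms(1,2) f g] F])
     (auto intro!: AE_I2 order_trans[OF le])

lemma Fubini_dominated:
  fixes F :: "'a \<Rightarrow> 'b \<Rightarrow> 'c::{banach, second_countable_topology}"
  assumes "sigma_finite_measure M" "sigma_finite_measure N"
    and F: "case_prod F \<in> borel_measurable (M \<Otimes>\<^sub>M N)"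
    and f: "integrable M f" and g: "integrable N g"
    and le: "\<And>x y. norm (F x y) \<le> f x * g y"
  shows "(\<integral>x. (\<integral>y. F x y \<partial>N) \<partial>M) = (\<integral>y. (\<integral>x. F x y \<partial>M) \<partial>N)"
proof -
  interpret M: sigma_finite_measure M by fact
  interpret N: sigma_finite_measure N by fact
  interpret pair_sigma_finite M N ..
  show ?thesis
    by (rule Fubini_integral[symmetric]) (rule integrable_pair_dominated[OF assms])
qed

lemma integrable_indicator_Icc [simp]: "integrable lborel (indicator {a..b} :: real \<Rightarrow> real)"
  by (rule integrable_real_indicator) (auto simp: emeasure_lborel_Icc_eq)

lemma integrable_indicator_Ioc [simp]: "integrable lborel (indicator {a<..b} :: real \<Rightarrow> real)"
  by (rule Bochner_Integration.integrable_bound[OF integrable_indicator_Icc[of a b]]) (auto simp: indicator_def)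

section \<open>The Fejer kernel\<close>

text \<open>Away from \<open>0\<close> this is \<open>2 (1 - cos (T x)) / (T x\<^sup>2)\<close>. Defining it as the cosine transform of the
  triangle on \<open>[0, T]\<close> makes the frequency bound \<open>T\<close> visible and keeps all later
  frequency integrals on the positive half-line.\<close>

definition fejer :: "real \<Rightarrow> real \<Rightarrow> real" where
  "fejer T x = (\<integral>t. indicator {0..T} t * (2 * (1 - t / T) * cos (t * x)) \<partial>lborel)"

lemma fejer_eq:
  assumes T: "T > 0" and x: "x \<noteq> 0"
  shows "fejer T x = 2 * (1 - cos (T * x)) / (T * x^2)"
proof -
  let ?F = "\<lambda>t. 2 * (1 - t / T) * sin (t * x) / x - 2 * cos (t * x) / (T * x^2)"
  have "(\<integral>t. indicator {0..T} t *\<^sub>R (2 * (1 - t / T) * cos (t * x)) \<partial>lborel) = ?F T - ?F 0"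
  proof (rule integral_FTC_Icc)
    show "(?F has_vector_derivative 2 * (1 - t / T) * cos (t * x)) (at t within {0..T})" for t
      unfolding has_real_derivative_iff_has_vector_derivative[symmetric]
      using T x by (auto intro!: derivative_eq_intros simp: field_simps power2_eq_square)
    show "continuous_on {0..T} (\<lambda>t. 2 * (1 - t / T) * cos (t * x))"
      using T by (intro continuous_intros) auto
  qed (use T in auto)
  then show ?thesis
    using T x by (simp add: fejer_def field_simps)
qed

lemma fejer_scale:
  assumes T: "T > 0"
  shows "fejer T x = T * fejer 1 (T * x)"
proof -
  have "fejer T x = T * (\<integral>t. indicator {0..T} (0 + T * t) * (2 * (1 - (0 + T * t) / T) * cos ((0 + T * t) * x)) \<partial>lborel)"
    unfolding fejer_def using T
    by (subst lborel_integral_real_affine[of T _ 0]) auto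
  also have "(\<lambda>t. indicator {0..T} (0 + T * t) * (2 * (1 - (0 + T * t) / T) * cos ((0 + T * t) * x)))
     = (\<lambda>t. indicator {0..1} t * (2 * (1 - t / 1) * cos (t * (T * x))) :: real)"
    using T by (auto simp: fun_eq_iff indicator_def zero_le_mult_iff ac_simps)
  finally show ?thesis by (simp add: fejer_def)
qed

lemma fejer_1_bound: "\<bar>fejer 1 x\<bar> \<le> 2"
proof -
  have "\<bar>fejer 1 x\<bar> \<le> (\<integral>t. norm (indicator {0..1} t * (2 * (1 - t / 1) * cos (t * x))) \<partial>lborel)"
    unfolding fejer_def real_norm_def[symmetric] by (rule integral_norm_bound)
  also have "\<dots> \<le> (\<integral>t. indicator {0..1::real} t * 2 \<partial>lborel)"
  proof (rule Bochner_Integration.integral_mono)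
    show "integrable lborel (\<lambda>t. norm (indicator {0..1} t * (2 * (1 - t / 1) * cos (t * x)) :: real))"
      using borel_integrable_compact[of "{0..1::real}" "\<lambda>t. 2 * (1 - t / 1) * cos (t * x)"]
      by (intro integrable_norm) (simp add: continuous_intros)
    show "norm (indicator {0..1} t * (2 * (1 - t / 1) * cos (t * x))) \<le> indicator {0..1} t * 2" for t
      using mult_mono[of "\<bar>2 - 2 * t\<bar>" 2 "\<bar>cos (t * x)\<bar>" 1] by (auto simp: indicator_def abs_mult)
  qed simp
  also have "\<dots> = 2" by simp
  finally show ?thesis .
qed

lemma fejer_nonneg:
  assumes "T > 0" shows "fejer T x \<ge> 0"
proof -
  have "fejer 1 u \<ge> 0" for u
  proof (cases "u = 0")
    case True
    then show ?thesis unfolding fejer_def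
      by (intro Bochner_Integration.integral_nonneg) (auto simp: indicator_def)
  qed (auto simp: fejer_eq)
  then show ?thesis using fejer_scale[OF assms] assms by simp
qed

lemma fejer_measurable [measurable]: "fejer T \<in> borel_measurable borel"
  unfolding fejer_def by measurable

lemma fejer_1_integrable: "integrable lborel (fejer 1)"
proof (rule Bochner_Integration.integrable_bound)
  show "integrable lborel (\<lambda>x::real. 8 * inverse (1 + x^2))"
    using integrable_inverse_1_plus_square by (simp add: set_integrable_def)
  have "\<bar>fejer 1 x\<bar> \<le> 8 * inverse (1 + x^2)" for x
  proof (cases "\<bar>x\<bar> \<le> 1")
    case True
    then have "x^2 \<le> 1" by (simp add: abs_square_le_1)
    then have "2 \<le> 8 * inverse (1 + x^2)" by (simp add: field_simps add_pos_nonneg)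
    then show ?thesis using fejer_1_bound[of x] by linarith
  next
    case False
    then have x: "x \<noteq> 0" "x^2 > 1"
      using abs_square_le_1[of x] by (auto simp: not_le[symmetric])
    have "fejer 1 x \<le> 4 / x^2"
      using x cos_ge_minus_one[of x] unfolding fejer_eq[OF zero_less_one x(1)]
      by (simp add: divide_le_cancel, linarith)
    also have "\<dots> \<le> 8 * inverse (1 + x^2)"
      using x by (simp add: field_simps add_pos_nonneg)
    finally show ?thesis using fejer_nonneg[of 1 x] by simp
  qed
  then show "AE x in lborel. norm (fejer 1 x) \<le> norm (8 * inverse (1 + x^2))"
    by (auto intro!: AE_I2 order_trans[OF _ abs_ge_self])
qed simp

lemma fejer_integrable:
  assumes "T > 0"
  shows "integrable lborel (fejer T)"
proof -
  have "integrable lborel (\<lambda>x. T * fejer 1 (0 + T * x))"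
    using assms lborel_integrable_real_affine[OF fejer_1_integrable, of T 0] by simp
  then show ?thesis by (subst fejer_scale[OF assms, abs_def]) simp
qed

lemma fejer_integral:
  assumes "T > 0"
  shows "(\<integral>x. fejer T x \<partial>lborel) = (\<integral>x. fejer 1 x \<partial>lborel)"
  using lborel_integral_real_affine[of T "fejer 1" 0] assms
  by (simp add: fejer_scale[OF assms])

lemma fejer_integral_ball:
  assumes "T > 0"
  shows "(\<integral>x. indicator {-R/T..R/T} x * fejer T x \<partial>lborel) = (\<integral>x. indicator {-R..R} x * fejer 1 x \<partial>lborel)"
proof -
  have "(\<integral>x. indicator {-R..R} x * fejer 1 x \<partial>lborel)
     = (\<integral>x. T * (indicator {-R..R} (T * x) * fejer 1 (T * x)) \<partial>lborel)"
    using lborel_integral_real_affine[of T "\<lambda>x. indicator {-R..R} x * fejer 1 x" 0] assms by simp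
  also have "(\<lambda>x. T * (indicator {-R..R} (T * x) * fejer 1 (T * x)))
     = (\<lambda>x. indicator {-R/T..R/T} x * fejer T x)"
    using assms by (auto simp: fun_eq_iff fejer_scale[OF assms] indicator_def field_simps)
  finally show ?thesis by simp
qed

lemma fejer_mass_pos: "(\<integral>x. fejer 1 x \<partial>lborel) > 0"
proof (rule ccontr)
  assume "\<not> ?thesis"
  then have "(\<integral>x. fejer 1 x \<partial>lborel) = 0"
    using Bochner_Integration.integral_nonneg[of lborel "fejer 1"] fejer_nonneg[of 1]
    by (intro antisym) (auto simp: not_less)
  then have "AE x in lborel. fejer 1 x = 0"
    using integral_nonneg_eq_0_iff_AE[OF fejer_1_integrable] fejer_nonneg[of 1] by simp
  then have "AE x in lborel. x \<notin> {0<..<1::real}"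
  proof eventually_elim
    case (elim x)
    show ?case
    proof
      assume x: "x \<in> {0<..<1}"
      then have "cos x < cos 0"
        using pi_gt3 by (intro cos_monotone_0_pi) auto
      with x elim show False by (simp add: fejer_eq)
    qed
  qed
  then have "emeasure lborel {0<..<1::real} = 0"
    by (subst (asm) AE_iff_measurable[where N="{0<..<1}"]) auto
  then show False by simp
qed

text \<open>The proportion \<open>3/4\<close> leaves more mass inside \<open>[-R, R]\<close> than outside, which is what undoing
  the smoothing requires.\<close>

lemma fejer_concentration:
  obtains R where "R > 0"
    "(\<integral>x. indicator {-R..R} x * fejer 1 x \<partial>lborel) \<ge> 3 / 4 * (\<integral>x. fejer 1 x \<partial>lborel)"
proof -
  let ?c = "\<integral>x. fejer 1 x \<partial>lborel"
  have "(\<lambda>n. \<integral>x. indicator {-real n..real n} x * fejer 1 x \<partial>lborel) \<longlonglongrightarrow> ?c"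
  proof (rule integral_dominated_convergence[where w="fejer 1"])
    show "AE x in lborel. (\<lambda>n. indicator {-real n..real n} x * fejer 1 x) \<longlonglongrightarrow> fejer 1 x"
    proof (rule AE_I2)
      fix x :: real
      have "\<forall>\<^sub>F n in sequentially. indicator {-real n..real n} x * fejer 1 x = fejer 1 x"
        using eventually_ge_at_top[of "nat \<lceil>\<bar>x\<bar>\<rceil>"]
        by eventually_elim (auto simp: indicator_def)
      then show "(\<lambda>n. indicator {-real n..real n} x * fejer 1 x) \<longlonglongrightarrow> fejer 1 x"
        by (rule tendsto_eventually)
    qed
  qed (auto simp: fejer_1_integrable fejer_nonneg indicator_def)
  then have "\<forall>\<^sub>F n in sequentially. (\<integral>x. indicator {-real n..real n} x * fejer 1 x \<partial>lborel) > 3 / 4 * ?c"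
    by (rule order_tendstoD) (use fejer_mass_pos in simp)
  then have "\<forall>\<^sub>F n in sequentially. n > 0 \<and> (\<integral>x. indicator {-real n..real n} x * fejer 1 x \<partial>lborel) > 3 / 4 * ?c"
    using eventually_gt_at_top[of 0] by eventually_elim auto
  then obtain n where "n > 0" "(\<integral>x. indicator {-real n..real n} x * fejer 1 x \<partial>lborel) > 3 / 4 * ?c"
    using eventually_happens'[OF sequentially_bot] by blast
  then show ?thesis by (intro that[of "real n"]) auto
qed

section \<open>A smoothing inequality of Esseen type\<close>

lemma has_vector_derivative_iexp_scaled:
  "((\<lambda>x. iexp (c * x)) has_vector_derivative c *\<^sub>R (\<i> * iexp (c * x))) (at x within A)"
proof -
  have "((\<lambda>x. \<i> * of_real (c * x)) has_vector_derivative \<i> * of_real c) (at x within A)"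
    by (intro has_vector_derivative_mult_right has_vector_derivative_of_real)
       (auto intro!: derivative_eq_intros)
  from field_vector_diff_chain_within[OF this, of exp "iexp (c * x)"]
  show ?thesis
    by (auto simp: o_def scaleR_conv_of_real ac_simps intro: DERIV_exp has_field_derivative_at_within)
qed

lemma norm_interval_iexp_integral:
  fixes a b t :: real
  assumes t: "t > 0" and ab: "a \<le> b"
  shows "norm (\<integral>x. indicator {a<..b} x *\<^sub>R iexp (- (t * x)) \<partial>lborel) \<le> 2 / t"
proof -
  let ?F = "\<lambda>x. \<i> / t * iexp (- (t * x))"
  have "(\<integral>x. indicator {a<..b} x *\<^sub>R iexp (- (t * x)) \<partial>lborel) = (\<integral>x. indicator {a..b} x *\<^sub>R iexp (- (t * x)) \<partial>lborel)"
    using AE_lborel_singleton[of a]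
    by (intro integral_cong_AE) (auto elim!: eventually_mono simp: indicator_def)
  also have "\<dots> = ?F b - ?F a"
  proof (rule integral_FTC_Icc)
    show "(?F has_vector_derivative iexp (- (t * x))) (at x within {a..b})" for x
    proof -
      have "((\<lambda>x. \<i> / t * iexp (- (t * x))) has_vector_derivative (\<i> / t * ((- t) *\<^sub>R (\<i> * iexp (- (t * x)))))) (at x within {a..b})"
        using has_vector_derivative_iexp_scaled[of "-t" x] by (intro has_vector_derivative_mult_right) simp
      then show ?thesis using t by (simp add: scaleR_conv_of_real)
    qed
  qed (use ab in \<open>auto intro!: continuous_intros\<close>)
  finally have "norm (\<integral>x. indicator {a<..b} x *\<^sub>R iexp (- (t * x)) \<partial>lborel) \<le> norm (?F b) + norm (?F a)"
    by (simp add: norm_triangle_ineq4 del: of_real_mult of_real_minus)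
  also have "\<dots> = 2 / t" using t by (simp add: norm_mult norm_divide del: of_real_mult of_real_minus)
  finally show ?thesis .
qed

text \<open>Inserting the frequency representation of the kernel and exchanging the order of integration
  shows that the kernel only sees frequencies in \<open>[0, T]\<close> of the interval.\<close>

lemma fejer_interval_integral:
  fixes a b z T :: real
  assumes T: "T > 0"
  defines "E \<equiv> \<lambda>t. \<integral>x. indicator {a<..b} x *\<^sub>R iexp (- (t * x)) \<partial>lborel"
  shows "(\<integral>y. indicator {a<..b} (z + y) * fejer T y \<partial>lborel)
     = Re (\<integral>t. indicator {0..T} t *\<^sub>R ((2 * (1 - t / T)) *\<^sub>R (E t * iexp (t * z))) \<partial>lborel)"
proof -
  have fejer_Re: "of_real (fejer T y) = of_real (Re (\<integral>t. indicator {0..T} t *\<^sub>R ((2 * (1 - t / T)) *\<^sub>R iexp (- (t * y))) \<partial>lborel))" for y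
  proof -
    have "integrable lborel (\<lambda>t. indicator {0..T} t *\<^sub>R ((2 * (1 - t / T)) *\<^sub>R iexp (- (t * y))))"
      using T by (intro borel_integrable_compact) (auto intro!: continuous_intros)
    then show ?thesis
      by (subst integral_Re[symmetric]) (auto simp: fejer_def Re_exp ac_simps simp flip: of_real_mult of_real_minus)
  qed
  have int0: "integrable lborel (\<lambda>t. indicator {0..T} t * 2 :: real)" "integrable lborel (\<lambda>x. indicator {a<..b} x :: real)"
    by simp_all
  let ?K = "\<lambda>x t. (indicator {a<..b} x * indicator {0..T} t * (2 * (1 - t / T))) *\<^sub>R iexp (- (t * (x - z)))"
  have le: "norm (?K x t) \<le> indicator {a<..b} x * (indicator {0..T} t * 2)" for x t
  proof -
    have "\<bar>2 * (1 - t / T)\<bar> \<le> 2" if "0 \<le> t" "t \<le> T"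
      using T that by (auto simp: abs_le_iff field_simps)
    then show ?thesis
      by (auto simp: indicator_def abs_mult simp del: of_real_mult of_real_minus of_real_diff)
  qed
  have "(\<integral>y. indicator {a<..b} (z + y) * fejer T y \<partial>lborel) = (\<integral>x. indicator {a<..b} x * fejer T (x - z) \<partial>lborel)"
    using lborel_integral_real_affine[of 1 "\<lambda>x. indicator {a<..b} x * fejer T (x - z)" z] by simp
  also have "\<dots> = (\<integral>x. Re (\<integral>t. ?K x t \<partial>lborel) \<partial>lborel)"
  proof (rule Bochner_Integration.integral_cong)
    fix x
    have "indicator {a<..b} x * fejer T (x - z) = indicator {a<..b} x * Re (\<integral>t. indicator {0..T} t *\<^sub>R ((2 * (1 - t / T)) *\<^sub>R iexp (- (t * (x - z)))) \<partial>lborel)"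
      using fejer_Re[of "x - z"] by (simp only: of_real_eq_iff)
    also have "\<dots> = Re (\<integral>t. indicator {a<..b} x *\<^sub>R (indicator {0..T} t *\<^sub>R ((2 * (1 - t / T)) *\<^sub>R iexp (- (t * (x - z))))) \<partial>lborel)"
      by (subst integral_scaleR_right) simp
    finally show "indicator {a<..b} x * fejer T (x - z) = Re (\<integral>t. ?K x t \<partial>lborel)"
      by (simp only: scaleR_scaleR mult.assoc)
  qed simp
  also have "\<dots> = Re (\<integral>x. (\<integral>t. ?K x t \<partial>lborel) \<partial>lborel)"
  proof (rule integral_Re)
    have "integrable (lborel \<Otimes>\<^sub>M lborel) (\<lambda>(x, t). ?K x t)"
      by (rule integrable_pair_dominated[OF lborel.sigma_finite_measure_axioms lborel.sigma_finite_measure_axioms _ int0(2,1) le]) measurable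
    then show "integrable lborel (\<lambda>x. \<integral>t. ?K x t \<partial>lborel)"
      by (rule lborel_pair.integrable_fst)
  qed
  also have "(\<integral>x. (\<integral>t. ?K x t \<partial>lborel) \<partial>lborel) = (\<integral>t. (\<integral>x. ?K x t \<partial>lborel) \<partial>lborel)"
    by (rule Fubini_dominated[OF lborel.sigma_finite_measure_axioms lborel.sigma_finite_measure_axioms _ int0(2,1) le]) measurable
  also have "\<dots> = (\<integral>t. indicator {0..T} t *\<^sub>R ((2 * (1 - t / T)) *\<^sub>R (E t * iexp (t * z))) \<partial>lborel)"
  proof (rule Bochner_Integration.integral_cong)
    fix t
    have "?K x t = (indicator {0..T} t * (2 * (1 - t / T))) *\<^sub>R (iexp (t * z) * (indicator {a<..b} x *\<^sub>R iexp (- (t * x))))" for x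
      by (simp add: algebra_simps scaleR_conv_of_real flip: exp_add)
    then have "(\<integral>x. ?K x t \<partial>lborel) = (\<integral>x. (indicator {0..T} t * (2 * (1 - t / T))) *\<^sub>R (iexp (t * z) * (indicator {a<..b} x *\<^sub>R iexp (- (t * x)))) \<partial>lborel)"
      by (simp only:)
    also have "\<dots> = (indicator {0..T} t * (2 * (1 - t / T))) *\<^sub>R (iexp (t * z) * E t)"
      unfolding E_def by (subst integral_scaleR_right, subst integral_mult_right_zero) simp
    finally show "(\<integral>x. ?K x t \<partial>lborel) = indicator {0..T} t *\<^sub>R ((2 * (1 - t / T)) *\<^sub>R (E t * iexp (t * z)))"
      by (simp add: mult.commute)
  qed simp
  finally show ?thesis .
qed

text \<open>A Parseval identity on \<open>[0, T]\<close>. The weight \<open>c\<close> over a reference measure \<open>\<nu>\<close> covers both sides of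
  the later comparison: a probability law (\<open>c = 1\<close>) and a signed density over Lebesgue measure.\<close>

lemma fejer_smoothed_increment:
  fixes c :: "real \<Rightarrow> real" and a b T :: real
  assumes T: "T > 0" and nu: "sigma_finite_measure \<nu>" and sets [measurable_cong]: "sets \<nu> = sets borel"
    and c: "integrable \<nu> c"
  defines "E \<equiv> \<lambda>t. \<integral>x. indicator {a<..b} x *\<^sub>R iexp (- (t * x)) \<partial>lborel"
  shows "(\<integral>y. fejer T y * (\<integral>z. c z * indicator {a - y<..b - y} z \<partial>\<nu>) \<partial>lborel)
     = Re (\<integral>t. indicator {0..T} t *\<^sub>R ((2 * (1 - t / T)) *\<^sub>R (E t * (\<integral>z. c z *\<^sub>R iexp (t * z) \<partial>\<nu>))) \<partial>lborel)"
proof -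
  have [measurable]: "c \<in> borel_measurable \<nu>" using c by auto
  have fej: "integrable lborel (\<lambda>y. \<bar>fejer T y\<bar>)" using fejer_integrable[OF T] by simp
  have cabs: "integrable \<nu> (\<lambda>z. \<bar>c z\<bar>)" using c by simp
  have E_le: "norm (E t) \<le> \<bar>b - a\<bar>" for t
  proof -
    have "norm (E t) \<le> (\<integral>x. norm (indicator {a<..b} x *\<^sub>R iexp (- (t * x))) \<partial>lborel)"
      unfolding E_def by (rule integral_norm_bound)
    also have "\<dots> = (\<integral>x. indicator {a<..b} x \<partial>lborel)"
      by (rule Bochner_Integration.integral_cong) (auto simp del: of_real_mult of_real_minus)
    also have "\<dots> \<le> \<bar>b - a\<bar>" by (cases "a \<le> b") auto
    finally show ?thesis .
  qed
  have [measurable]: "E \<in> borel_measurable borel" unfolding E_def by measurable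
  have int0: "integrable lborel (\<lambda>t. indicator {0..T} t * (2 * \<bar>b - a\<bar>) :: real)"
    by simp
  let ?K = "\<lambda>z t. (indicator {0..T} t * (2 * (1 - t / T)) * c z) *\<^sub>R (E t * iexp (t * z))"
  have le: "norm (?K z t) \<le> \<bar>c z\<bar> * (indicator {0..T} t * (2 * \<bar>b - a\<bar>))" for z t
  proof -
    have "norm (?K z t) = \<bar>c z\<bar> * (indicator {0..T} t * (2 * (1 - t / T) * norm (E t)))"
    proof -
      have "\<bar>2 * (1 - t / T)\<bar> = 2 * (1 - t / T)" if "0 \<le> t" "t \<le> T"
        using T that by (auto simp: field_simps)
      then show ?thesis
        by (simp add: indicator_def norm_mult abs_mult del: of_real_mult of_real_minus)
    qed
    also have "\<dots> \<le> \<bar>c z\<bar> * (indicator {0..T} t * (2 * \<bar>b - a\<bar>))"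
    proof (rule mult_left_mono)
      show "indicator {0..T} t * (2 * (1 - t / T) * norm (E t)) \<le> indicator {0..T} t * (2 * \<bar>b - a\<bar>)"
        using T E_le[of t] mult_mono[of "2 * (1 - t / T)" 2 "norm (E t)" "\<bar>b - a\<bar>"]
        by (auto simp: indicator_def)
    qed auto
    finally show ?thesis .
  qed
  have "(\<integral>y. fejer T y * (\<integral>z. c z * indicator {a - y<..b - y} z \<partial>\<nu>) \<partial>lborel)
      = (\<integral>y. (\<integral>z. fejer T y * (c z * indicator {a<..b} (z + y)) \<partial>\<nu>) \<partial>lborel)"
    by (auto intro!: Bochner_Integration.integral_cong simp: indicator_def algebra_simps simp flip: integral_mult_right_zero)
  also have "\<dots> = (\<integral>z. (\<integral>y. fejer T y * (c z * indicator {a<..b} (z + y)) \<partial>lborel) \<partial>\<nu>)"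
    by (rule Fubini_dominated[OF lborel.sigma_finite_measure_axioms nu _ fej cabs])
       (auto simp: abs_mult indicator_def)
  also have "\<dots> = (\<integral>z. Re (\<integral>t. ?K z t \<partial>lborel) \<partial>\<nu>)"
  proof (rule Bochner_Integration.integral_cong)
    fix z
    have "(\<integral>y. fejer T y * (c z * indicator {a<..b} (z + y)) \<partial>lborel) = (\<integral>y. c z * (indicator {a<..b} (z + y) * fejer T y) \<partial>lborel)"
      by (simp add: ac_simps)
    also have "\<dots> = c z * Re (\<integral>t. indicator {0..T} t *\<^sub>R ((2 * (1 - t / T)) *\<^sub>R (E t * iexp (t * z))) \<partial>lborel)"
      unfolding E_def by (subst fejer_interval_integral[OF T, symmetric]) simp
    also have "\<dots> = Re (\<integral>t. c z *\<^sub>R (indicator {0..T} t *\<^sub>R ((2 * (1 - t / T)) *\<^sub>R (E t * iexp (t * z)))) \<partial>lborel)"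
      by (subst integral_scaleR_right) simp
    finally show "(\<integral>y. fejer T y * (c z * indicator {a<..b} (z + y)) \<partial>lborel) = Re (\<integral>t. ?K z t \<partial>lborel)"
      by (simp add: ac_simps)
  qed simp
  also have "\<dots> = Re (\<integral>z. (\<integral>t. ?K z t \<partial>lborel) \<partial>\<nu>)"
  proof (rule integral_Re)
    interpret nu: sigma_finite_measure \<nu> by fact
    interpret pair_sigma_finite \<nu> lborel ..
    have "integrable (\<nu> \<Otimes>\<^sub>M lborel) (\<lambda>(z, t). ?K z t)"
      by (rule integrable_pair_dominated[OF nu lborel.sigma_finite_measure_axioms _ cabs int0 le]) measurable
    then show "integrable \<nu> (\<lambda>z. \<integral>t. ?K z t \<partial>lborel)"
      by (rule integrable_fst)
  qed
  also have "(\<integral>z. (\<integral>t. ?K z t \<partial>lborel) \<partial>\<nu>) = (\<integral>t. (\<integral>z. ?K z t \<partial>\<nu>) \<partial>lborel)"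
    by (rule Fubini_dominated[OF nu lborel.sigma_finite_measure_axioms _ cabs int0 le]) measurable
  also have "\<dots> = (\<integral>t. indicator {0..T} t *\<^sub>R ((2 * (1 - t / T)) *\<^sub>R (E t * (\<integral>z. c z *\<^sub>R iexp (t * z) \<partial>\<nu>))) \<partial>lborel)"
  proof (rule Bochner_Integration.integral_cong)
    fix t
    have "?K z t = (indicator {0..T} t * (2 * (1 - t / T))) *\<^sub>R (E t * (c z *\<^sub>R iexp (t * z)))" for z
      by (simp add: mult.assoc)
    then have "(\<integral>z. ?K z t \<partial>\<nu>) = (\<integral>z. (indicator {0..T} t * (2 * (1 - t / T))) *\<^sub>R (E t * (c z *\<^sub>R iexp (t * z))) \<partial>\<nu>)"
      by (simp only:)
    also have "\<dots> = (indicator {0..T} t * (2 * (1 - t / T))) *\<^sub>R (E t * (\<integral>z. c z *\<^sub>R iexp (t * z) \<partial>\<nu>))"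
      by (subst integral_scaleR_right, subst integral_mult_right_zero) simp
    finally show "(\<integral>z. ?K z t \<partial>\<nu>) = indicator {0..T} t *\<^sub>R ((2 * (1 - t / T)) *\<^sub>R (E t * (\<integral>z. c z *\<^sub>R iexp (t * z) \<partial>\<nu>)))"
      by simp
  qed simp
  finally show ?thesis .
qed

lemma fejer_minus: "fejer T (- x) = fejer T x"
  by (simp add: fejer_def)

text \<open>If \<open>D\<close> drops at rate at most \<open>m\<close>, then a large value at \<open>x\<close> persists to the right of \<open>x\<close>. Averaging
  around \<open>x + R/T\<close> therefore sees a value close to \<open>D x\<close> on three quarters of the kernel mass, and the
  remaining quarter costs at most a quarter of \<open>\<eta>\<close>.\<close>

lemma fejer_desmoothing_upper:
  fixes D :: "real \<Rightarrow> real"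
  assumes T: "T > 0" and R: "R > 0"
    and conc: "(\<integral>x. indicator {-R..R} x * fejer 1 x \<partial>lborel) \<ge> 3 / 4 * (\<integral>x. fejer 1 x \<partial>lborel)"
    and D [measurable]: "D \<in> borel_measurable borel" and bound: "\<And>x. \<bar>D x\<bar> \<le> \<eta>"
    and drop: "\<And>x y. x \<le> y \<Longrightarrow> D x - m * (y - x) \<le> D y" and m: "m \<ge> 0"
    and B: "\<And>x. (\<integral>y. fejer T y * D (x - y) \<partial>lborel) \<le> B" "B \<ge> 0"
  shows "D x \<le> 4 / 3 * (B / (\<integral>x. fejer 1 x \<partial>lborel)) + 2 * m * (R / T) + \<eta> / 3"
proof -
  define c where "c = (\<integral>x. fejer 1 x \<partial>lborel)"
  define \<delta> where "\<delta> = R / T"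
  define I where "I = (\<integral>y. indicator {-\<delta>..\<delta>} y * fejer T y \<partial>lborel)"
  have c: "c > 0" unfolding c_def by (rule fejer_mass_pos)
  have \<delta>: "\<delta> > 0" using R T by (simp add: \<delta>_def)
  have \<eta>: "\<eta> \<ge> 0" using bound[of 0] by linarith
  have I: "I \<ge> 3 / 4 * c"
    using conc fejer_integral_ball[OF T, of R] by (simp add: I_def c_def \<delta>_def)
  have kint: "integrable lborel (fejer T)" by (rule fejer_integrable[OF T])
  have kint2: "integrable lborel (\<lambda>y. indicator {-\<delta>..\<delta>} y * fejer T y)"
    by (rule Bochner_Integration.integrable_bound[OF kint]) (auto simp: indicator_def)
  have c_eq: "(\<integral>y. fejer T y \<partial>lborel) = c" unfolding c_def by (rule fejer_integral[OF T])
  have kD: "integrable lborel (\<lambda>y. fejer T y * D (x + \<delta> - y))"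
  proof (rule Bochner_Integration.integrable_bound)
    show "integrable lborel (\<lambda>y. \<eta> * fejer T y)" using kint by simp
    show "AE y in lborel. norm (fejer T y * D (x + \<delta> - y)) \<le> norm (\<eta> * fejer T y)"
      using bound \<eta> by (auto simp: abs_mult mult.commute[of \<eta>] intro!: AE_I2 mult_left_mono)
  qed simp
  have "(D x - 2 * m * \<delta>) * I - \<eta> * (c - I)
     = (\<integral>y. (D x - 2 * m * \<delta>) * (indicator {-\<delta>..\<delta>} y * fejer T y) - \<eta> * (fejer T y - indicator {-\<delta>..\<delta>} y * fejer T y) \<partial>lborel)"
    using kint kint2 by (simp add: c_eq I_def)
  also have "\<dots> \<le> (\<integral>y. fejer T y * D (x + \<delta> - y) \<partial>lborel)"
  proof (rule Bochner_Integration.integral_mono)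
    fix y
    have k: "fejer T y \<ge> 0" by (rule fejer_nonneg[OF T])
    show "(D x - 2 * m * \<delta>) * (indicator {-\<delta>..\<delta>} y * fejer T y) - \<eta> * (fejer T y - indicator {-\<delta>..\<delta>} y * fejer T y)
       \<le> fejer T y * D (x + \<delta> - y)"
    proof (cases "y \<in> {-\<delta>..\<delta>}")
      case True
      then have "m * (\<delta> - y) \<le> m * (2 * \<delta>)" using m by (intro mult_left_mono) auto
      moreover have "D x - m * (\<delta> - y) \<le> D (x + \<delta> - y)"
        using drop[of x "x + \<delta> - y"] True by (simp add: algebra_simps)
      ultimately have "D x - 2 * m * \<delta> \<le> D (x + \<delta> - y)" by linarith
      then show ?thesis using True k by (simp add: mult.commute mult_left_mono)
    next
      case False
      have "- \<eta> \<le> D (x + \<delta> - y)" using bound[of "x + \<delta> - y"] by linarith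
      then have "fejer T y * (- \<eta>) \<le> fejer T y * D (x + \<delta> - y)" using k by (intro mult_left_mono)
      then show ?thesis using False by (simp add: mult.commute)
    qed
  qed (use kint kint2 kD in auto)
  also have "\<dots> \<le> B" by (rule B)
  finally have main: "(D x - 2 * m * \<delta>) * I - \<eta> * (c - I) \<le> B" .
  have "D x - 2 * m * \<delta> \<le> 4 / 3 * (B / c) + \<eta> / 3"
  proof (cases "D x - 2 * m * \<delta> \<ge> 0")
    case True
    then have "(D x - 2 * m * \<delta>) * (3 / 4 * c) \<le> (D x - 2 * m * \<delta>) * I"
      using I by (intro mult_left_mono)
    moreover have "\<eta> * (c - I) \<le> \<eta> * (c / 4)" using I \<eta> by (intro mult_left_mono) auto
    ultimately have "(D x - 2 * m * \<delta>) * (3 / 4 * c) \<le> B + \<eta> * (c / 4)" using main by linarith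
    then show ?thesis using c by (simp add: field_simps)
  next
    case False
    moreover have "0 \<le> B / c" using c B(2) by simp
    ultimately show ?thesis using \<eta> by linarith
  qed
  then show ?thesis unfolding c_def \<delta>_def by simp
qed

text \<open>The one-sided bound applies to \<open>D\<close> and to its point reflection \<open>\<lambda>x. - D (- x)\<close>, so the supremum \<open>\<eta>\<close> of
  \<open>\<bar>D\<bar>\<close> is at most the bound plus \<open>\<eta> / 3\<close>; solving for \<open>\<eta>\<close> gives the claim.\<close>

lemma fejer_desmoothing:
  fixes D :: "real \<Rightarrow> real"
  assumes T: "T > 0" and R: "R > 0"
    and conc: "(\<integral>x. indicator {-R..R} x * fejer 1 x \<partial>lborel) \<ge> 3 / 4 * (\<integral>x. fejer 1 x \<partial>lborel)"
    and D [measurable]: "D \<in> borel_measurable borel" and bound: "\<And>x. \<bar>D x\<bar> \<le> K"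
    and drop: "\<And>x y. x \<le> y \<Longrightarrow> D x - m * (y - x) \<le> D y" and m: "m \<ge> 0"
    and B: "\<And>x. \<bar>\<integral>y. fejer T y * D (x - y) \<partial>lborel\<bar> \<le> B"
  shows "\<bar>D x\<bar> \<le> 2 * (B / (\<integral>x. fejer 1 x \<partial>lborel)) + 3 * m * (R / T)"
proof -
  define \<eta> where "\<eta> = (SUP x. \<bar>D x\<bar>)"
  have bdd: "bdd_above (range (\<lambda>x. \<bar>D x\<bar>))" using bound by (auto intro!: bdd_aboveI)
  have le_\<eta>: "\<bar>D x\<bar> \<le> \<eta>" for x unfolding \<eta>_def by (intro cSUP_upper bdd) auto
  have B0: "B \<ge> 0" using B[of 0] by linarith
  let ?b = "4 / 3 * (B / (\<integral>x. fejer 1 x \<partial>lborel)) + 2 * m * (R / T) + \<eta> / 3"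
  have 1: "D x \<le> ?b" for x
    by (rule fejer_desmoothing_upper[OF T R conc D le_\<eta> drop m _ B0]) (use B abs_le_D1 in blast)+
  have 2: "- D (- x) \<le> ?b" for x
  proof (rule fejer_desmoothing_upper[OF T R conc, where D="\<lambda>x. - D (- x)"])
    show "(\<lambda>x. - D (- x)) \<in> borel_measurable borel" by measurable
    show "\<bar>- D (- x)\<bar> \<le> \<eta>" for x using le_\<eta>[of "-x"] by simp
    show "- D (- x) - m * (y - x) \<le> - D (- y)" if "x \<le> y" for x y
      using drop[of "-y" "-x"] that by simp
    show "(\<integral>y. fejer T y * - D (- (x - y)) \<partial>lborel) \<le> B" for x
    proof -
      have "(\<integral>y. fejer T y * - D (- (x - y)) \<partial>lborel) = (\<integral>y. fejer T (- y) * - D (- (x + y)) \<partial>lborel)"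
        using lborel_integral_real_affine[of "-1" "\<lambda>y. fejer T y * - D (- (x - y))" 0] by simp
      also have "\<dots> = - (\<integral>y. fejer T y * D (- x - y) \<partial>lborel)"
        by (simp add: fejer_minus)
      also have "\<dots> \<le> B" using B[of "-x"] by linarith
      finally show ?thesis .
    qed
  qed (use m B0 in auto)
  have "\<bar>D x\<bar> \<le> ?b" for x using 1[of x] 2[of "-x"] by simp
  then have "\<eta> \<le> ?b" unfolding \<eta>_def[symmetric] by (subst \<eta>_def) (intro cSUP_least, auto)
  with le_\<eta>[of x] show ?thesis by linarith
qed

text \<open>The transform of an interval is at most \<open>2 / t\<close> at frequency \<open>t\<close>, whatever its end points. Together
  with the Parseval identity this bounds every increment of the smoothed difference.\<close>

lemma smoothing_increment_bound:
  fixes \<gamma> :: "real \<Rightarrow> real"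
  assumes H: "real_distribution H" and \<gamma>: "integrable lborel \<gamma>" and T: "T > 0" and ab: "a \<le> b"
    and q: "integrable lborel (\<lambda>t. indicator {0..T} t * q t)"
    and diff: "\<And>t. 0 < t \<Longrightarrow> t \<le> T \<Longrightarrow> norm (char H t - (\<integral>x. \<gamma> x *\<^sub>R iexp (t * x) \<partial>lborel)) \<le> t * q t"
  defines "D \<equiv> \<lambda>x. cdf H x - (\<integral>z. \<gamma> z * indicator {..x} z \<partial>lborel)"
  shows "\<bar>(\<integral>y. fejer T y * (D (b - y) - D (a - y)) \<partial>lborel)\<bar> \<le> 4 * (\<integral>t. indicator {0..T} t * q t \<partial>lborel)"
proof -
  interpret H: real_distribution H by fact
  have [measurable_cong]: "sets H = sets borel" by simp
  let ?g = "\<lambda>t. \<integral>x. \<gamma> x *\<^sub>R iexp (t * x) \<partial>lborel"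
  define E where "E t = (\<integral>x. indicator {a<..b} x *\<^sub>R iexp (- (t * x)) \<partial>lborel)" for t
  have [measurable]: "E \<in> borel_measurable borel" unfolding E_def by measurable
  have [measurable]: "\<gamma> \<in> borel_measurable borel" using \<gamma> by auto
  have E_le: "norm (E t) \<le> b - a" for t
  proof -
    have "norm (E t) \<le> (\<integral>x. norm (indicator {a<..b} x *\<^sub>R iexp (- (t * x))) \<partial>lborel)"
      unfolding E_def by (rule integral_norm_bound)
    also have "\<dots> = (\<integral>x. indicator {a<..b} x \<partial>lborel)"
      by (rule Bochner_Integration.integral_cong) (auto simp del: of_real_mult of_real_minus)
    also have "\<dots> = b - a" using ab by simp
    finally show ?thesis .
  qed
  have w: "\<bar>2 * (1 - t / T)\<bar> \<le> 2" if "t \<in> {0..T}" for t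
    using T that by (auto simp: abs_le_iff field_simps)
  have g_le: "norm (?g t) \<le> (\<integral>x. \<bar>\<gamma> x\<bar> \<partial>lborel)" for t
    by (rule order_trans[OF integral_norm_bound]) (simp del: of_real_mult)
  have g_meas [measurable]: "?g \<in> borel_measurable borel" by measurable
  let ?F = "\<lambda>u t. indicator {0..T} t *\<^sub>R ((2 * (1 - t / T)) *\<^sub>R (E t * u t))"
  have int: "integrable lborel (?F u)" if [measurable]: "u \<in> borel_measurable borel" and "\<And>t. norm (u t) \<le> C" for u :: "real \<Rightarrow> complex" and C
  proof (rule Bochner_Integration.integrable_bound)
    show "integrable lborel (\<lambda>t. (2 * ((b - a) * C)) * indicator {0..T} t)" by simp
    show "AE t in lborel. norm (?F u t) \<le> norm ((2 * ((b - a) * C)) * indicator {0..T} t)"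
    proof (rule AE_I2)
      fix t
      have C: "C \<ge> 0" using that(2)[of 0] norm_ge_zero order_trans by blast
      have "norm (E t) * norm (u t) \<le> (b - a) * C" using E_le that(2) ab by (intro mult_mono) auto
      then show "norm (?F u t) \<le> norm ((2 * ((b - a) * C)) * indicator {0..T} t)"
        using w[of t] ab C by (auto simp: indicator_def norm_mult abs_mult intro!: mult_mono)
    qed
  qed measurable
  have kint: "integrable lborel (fejer T)" by (rule fejer_integrable[OF T])
  have cdf_inc: "cdf H (b - y) - cdf H (a - y) = (\<integral>z. 1 * indicator {a - y<..b - y} z \<partial>H)" for y
    using ab by (cases "a = b") (simp_all add: H.cdf_diff_eq)
  have g_inc: "(\<integral>z. \<gamma> z * indicator {..b - y} z \<partial>lborel) - (\<integral>z. \<gamma> z * indicator {..a - y} z \<partial>lborel)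
     = (\<integral>z. \<gamma> z * indicator {a - y<..b - y} z \<partial>lborel)" for y
  proof -
    have i: "integrable lborel (\<lambda>z. \<gamma> z * indicator {..x} z)" for x :: real
      by (rule Bochner_Integration.integrable_bound[OF \<gamma>]) (auto simp: indicator_def)
    show ?thesis using ab
      by (subst Bochner_Integration.integral_diff[OF i i, symmetric])
         (auto intro!: Bochner_Integration.integral_cong simp: indicator_def)
  qed
  have [measurable]: "cdf H \<in> borel_measurable borel"
    by (intro borel_measurable_mono) (auto simp: mono_def H.cdf_nondecreasing)
  have int1: "integrable lborel (\<lambda>y. fejer T y * (\<integral>z. 1 * indicator {a - y<..b - y} z \<partial>H))"
  proof (rule Bochner_Integration.integrable_bound[OF kint])
    show "(\<lambda>y. fejer T y * (\<integral>z. 1 * indicator {a - y<..b - y} z \<partial>H)) \<in> borel_measurable lborel"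
      unfolding cdf_inc[symmetric] by measurable
    show "AE y in lborel. norm (fejer T y * (\<integral>z. 1 * indicator {a - y<..b - y} z \<partial>H)) \<le> norm (fejer T y)"
      by (auto simp: abs_mult intro!: AE_I2 mult_left_le)
  qed
  have int2: "integrable lborel (\<lambda>y. fejer T y * (\<integral>z. \<gamma> z * indicator {a - y<..b - y} z \<partial>lborel))"
  proof (rule Bochner_Integration.integrable_bound)
    show "integrable lborel (\<lambda>y. (\<integral>x. \<bar>\<gamma> x\<bar> \<partial>lborel) * fejer T y)" using kint by simp
    have "(\<lambda>y. fejer T y * (\<integral>z. \<gamma> z * (if a < z + y \<and> z + y \<le> b then 1 else 0) \<partial>lborel)) \<in> borel_measurable lborel"
      by measurable
    also have "(\<lambda>y. fejer T y * (\<integral>z. \<gamma> z * (if a < z + y \<and> z + y \<le> b then 1 else 0) \<partial>lborel)) = (\<lambda>y. fejer T y * (\<integral>z. \<gamma> z * indicator {a - y<..b - y} z \<partial>lborel))"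
      by (auto simp: fun_eq_iff indicator_def algebra_simps intro!: Bochner_Integration.integral_cong)
    finally show "(\<lambda>y. fejer T y * (\<integral>z. \<gamma> z * indicator {a - y<..b - y} z \<partial>lborel)) \<in> borel_measurable lborel" .
    have "\<bar>\<integral>z. \<gamma> z * indicator {a - y<..b - y} z \<partial>lborel\<bar> \<le> (\<integral>x. \<bar>\<gamma> x\<bar> \<partial>lborel)" for y
    proof -
      have "\<bar>\<integral>z. \<gamma> z * indicator {a - y<..b - y} z \<partial>lborel\<bar> \<le> (\<integral>z. norm (\<gamma> z * indicator {a - y<..b - y} z) \<partial>lborel)"
        unfolding real_norm_def[symmetric] by (rule integral_norm_bound)
      also have "\<dots> \<le> (\<integral>x. \<bar>\<gamma> x\<bar> \<partial>lborel)"
        by (rule integral_mono_AE'[OF integrable_abs[OF \<gamma>]]) (auto simp: indicator_def)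
      finally show ?thesis .
    qed
    then show "AE y in lborel. norm (fejer T y * (\<integral>z. \<gamma> z * indicator {a - y<..b - y} z \<partial>lborel)) \<le> norm ((\<integral>x. \<bar>\<gamma> x\<bar> \<partial>lborel) * fejer T y)"
      by (auto simp: abs_mult mult.commute intro!: AE_I2 mult_right_mono mult_left_mono)
  qed
  have "(\<integral>y. fejer T y * (D (b - y) - D (a - y)) \<partial>lborel)
      = (\<integral>y. fejer T y * (\<integral>z. 1 * indicator {a - y<..b - y} z \<partial>H) - fejer T y * (\<integral>z. \<gamma> z * indicator {a - y<..b - y} z \<partial>lborel) \<partial>lborel)"
    unfolding D_def cdf_inc[symmetric] g_inc[symmetric] by (simp add: algebra_simps)
  also have "\<dots> = (\<integral>y. fejer T y * (\<integral>z. 1 * indicator {a - y<..b - y} z \<partial>H) \<partial>lborel) - (\<integral>y. fejer T y * (\<integral>z. \<gamma> z * indicator {a - y<..b - y} z \<partial>lborel) \<partial>lborel)"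
    by (rule Bochner_Integration.integral_diff[OF int1 int2])
  also have "(\<integral>y. fejer T y * (\<integral>z. 1 * indicator {a - y<..b - y} z \<partial>H) \<partial>lborel) = Re (\<integral>t. ?F (char H) t \<partial>lborel)"
    unfolding E_def using fejer_smoothed_increment[OF T H.sigma_finite_measure_axioms, of "\<lambda>_. 1" a b]
    by (simp add: char_def)
  also have "(\<integral>y. fejer T y * (\<integral>z. \<gamma> z * indicator {a - y<..b - y} z \<partial>lborel) \<partial>lborel) = Re (\<integral>t. ?F ?g t \<partial>lborel)"
    unfolding E_def by (rule fejer_smoothed_increment[OF T lborel.sigma_finite_measure_axioms _ \<gamma>]) simp
  also have "Re (\<integral>t. ?F (char H) t \<partial>lborel) - Re (\<integral>t. ?F ?g t \<partial>lborel)
      = Re (\<integral>t. ?F (char H) t - ?F ?g t \<partial>lborel)"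
    using int[OF H.char_measurable H.cmod_char_le_1] int[OF g_meas g_le] by simp
  finally have "\<bar>(\<integral>y. fejer T y * (D (b - y) - D (a - y)) \<partial>lborel)\<bar> \<le> norm (\<integral>t. ?F (char H) t - ?F ?g t \<partial>lborel)"
    by (simp add: abs_Re_le_cmod)
  also have "\<dots> \<le> (\<integral>t. norm (?F (char H) t - ?F ?g t) \<partial>lborel)" by (rule integral_norm_bound)
  also have "\<dots> \<le> (\<integral>t. 4 * (indicator {0..T} t * q t) \<partial>lborel)"
  proof (rule integral_mono_AE)
    show "integrable lborel (\<lambda>t. norm (?F (char H) t - ?F ?g t))"
      using int[OF H.char_measurable H.cmod_char_le_1] int[OF g_meas g_le] by (intro integrable_norm Bochner_Integration.integrable_diff)
    show "integrable lborel (\<lambda>t. 4 * (indicator {0..T} t * q t))" using q by simp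
    show "AE t in lborel. norm (?F (char H) t - ?F ?g t) \<le> 4 * (indicator {0..T} t * q t)"
      using AE_lborel_singleton[of 0]
    proof eventually_elim
      case (elim t)
      show ?case
      proof (cases "t \<in> {0..T}")
        case True
        with elim have t: "0 < t" "t \<le> T" by auto
        have "norm (?F (char H) t - ?F ?g t) = \<bar>2 * (1 - t / T)\<bar> * (norm (E t) * norm (char H t - ?g t))"
          using True by (simp add: scaleR_diff_right[symmetric] right_diff_distrib[symmetric] norm_mult del: of_real_mult)
        also have "\<dots> \<le> 2 * ((2 / t) * (t * q t))"
          using norm_interval_iexp_integral[OF t(1) ab] diff[OF t] w[OF True] t
          by (intro mult_mono) (auto simp: E_def intro!: mult_nonneg_nonneg)
        also have "\<dots> = 4 * (indicator {0..T} t * q t)" using t True by simp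
        finally show ?thesis .
      qed simp
    qed
  qed
  finally show ?thesis by simp
qed

text \<open>The increments of the smoothed difference are bounded uniformly in the left end point, and the
  difference vanishes at \<open>- \<infinity>\<close>; so the smoothed difference itself is bounded, and the smoothing can be
  undone because \<open>\<gamma>\<close>, the density of the approximating function, is bounded by \<open>m\<close>.\<close>

theorem esseen_smoothing:
  obtains K where "K > 0"
    "\<And>H \<gamma> m T q x. \<lbrakk>real_distribution H; integrable lborel \<gamma>; \<And>x. \<bar>\<gamma> x\<bar> \<le> m; T > 0;
       integrable lborel (\<lambda>t. indicator {0..T} t * q t);
       \<And>t. 0 < t \<Longrightarrow> t \<le> T \<Longrightarrow> norm (char H t - (\<integral>x. \<gamma> x *\<^sub>R iexp (t * x) \<partial>lborel)) \<le> t * q t\<rbrakk>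
      \<Longrightarrow> \<bar>cdf H x - (\<integral>z. \<gamma> z * indicator {..x} z \<partial>lborel)\<bar> \<le> K * ((\<integral>t. indicator {0..T} t * q t \<partial>lborel) + m / T)"
proof -
  obtain R where R: "R > 0"
    "(\<integral>x. indicator {-R..R} x * fejer 1 x \<partial>lborel) \<ge> 3 / 4 * (\<integral>x. fejer 1 x \<partial>lborel)"
    by (rule fejer_concentration)
  define c where "c = (\<integral>x. fejer 1 x \<partial>lborel)"
  have c: "c > 0" unfolding c_def by (rule fejer_mass_pos)
  show thesis
  proof (rule that)
    show "8 / c + 3 * R > 0" using c R by (simp add: add_pos_pos)
  next
    fix H :: "real measure" and \<gamma> :: "real \<Rightarrow> real" and m T :: real and q :: "real \<Rightarrow> real" and x :: real
    assume H: "real_distribution H" and \<gamma>: "integrable lborel \<gamma>" and m: "\<And>x. \<bar>\<gamma> x\<bar> \<le> m" and T: "T > 0"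
      and q: "integrable lborel (\<lambda>t. indicator {0..T} t * q t)"
      and diff: "\<And>t. 0 < t \<Longrightarrow> t \<le> T \<Longrightarrow> norm (char H t - (\<integral>x. \<gamma> x *\<^sub>R iexp (t * x) \<partial>lborel)) \<le> t * q t"
    interpret H: real_distribution H by fact
    have [measurable]: "\<gamma> \<in> borel_measurable borel" using \<gamma> by auto
    define G where "G x = (\<integral>z. \<gamma> z * indicator {..x} z \<partial>lborel)" for x
    define D where "D x = cdf H x - G x" for x
    define Q where "Q = (\<integral>t. indicator {0..T} t * q t \<partial>lborel)"
    have m0: "m \<ge> 0" using m[of 0] by linarith
    have i: "integrable lborel (\<lambda>z. \<gamma> z * indicator {..x} z)" for x :: real
      by (rule Bochner_Integration.integrable_bound[OF \<gamma>]) (auto simp: indicator_def)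
    have G_bound: "\<bar>G x\<bar> \<le> (\<integral>x. \<bar>\<gamma> x\<bar> \<partial>lborel)" for x
    proof -
      have "\<bar>G x\<bar> \<le> (\<integral>z. norm (\<gamma> z * indicator {..x} z) \<partial>lborel)"
        unfolding real_norm_def[symmetric] G_def by (rule integral_norm_bound)
      also have "\<dots> \<le> (\<integral>x. \<bar>\<gamma> x\<bar> \<partial>lborel)"
        by (rule integral_mono_AE'[OF integrable_abs[OF \<gamma>]]) (auto simp: indicator_def)
      finally show ?thesis .
    qed
    have G_lip: "G y - G x \<le> m * (y - x)" if "x \<le> y" for x y
    proof -
      have "G y - G x = (\<integral>z. \<gamma> z * indicator {x<..y} z \<partial>lborel)"
        unfolding G_def using that
        by (subst Bochner_Integration.integral_diff[OF i i, symmetric])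
           (auto intro!: Bochner_Integration.integral_cong simp: indicator_def)
      also have "\<dots> \<le> (\<integral>z. m * indicator {x<..y} z \<partial>lborel)"
      proof (rule Bochner_Integration.integral_mono')
        show "integrable lborel (\<lambda>z. m * indicator {x<..y} z)" by simp
      qed (use abs_le_D1[OF m] m0 in \<open>auto simp: indicator_def\<close>)
      finally show ?thesis using that by simp
    qed
    have [measurable]: "G \<in> borel_measurable borel" 
    proof -
      have "(\<lambda>x. \<integral>z. \<gamma> z * (if z \<le> x then 1 else 0) \<partial>lborel) \<in> borel_measurable borel" by measurable
      also have "(\<lambda>x. \<integral>z. \<gamma> z * (if z \<le> x then 1 else 0) \<partial>lborel) = G"
        by (auto simp: G_def fun_eq_iff indicator_def intro!: Bochner_Integration.integral_cong)
      finally show ?thesis .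
    qed
    have [measurable]: "cdf H \<in> borel_measurable borel"
      by (intro borel_measurable_mono) (auto simp: mono_def H.cdf_nondecreasing)
    have D_meas [measurable]: "D \<in> borel_measurable borel" unfolding D_def by measurable
    define C where "C = 1 + (\<integral>x. \<bar>\<gamma> x\<bar> \<partial>lborel)"
    have D_bound: "\<bar>D x\<bar> \<le> C" for x
      unfolding C_def using G_bound[of x] H.cdf_nonneg[of x] H.cdf_bounded_prob[of x] unfolding D_def by linarith
    have drop: "D x - m * (y - x) \<le> D y" if "x \<le> y" for x y
      using G_lip[OF that] H.cdf_nondecreasing[OF that] unfolding D_def by linarith
    have G_lim: "(\<lambda>n. G (u n)) \<longlonglongrightarrow> 0" if u: "filterlim u at_bot sequentially" for u
    proof -
      have "(\<lambda>n. \<integral>z. \<gamma> z * indicator {..u n} z \<partial>lborel) \<longlonglongrightarrow> (\<integral>z. 0 \<partial>(lborel :: real measure))"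
      proof (rule integral_dominated_convergence[where w="\<lambda>z. \<bar>\<gamma> z\<bar>"])
        show "AE z in lborel. (\<lambda>n. \<gamma> z * indicator {..u n} z) \<longlonglongrightarrow> 0"
        proof (rule AE_I2)
          fix z
          have "\<forall>\<^sub>F n in sequentially. u n < z" using u by (rule filterlim_at_bot_dense[THEN iffD1, rule_format])
          then have "\<forall>\<^sub>F n in sequentially. \<gamma> z * indicator {..u n} z = 0" by eventually_elim simp
          then show "(\<lambda>n. \<gamma> z * indicator {..u n} z) \<longlonglongrightarrow> 0" by (rule tendsto_eventually)
        qed
      qed (use \<gamma> in \<open>auto simp: indicator_def\<close>)
      then show ?thesis by (simp add: G_def)
    qed
    have D_lim: "(\<lambda>n. D (u n)) \<longlonglongrightarrow> 0" if u: "filterlim u at_bot sequentially" for u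
      using tendsto_diff[OF filterlim_compose[OF H.cdf_lim_at_bot u] G_lim[OF u]] by (simp add: D_def)
    \<comment> \<open>Send the left end point of the increment to \<open>- \<infinity>\<close>.\<close>
    have B: "\<bar>\<integral>y. fejer T y * D (x - y) \<partial>lborel\<bar> \<le> 4 * Q" for x
    proof (rule Lim_bounded)
      let ?u = "\<lambda>n y. x - real n - y"
      show "(\<lambda>n. \<bar>\<integral>y. fejer T y * (D (x - y) - D (?u n y)) \<partial>lborel\<bar>) \<longlonglongrightarrow> \<bar>\<integral>y. fejer T y * D (x - y) \<partial>lborel\<bar>"
      proof (intro tendsto_rabs integral_dominated_convergence[where w="\<lambda>y. fejer T y * (2 * C)"])
        show "integrable lborel (\<lambda>y. fejer T y * (2 * C))"
          using fejer_integrable[OF T] by simp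
        show "AE y in lborel. (\<lambda>n. fejer T y * (D (x - y) - D (?u n y))) \<longlonglongrightarrow> fejer T y * D (x - y)"
        proof (rule AE_I2)
          fix y
          have "filterlim (\<lambda>n. x - real n - y) at_bot sequentially"
            unfolding filterlim_at_bot
          proof
            fix Z :: real
            show "\<forall>\<^sub>F n in sequentially. x - real n - y \<le> Z"
              using eventually_ge_at_top[of "nat \<lceil>x - y - Z\<rceil>"]
              by eventually_elim (simp add: nat_ceiling_le_eq)
          qed
          from D_lim[OF this] show "(\<lambda>n. fejer T y * (D (x - y) - D (?u n y))) \<longlonglongrightarrow> fejer T y * D (x - y)"
            by (auto intro!: tendsto_eq_intros)
        qed
        show "AE y in lborel. norm (fejer T y * (D (x - y) - D (?u n y))) \<le> fejer T y * (2 * C)" for n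
        proof (rule AE_I2)
          fix y
          have "\<bar>D (x - y) - D (?u n y)\<bar> \<le> 2 * C"
            using D_bound[of "x - y"] D_bound[of "?u n y"] by linarith
          then show "norm (fejer T y * (D (x - y) - D (?u n y))) \<le> fejer T y * (2 * C)"
            using fejer_nonneg[OF T, of y] by (simp add: abs_mult mult_left_mono)
        qed
      qed measurable
      show "\<forall>n\<ge>0. \<bar>\<integral>y. fejer T y * (D (x - y) - D (?u n y)) \<partial>lborel\<bar> \<le> 4 * Q"
        using smoothing_increment_bound[OF H \<gamma> T _ q diff, of "x - real _" x]
        by (auto simp: D_def G_def Q_def)
    qed
    have "\<bar>D x\<bar> \<le> 2 * (4 * Q / c) + 3 * m * (R / T)"
      unfolding c_def by (rule fejer_desmoothing[OF T R D_meas D_bound drop m0 B])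
    also have "\<dots> = 8 / c * Q + 3 * R * (m / T)" by simp
    also have "\<dots> \<le> (8 / c + 3 * R) * (Q + m / T)"
    proof -
      have "Q \<ge> 0" using B[of 0] by linarith
      then have "0 \<le> 8 / c * (m / T)" "0 \<le> 3 * R * Q" using c T m0 R by auto
      moreover have "(8 / c + 3 * R) * (Q + m / T) = 8 / c * Q + 3 * R * (m / T) + (8 / c * (m / T) + 3 * R * Q)"
        by (simp only: distrib_left distrib_right)
      ultimately show ?thesis by linarith
    qed
    finally show "\<bar>cdf H x - (\<integral>z. \<gamma> z * indicator {..x} z \<partial>lborel)\<bar> \<le> (8 / c + 3 * R) * ((\<integral>t. indicator {0..T} t * q t \<partial>lborel) + m / T)"
      unfolding D_def G_def Q_def .
  qed
qed

section \<open>The one-term Edgeworth approximation\<close>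

lemma integral_derivative_eq_0:
  fixes F f :: "real \<Rightarrow> complex"
  assumes F: "\<And>x. (F has_vector_derivative f x) (at x)" and cont: "\<And>x. isCont f x"
    and int: "integrable lborel f" and lims: "(F \<longlongrightarrow> 0) at_top" "(F \<longlongrightarrow> 0) at_bot"
  shows "(\<integral>x. f x \<partial>lborel) = 0"
proof -
  have "(LBINT x=-\<infinity>..\<infinity>. f x) = 0 - 0"
  proof (rule interval_integral_FTC_integrable[where F=F])
    show "set_integrable lborel (einterval (-\<infinity>) \<infinity>) f"
      using int by (simp add: set_integrable_def)
  qed (use F cont lims in \<open>auto simp: ereal_tendsto_simps\<close>)
  then show ?thesis by (simp add: interval_lebesgue_integral_def set_lebesgue_integral_def)
qed

lemma fourier_transform_derivative:
  fixes q q' :: "real \<Rightarrow> real"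
  assumes q: "\<And>x. (q has_real_derivative q' x) (at x)" and cont: "\<And>x. isCont q' x"
    and int: "integrable lborel q" "integrable lborel q'"
    and lims: "(q \<longlongrightarrow> 0) at_top" "(q \<longlongrightarrow> 0) at_bot"
  shows "(\<integral>x. q' x *\<^sub>R iexp (t * x) \<partial>lborel) = - (\<i> * t) * (\<integral>x. q x *\<^sub>R iexp (t * x) \<partial>lborel)"
proof -
  have [measurable]: "q \<in> borel_measurable borel" "q' \<in> borel_measurable borel" using int by auto
  have contq: "isCont q x" for x using q DERIV_isCont by blast
  have i: "integrable lborel (\<lambda>x. u x *\<^sub>R iexp (t * x))" if "integrable lborel u" for u :: "real \<Rightarrow> real"
  proof (rule Bochner_Integration.integrable_bound[OF that])
    show "(\<lambda>x. u x *\<^sub>R iexp (t * x)) \<in> borel_measurable lborel" using that by measurable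
  qed (simp del: of_real_mult)
  have lim: "((\<lambda>x. q x *\<^sub>R iexp (t * x)) \<longlongrightarrow> 0) F" if "(q \<longlongrightarrow> 0) F" for F
    by (rule tendsto_norm_zero_cancel) (use tendsto_norm_zero[OF that] in \<open>simp del: of_real_mult\<close>)
  have "(\<integral>x. q' x *\<^sub>R iexp (t * x) + (\<i> * t) * (q x *\<^sub>R iexp (t * x)) \<partial>lborel) = 0"
  proof (rule integral_derivative_eq_0[where F="\<lambda>x. q x *\<^sub>R iexp (t * x)"])
    fix x
    have "((\<lambda>x. iexp (t * x)) has_vector_derivative t *\<^sub>R (\<i> * iexp (t * x))) (at x)"
      using has_vector_derivative_iexp_scaled by blast
    then show "((\<lambda>x. q x *\<^sub>R iexp (t * x)) has_vector_derivative q' x *\<^sub>R iexp (t * x) + (\<i> * t) * (q x *\<^sub>R iexp (t * x))) (at x)"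
      by (rule has_vector_derivative_eq_rhs[OF has_vector_derivative_scaleR[OF q]]) (simp add: scaleR_conv_of_real)
    show "isCont (\<lambda>x. q' x *\<^sub>R iexp (t * x) + (\<i> * t) * (q x *\<^sub>R iexp (t * x))) x"
      by (intro continuous_intros cont contq)
  next
    show "integrable lborel (\<lambda>x. q' x *\<^sub>R iexp (t * x) + (\<i> * t) * (q x *\<^sub>R iexp (t * x)))"
      by (intro Bochner_Integration.integrable_add integrable_mult_right i int)
  qed (intro lim lims)+
  then have "(\<integral>x. q' x *\<^sub>R iexp (t * x) \<partial>lborel) + (\<integral>x. (\<i> * t) * (q x *\<^sub>R iexp (t * x)) \<partial>lborel) = 0"
    by (subst (asm) Bochner_Integration.integral_add[OF i[OF int(2)] integrable_mult_right[OF i[OF int(1)]]])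
  then have "(\<integral>x. q' x *\<^sub>R iexp (t * x) \<partial>lborel) + (\<i> * t) * (\<integral>x. q x *\<^sub>R iexp (t * x) \<partial>lborel) = 0"
    by (subst (asm) integral_mult_right_zero)
  then show ?thesis
    by (simp only: add_eq_0_iff2 minus_mult_left)
qed

text \<open>The negative second derivative of the normal density.\<close>

abbreviation psi :: "real \<Rightarrow> real" where
  "psi x \<equiv> (1 - x^2) * std_normal_density x"

lemma DERIV_std_normal_density [derivative_intros]:
  assumes "(f has_real_derivative f') (at x)"
  shows "((\<lambda>x. std_normal_density (f x)) has_real_derivative - f x * std_normal_density (f x) * f') (at x)"
  unfolding std_normal_density_def
  by (rule derivative_eq_intros assms refl | simp)+

lemma isCont_std_normal_density [continuous_intros]:
  "isCont std_normal_density x"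
  by (rule DERIV_isCont[OF DERIV_std_normal_density[OF DERIV_ident, unfolded id_def]])

lemma DERIV_psi: "(psi has_real_derivative (x^3 - 3 * x) * std_normal_density x) (at x)"
  by (rule derivative_eq_intros refl | simp)+ (simp add: algebra_simps power2_eq_square power3_eq_cube)

lemma std_normal_lims:
  "(std_normal_density \<longlongrightarrow> 0) at_top" "(std_normal_density \<longlongrightarrow> 0) at_bot"
  "((\<lambda>x. x * std_normal_density x) \<longlongrightarrow> 0) at_top" "((\<lambda>x. x * std_normal_density x) \<longlongrightarrow> 0) at_bot"
  "(psi \<longlongrightarrow> 0) at_top" "(psi \<longlongrightarrow> 0) at_bot"
  unfolding std_normal_density_def by real_asymp+

lemma integrable_power_std_normal: "integrable lborel (\<lambda>x. x ^ k * std_normal_density x)"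
  using integrable_std_normal_moment[of k] by (simp add: mult.commute)

lemma integrable_psi: "integrable lborel psi"
proof -
  have "integrable lborel (\<lambda>x. x ^ 0 * std_normal_density x - x ^ 2 * std_normal_density x)"
    by (intro Bochner_Integration.integrable_diff integrable_power_std_normal)
  then show ?thesis by (simp add: algebra_simps)
qed

lemma integrable_psi_deriv: "integrable lborel (\<lambda>x. (x^3 - 3 * x) * std_normal_density x)"
proof -
  have "integrable lborel (\<lambda>x. x ^ 3 * std_normal_density x - 3 * (x ^ 1 * std_normal_density x))"
    by (intro Bochner_Integration.integrable_diff integrable_mult_right integrable_power_std_normal)
  then show ?thesis by (simp add: algebra_simps)
qed

lemma fourier_std_normal:
  "(\<integral>x. std_normal_density x *\<^sub>R iexp (t * x) \<partial>lborel) = exp (- (t^2) / 2)"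
proof -
  have "char std_normal_distribution t = (\<integral>x. std_normal_density x *\<^sub>R iexp (t * x) \<partial>lborel)"
    unfolding char_def by (subst integral_density) auto
  then show ?thesis by (simp add: char_std_normal_distribution)
qed

text \<open>This density is the negative third derivative of the normal density, so its transform arises from
  \<open>exp (- t\<^sup>2 / 2)\<close> by three integrations by parts.\<close>

lemma fourier_psi_deriv:
  "(\<integral>x. ((x^3 - 3 * x) * std_normal_density x) *\<^sub>R iexp (t * x) \<partial>lborel) = - \<i> * t^3 * exp (- (t^2) / 2)"
proof -
  note D = DERIV_std_normal_density[OF DERIV_ident, unfolded mult_1_right]
  have 1: "(\<integral>x. (- x * std_normal_density x) *\<^sub>R iexp (t * x) \<partial>lborel) = - (\<i> * t) * exp (- (t^2) / 2)"
    unfolding fourier_std_normal[symmetric]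
  proof (rule fourier_transform_derivative)
    show "(std_normal_density has_real_derivative - x * std_normal_density x) (at x)" for x by (rule D)
    show "integrable lborel (\<lambda>x. - x * std_normal_density x)"
      using integrable_minus[OF integrable_power_std_normal[of 1]] by simp
    show "(std_normal_density \<longlongrightarrow> 0) at_top" "(std_normal_density \<longlongrightarrow> 0) at_bot"
      by (rule std_normal_lims)+
  qed (auto intro!: continuous_intros)
  have 2: "(\<integral>x. psi x *\<^sub>R iexp (t * x) \<partial>lborel) = t^2 * exp (- (t^2) / 2)"
  proof (subst fourier_transform_derivative[where q="\<lambda>x. x * std_normal_density x"])
    show "((\<lambda>x. x * std_normal_density x) has_real_derivative psi x) (at x)" for x
      by (rule derivative_eq_intros refl | simp)+ (simp add: algebra_simps power2_eq_square)
    show "integrable lborel (\<lambda>x. x * std_normal_density x)"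
      using integrable_power_std_normal[of 1] by simp
    show "((\<lambda>x. x * std_normal_density x) \<longlongrightarrow> 0) at_top" "((\<lambda>x. x * std_normal_density x) \<longlongrightarrow> 0) at_bot"
      by (rule std_normal_lims)+
    have "(\<integral>x. (x * std_normal_density x) *\<^sub>R iexp (t * x) \<partial>lborel) = - (\<integral>x. (- x * std_normal_density x) *\<^sub>R iexp (t * x) \<partial>lborel)"
      by (subst Bochner_Integration.integral_minus[symmetric]) simp
    then show "- (\<i> * t) * (\<integral>x. (x * std_normal_density x) *\<^sub>R iexp (t * x) \<partial>lborel) = t^2 * exp (- (t^2) / 2)"
      unfolding 1 by (simp add: power2_eq_square algebra_simps)
  qed (auto intro!: continuous_intros integrable_psi)
  show ?thesis
  proof (subst fourier_transform_derivative[where q=psi])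
    show "- (\<i> * t) * (\<integral>x. psi x *\<^sub>R iexp (t * x) \<partial>lborel) = - \<i> * t^3 * exp (- (t^2) / 2)"
      unfolding 2 by (simp add: power2_eq_square power3_eq_cube)
  qed (auto intro!: continuous_intros integrable_psi integrable_psi_deriv std_normal_lims DERIV_psi)
qed

text \<open>The density approximates the law of the unscaled sum of \<open>n\<close> variables: this way the frequencies of
  the comparison stay in a fixed interval. The function \<open>edgeworth_cdf\<close> lives on the standardized scale.\<close>

definition edgeworth_density :: "real \<Rightarrow> nat \<Rightarrow> real \<Rightarrow> real" where
  "edgeworth_density m3 n x = (let y = x / sqrt n in
     (std_normal_density y + m3 / (6 * sqrt n) * ((y^3 - 3 * y) * std_normal_density y)) / sqrt n)"

definition edgeworth_cdf :: "real \<Rightarrow> nat \<Rightarrow> real \<Rightarrow> real" where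
  "edgeworth_cdf m3 n y = cdf std_normal_distribution y + m3 / (6 * sqrt n) * psi y"

lemma edgeworth_density_integrable:
  assumes "n > 0" shows "integrable lborel (edgeworth_density m3 n)"
proof -
  let ?g = "\<lambda>y. (std_normal_density y + m3 / (6 * sqrt n) * ((y^3 - 3 * y) * std_normal_density y)) / sqrt n"
  have "integrable lborel ?g"
    by (intro integrable_divide Bochner_Integration.integrable_add integrable_mult_right integrable_psi_deriv) auto
  then have "integrable lborel (\<lambda>x. ?g (0 + (1 / sqrt n) * x))"
    using assms by (intro lborel_integrable_real_affine) auto
  then show ?thesis by (simp add: edgeworth_density_def[abs_def] Let_def)
qed

lemma fourier_edgeworth:
  assumes n: "n > 0"
  shows "(\<integral>x. edgeworth_density m3 n x *\<^sub>R iexp (s * x) \<partial>lborel)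
    = of_real (exp (- (n * s^2) / 2)) * (1 - \<i> * of_real (m3 * n * s^3 / 6))"
proof -
  let ?r = "sqrt n"
  let ?g = "\<lambda>y. std_normal_density y + m3 / (6 * sqrt n) * ((y^3 - 3 * y) * std_normal_density y)"
  have r: "?r > 0" "?r^2 = n" using n by auto
  have pt: "?r *\<^sub>R (edgeworth_density m3 n (0 + ?r * y) *\<^sub>R iexp (s * (0 + ?r * y)))
      = std_normal_density y *\<^sub>R iexp ((s * ?r) * y)
      + (m3 / (6 * ?r)) *\<^sub>R (((y^3 - 3 * y) * std_normal_density y) *\<^sub>R iexp ((s * ?r) * y))" for y
  proof -
    have "?r * edgeworth_density m3 n (0 + ?r * y) = std_normal_density y + m3 / (6 * ?r) * ((y^3 - 3 * y) * std_normal_density y)"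
      using r by (simp add: edgeworth_density_def Let_def)
    then show ?thesis
      by (simp only: scaleR_scaleR scaleR_add_left mult.assoc add_0_left)
  qed
  have "(\<integral>x. edgeworth_density m3 n x *\<^sub>R iexp (s * x) \<partial>lborel)
     = ?r *\<^sub>R (\<integral>y. edgeworth_density m3 n (0 + ?r * y) *\<^sub>R iexp (s * (0 + ?r * y)) \<partial>lborel)"
    using r by (subst lborel_integral_real_affine[of ?r _ 0]) auto
  also have "\<dots> = (\<integral>y. ?r *\<^sub>R (edgeworth_density m3 n (0 + ?r * y) *\<^sub>R iexp (s * (0 + ?r * y))) \<partial>lborel)"
    by (rule integral_scaleR_right[symmetric])
  also have "\<dots> = (\<integral>y. std_normal_density y *\<^sub>R iexp ((s * ?r) * y)
      + (m3 / (6 * ?r)) *\<^sub>R (((y^3 - 3 * y) * std_normal_density y) *\<^sub>R iexp ((s * ?r) * y)) \<partial>lborel)"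
    by (simp only: pt)
  also have "\<dots> = exp (- ((s * ?r)^2) / 2) + (m3 / (6 * ?r)) *\<^sub>R (- \<i> * (s * ?r)^3 * exp (- ((s * ?r)^2) / 2))"
  proof -
    have i: "integrable lborel (\<lambda>x. u x *\<^sub>R iexp (t * x))" if "integrable lborel u" for u :: "real \<Rightarrow> real" and t
    proof (rule Bochner_Integration.integrable_bound[OF that])
      show "(\<lambda>x. u x *\<^sub>R iexp (t * x)) \<in> borel_measurable lborel" using that by measurable
    qed (simp del: of_real_mult)
    have i1: "integrable lborel (\<lambda>y. std_normal_density y *\<^sub>R iexp ((s * ?r) * y))" by (rule i) simp
    note i2 = i[OF integrable_psi_deriv, of "s * ?r"]
    show ?thesis
      by (subst Bochner_Integration.integral_add[OF i1 integrable_scaleR_right[OF i2]],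
          subst integral_scaleR_right, unfold fourier_std_normal fourier_psi_deriv) simp
  qed
  also have "\<dots> = exp (- (n * s^2) / 2) * (1 - \<i> * (m3 * n * s^3 / 6))"
  proof -
    have 1: "(s * ?r)^2 = n * s^2" using r by (simp add: power_mult_distrib)
    have 2: "(s * ?r)^3 = s^3 * (n * ?r)" using r by (simp add: power_mult_distrib power3_eq_cube)
    have 3: "m3 / (6 * ?r) * (s^3 * (n * ?r)) = m3 * n * s^3 / 6" using r by (simp add: field_simps)
    have "(m3 / (6 * ?r)) *\<^sub>R (- \<i> * of_real ((s * ?r)^3) * exp (- (n * s^2) / 2)) = - \<i> * of_real (m3 / (6 * ?r) * (s * ?r)^3) * exp (- (n * s^2) / 2)"
      by (simp add: scaleR_conv_of_real)
    then show ?thesis unfolding of_real_power[symmetric] of_real_mult[symmetric] 1 unfolding 2 3 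
      by (simp add: algebra_simps)
  qed
  finally show ?thesis .
qed

lemma psi_deriv_bound: "\<bar>(y^3 - 3 * y) * std_normal_density y\<bar> \<le> 32"
proof -
  have a: "\<bar>y\<bar> \<le> 1 + y^4 \<and> \<bar>y\<bar>^3 \<le> 1 + y^4"
  proof (cases "\<bar>y\<bar> \<le> 1")
    case True
    then have "\<bar>y\<bar>^3 \<le> 1" by (simp add: power_le_one)
    moreover have "0 \<le> y^4" by simp
    ultimately show ?thesis using True by linarith
  next
    case False
    then have "\<bar>y\<bar>^1 \<le> \<bar>y\<bar>^4" "\<bar>y\<bar>^3 \<le> \<bar>y\<bar>^4" by (intro power_increasing; simp)+
    then show ?thesis by simp
  qed
  have "\<bar>y^3 - 3 * y\<bar> \<le> \<bar>y\<bar>^3 + 3 * \<bar>y\<bar>" by (simp add: power_abs[symmetric])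
  also have "\<dots> \<le> 32 * (1 + y^2/2 + (y^2/2)^2 / 2)"
  proof -
    have "(y^2/2)^2 / 2 = y^4/8" by (simp add: power_divide flip: power_mult)
    moreover have "0 \<le> y^2" by simp
    moreover have "32 * (1 + y^2/2 + y^4/8) = 32 + 16 * y^2 + 4 * y^4" by simp
    ultimately show ?thesis using a by (simp only:) linarith
  qed
  also have "\<dots> \<le> 32 * exp (y^2/2)"
    using exp_lower_Taylor_quadratic[of "y^2/2"] by simp
  finally have 1: "\<bar>y^3 - 3 * y\<bar> * exp (- y\<^sup>2 / 2) \<le> 32"
    by (simp add: exp_minus field_simps)
  have "1 / sqrt (2 * pi) \<le> 1" using pi_gt3 by simp
  have "\<bar>(y^3 - 3 * y) * std_normal_density y\<bar> = 1 / sqrt (2 * pi) * (\<bar>y^3 - 3 * y\<bar> * exp (- y\<^sup>2 / 2))"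
    by (simp add: std_normal_density_def abs_mult)
  also have "\<dots> \<le> 1 * 32" by (intro mult_mono 1) (use pi_gt3 in auto)
  finally show ?thesis by simp
qed

lemma std_normal_density_le_1: "std_normal_density x \<le> 1"
proof -
  have "1 / sqrt (2 * pi) * exp (- x\<^sup>2 / 2) \<le> 1 * 1"
    by (intro mult_mono) (use pi_gt3 in auto)
  then show ?thesis by (simp add: std_normal_density_def)
qed

lemma edgeworth_density_bound:
  assumes n: "n > 0"
  shows "\<bar>edgeworth_density m3 n x\<bar> \<le> (1 + 6 * \<bar>m3\<bar>) / sqrt n"
proof -
  let ?y = "x / sqrt n"
  let ?p = "(?y^3 - 3 * ?y) * std_normal_density ?y"
  have "\<bar>m3 / (6 * sqrt n) * ?p\<bar> = \<bar>m3\<bar> / (6 * sqrt n) * \<bar>?p\<bar>" by (simp add: abs_mult)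
  also have "\<dots> \<le> \<bar>m3\<bar> / 6 * 32"
  proof (intro mult_mono)
    have "6 * 1 \<le> 6 * sqrt n" using n by (intro mult_left_mono) auto
    then show "\<bar>m3\<bar> / (6 * sqrt n) \<le> \<bar>m3\<bar> / 6" by (intro divide_left_mono) auto
    show "\<bar>?p\<bar> \<le> 32" by (rule psi_deriv_bound)
  qed auto
  finally have "\<bar>std_normal_density ?y + m3 / (6 * sqrt n) * ?p\<bar> \<le> 1 + 6 * \<bar>m3\<bar>"
  proof -
    have aux: "\<bar>a + b\<bar> \<le> 1 + 6 * c" if "\<bar>b\<bar> \<le> c / 6 * 32" "a \<le> 1" "0 \<le> a" "0 \<le> c" for a b c :: real
      using that by linarith
    show ?thesis if "\<bar>m3 / (6 * sqrt n) * ?p\<bar> \<le> \<bar>m3\<bar> / 6 * 32"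
      using that by (intro aux std_normal_density_le_1) auto
  qed
  then show ?thesis
    using n unfolding edgeworth_density_def Let_def abs_divide by (simp add: divide_right_mono)
qed

lemma integral_psi_deriv:
  "(\<integral>z. (z^3 - 3 * z) * std_normal_density z * indicator {..x} z \<partial>lborel) = psi x"
proof -
  have "(LBINT z=-\<infinity>..x. (z^3 - 3 * z) * std_normal_density z) = psi x - 0"
  proof (rule interval_integral_FTC_integrable[where F=psi])
    show "set_integrable lborel (einterval (-\<infinity>) x) (\<lambda>z. (z^3 - 3 * z) * std_normal_density z)"
      unfolding set_integrable_def
      by (rule Bochner_Integration.integrable_bound[OF integrable_psi_deriv]) (auto simp: indicator_def)
    show "(psi has_vector_derivative (z^3 - 3 * z) * std_normal_density z) (at z)" for z
      using DERIV_psi by (simp add: has_real_derivative_iff_has_vector_derivative)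
    show "((psi \<circ> real_of_ereal) \<longlongrightarrow> 0) (at_right (-\<infinity>))"
      using std_normal_lims(6) by (simp add: ereal_tendsto_simps)
    have "isCont psi x" by (rule DERIV_isCont[OF DERIV_psi])
    then have "(psi \<longlongrightarrow> psi x) (at_left x)"
      by (auto simp: isCont_def intro: filterlim_mono at_le)
    then show "((psi \<circ> real_of_ereal) \<longlongrightarrow> psi x) (at_left (ereal x))"
      by (simp only: ereal_tendsto_simps)
  qed (auto intro!: continuous_intros)
  also have "(LBINT z=-\<infinity>..x. (z^3 - 3 * z) * std_normal_density z) = (\<integral>z. (z^3 - 3 * z) * std_normal_density z * indicator {..x} z \<partial>lborel)"
    unfolding interval_lebesgue_integral_def set_lebesgue_integral_def using AE_lborel_singleton[of x]
    by (auto intro!: integral_cong_AE elim!: eventually_mono simp: indicator_def einterval_def)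
  finally show ?thesis by simp
qed

lemma cdf_std_normal:
  "cdf std_normal_distribution x = (\<integral>z. std_normal_density z * indicator {..x} z \<partial>lborel)"
proof -
  interpret real_distribution std_normal_distribution by (rule real_dist_normal_dist)
  have "cdf std_normal_distribution x = (\<integral>z. indicator {..x} z \<partial>std_normal_distribution)"
    by (simp add: cdf_def2)
  also have "\<dots> = (\<integral>z. std_normal_density z * indicator {..x} z \<partial>lborel)"
    by (subst integral_density) auto
  finally show ?thesis .
qed

lemma integral_edgeworth_density:
  assumes n: "n > 0"
  shows "(\<integral>z. edgeworth_density m3 n z * indicator {..x} z \<partial>lborel) = edgeworth_cdf m3 n (x / sqrt n)"
proof -
  let ?r = "sqrt n"
  have r: "?r > 0" using n by auto
  have pt: "?r * (edgeworth_density m3 n (0 + ?r * y) * indicator {..x} (0 + ?r * y))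
    = std_normal_density y * indicator {..x / ?r} y + m3 / (6 * ?r) * ((y^3 - 3 * y) * std_normal_density y * indicator {..x / ?r} y)" for y
  proof -
    have "?r * edgeworth_density m3 n (0 + ?r * y) = std_normal_density y + m3 / (6 * ?r) * ((y^3 - 3 * y) * std_normal_density y)"
      using r by (simp add: edgeworth_density_def Let_def)
    moreover have "indicator {..x} (0 + ?r * y) = (indicator {..x / ?r} y :: real)"
      using r by (auto simp: indicator_def field_simps)
    ultimately show ?thesis
      by (simp only: mult.assoc[symmetric] distrib_right)
  qed
  have "(\<integral>z. edgeworth_density m3 n z * indicator {..x} z \<partial>lborel)
     = (\<integral>y. ?r * (edgeworth_density m3 n (0 + ?r * y) * indicator {..x} (0 + ?r * y)) \<partial>lborel)"
    using r by (subst lborel_integral_real_affine[of ?r _ 0]) auto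
  also have "\<dots> = (\<integral>y. std_normal_density y * indicator {..x / ?r} y + m3 / (6 * ?r) * ((y^3 - 3 * y) * std_normal_density y * indicator {..x / ?r} y) \<partial>lborel)"
    by (simp only: pt)
  also have "\<dots> = edgeworth_cdf m3 n (x / ?r)"
  proof -
    have 1: "integrable lborel (\<lambda>y. std_normal_density y * indicator {..x / ?r} y)"
      by (rule Bochner_Integration.integrable_bound[of _ std_normal_density]) (auto simp: indicator_def)
    have 2: "integrable lborel (\<lambda>y. (y^3 - 3 * y) * std_normal_density y * indicator {..x / ?r} y)"
      by (rule Bochner_Integration.integrable_bound[OF integrable_psi_deriv]) (auto simp: indicator_def)
    show ?thesis
      by (subst Bochner_Integration.integral_add[OF 1 integrable_mult_right[OF 2]])
         (simp add: edgeworth_cdf_def cdf_std_normal integral_psi_deriv)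
  qed
  finally show ?thesis .
qed

section \<open>Uniform smoothing\<close>

definition unit_uniform :: "real measure" where
  "unit_uniform = density lborel (\<lambda>x. ennreal (indicator {-1/2..1/2} x))"

text \<open>The uniform law on \<open>[-h/2, h/2]\<close>, which for \<open>h = 0\<close> is the unit mass at \<open>0\<close>.\<close>

definition spread :: "real \<Rightarrow> real measure" where
  "spread h = distr unit_uniform borel (\<lambda>x. h * x)"

lemma real_distribution_unit_uniform: "real_distribution unit_uniform"
proof -
  have "prob_space unit_uniform"
    unfolding unit_uniform_def
    by (rule prob_spaceI) (simp add: emeasure_density ennreal_indicator)
  then show ?thesis
    by (auto simp: real_distribution_def real_distribution_axioms_def unit_uniform_def)
qed

lemma real_distribution_spread: "real_distribution (spread h)"
proof -
  interpret real_distribution unit_uniform by (rule real_distribution_unit_uniform)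
  show ?thesis unfolding spread_def by (rule real_distribution_distr) simp
qed

lemma AE_spread:
  assumes "h \<ge> 0"
  shows "AE x in spread h. \<bar>x\<bar> \<le> h / 2"
proof -
  have "AE x in unit_uniform. x \<in> {-1/2..1/2}"
    unfolding unit_uniform_def by (subst AE_density) (auto simp: indicator_def)
  then have "AE x in unit_uniform. \<bar>h * x\<bar> \<le> h / 2"
  proof eventually_elim
    case (elim x)
    then have "h * \<bar>x\<bar> \<le> h * (1/2)" using assms by (intro mult_left_mono) auto
    then show ?case using assms by (simp add: abs_mult)
  qed
  then show ?thesis
    unfolding spread_def by (subst AE_distr_iff) (auto simp: unit_uniform_def)
qed

lemma char_unit_uniform:
  assumes "t \<noteq> 0"
  shows "char unit_uniform t = of_real (sin (t / 2) / (t / 2))"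
proof -
  let ?F = "\<lambda>x. - (\<i> / t) * iexp (t * x)"
  have "char unit_uniform t = (\<integral>x. indicator {-1/2..1/2} x *\<^sub>R iexp (t * x) \<partial>lborel)"
    unfolding char_def unit_uniform_def by (subst integral_density) (auto simp: indicator_def)
  also have "\<dots> = ?F (1/2) - ?F (-1/2)"
  proof (rule integral_FTC_Icc)
    show "(?F has_vector_derivative iexp (t * x)) (at x within {-1/2..1/2})" for x
    proof -
      have "(?F has_vector_derivative (- (\<i> / t) * (t *\<^sub>R (\<i> * iexp (t * x))))) (at x within {-1/2..1/2})"
        by (rule has_vector_derivative_mult_right[OF has_vector_derivative_iexp_scaled])
      then show ?thesis using assms by (simp add: scaleR_conv_of_real)
    qed
  qed (auto intro!: continuous_intros)
  also have "\<dots> = of_real (sin (t / 2) / (t / 2))"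
    using assms by (simp add: complex_eq_iff Re_exp Im_exp Re_divide Im_divide power2_eq_square)
  finally show ?thesis .
qed

lemma char_spread: "char (spread h) s = char unit_uniform (h * s)"
  unfolding char_def spread_def
  by (subst integral_distr) (auto simp: unit_uniform_def ac_simps)

text \<open>The quadratic order, due to the symmetry of the law, makes the effect of the smoothing on the
  distribution function of order \<open>1 / n\<close>.\<close>

lemma char_unit_uniform_approx: "norm (char unit_uniform t - 1) \<le> t^2"
proof (cases "t = 0")
  case True
  then show ?thesis
    using real_distribution.char_zero[OF real_distribution_unit_uniform] by simp
next
  case False
  let ?x = "t / 2"
  have "\<bar>sin ?x - ?x\<bar> \<le> \<bar>?x\<bar> ^ 3 / 6"
    using Maclaurin_sin_bound[of ?x 3] by (simp add: eval_nat_numeral sin_coeff_def field_simps)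
  then have "\<bar>(sin ?x - ?x) / ?x\<bar> \<le> (\<bar>?x\<bar> ^ 3 / 6) / \<bar>?x\<bar>"
    unfolding abs_divide by (rule divide_right_mono) simp
  also have "\<dots> = ?x^2 / 6" using False by (simp add: field_simps eval_nat_numeral)
  also have "\<dots> \<le> t^2" by (simp add: power_divide)
  finally have "\<bar>sin ?x / ?x - 1\<bar> \<le> t^2" using False by (simp add: diff_divide_distrib)
  moreover have "char unit_uniform t - 1 = of_real (sin ?x / ?x - 1)"
    using False by (simp add: char_unit_uniform)
  ultimately show ?thesis by (simp only: norm_of_real)
qed

section \<open>Characteristic functions near the origin\<close>

locale standardized_law = real_distribution Q for Q +
  assumes integrable_cube: "integrable Q (\<lambda>x. \<bar>x\<bar>^3)"
    and mean_0: "expectation (\<lambda>x. x) = 0" and var_1: "expectation (\<lambda>x. x^2) = 1"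
begin

definition third_moment :: real where "third_moment = expectation (\<lambda>x. x^3)"

abbreviation taylor3 :: "real \<Rightarrow> complex" where
  "taylor3 s \<equiv> of_real (1 - s^2/2) - \<i> * of_real (third_moment * s^3 / 6)"

abbreviation f :: "real \<Rightarrow> complex" where "f \<equiv> char Q"

lemma integrable_moment:
  assumes "k \<le> 3" shows "integrable Q (\<lambda>x. x^k)"
proof (rule Bochner_Integration.integrable_bound)
  show "integrable Q (\<lambda>x. 1 + \<bar>x\<bar>^3)" using integrable_cube by simp
  have "\<bar>x\<bar>^k \<le> 1 + \<bar>x\<bar>^3" for x :: real
  proof (cases "\<bar>x\<bar> \<le> 1")
    case True
    then have "\<bar>x\<bar>^k \<le> 1" by (simp add: power_le_one)
    then show ?thesis by (smt (verit) zero_le_power abs_ge_zero)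
  next
    case False
    then have "\<bar>x\<bar>^k \<le> \<bar>x\<bar>^3" using assms by (intro power_increasing) auto
    then show ?thesis by simp
  qed
  then show "AE x in Q. norm (x^k) \<le> norm (1 + \<bar>x\<bar>^3)"
    by (auto simp: power_abs)
qed simp

text \<open>With only a third moment the remainder is \<open>o (s\<^sup>3)\<close> rather than \<open>O (s\<^sup>4)\<close>; it is bounded by a truncated
  fourth moment, which tends to \<open>0\<close> by dominated convergence.\<close>

lemma char_third_order:
  assumes "\<epsilon> > 0"
  obtains \<delta> where "\<delta> > 0"
    "\<And>s. \<bar>s\<bar> \<le> \<delta> \<Longrightarrow> norm (f s - taylor3 s) \<le> \<epsilon> * \<bar>s\<bar>^3"
proof -
  let ?r = "\<lambda>s x :: real. min (2 * \<bar>x\<bar>^3 * Suc 3) (\<bar>s\<bar> * \<bar>x\<bar>^Suc 3)"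
  have int: "integrable Q (?r s)" for s
  proof (rule Bochner_Integration.integrable_bound)
    show "integrable Q (\<lambda>x. 2 * \<bar>x\<bar>^3 * Suc 3)" using integrable_cube by simp
  qed (auto simp: min_def)
  have "(\<lambda>n. expectation (?r (1 / Suc n))) \<longlonglongrightarrow> expectation (\<lambda>x. 0)"
  proof (rule integral_dominated_convergence[where w="\<lambda>x::real. 2 * \<bar>x\<bar>^3 * Suc 3"])
    show "integrable Q (\<lambda>x. 2 * \<bar>x\<bar>^3 * Suc 3)" using integrable_cube by simp
    show "AE x in Q. (\<lambda>n. ?r (1 / Suc n) x) \<longlonglongrightarrow> 0"
    proof (rule AE_I2)
      fix x :: real
      have *: "(\<lambda>n. \<bar>1 / real (Suc n)\<bar> * \<bar>x\<bar> ^ Suc 3) \<longlonglongrightarrow> 0 * \<bar>x\<bar> ^ Suc 3"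
        by (intro tendsto_mult tendsto_rabs_zero LIMSEQ_Suc[OF lim_1_over_n] tendsto_const)
      show "(\<lambda>n. ?r (1 / Suc n) x) \<longlonglongrightarrow> 0"
      proof (rule tendsto_sandwich[of "\<lambda>_. 0", rotated 3])
        show "(\<lambda>n. \<bar>1 / real (Suc n)\<bar> * \<bar>x\<bar> ^ Suc 3) \<longlonglongrightarrow> 0"
          using * by simp
        show "\<forall>\<^sub>F n in sequentially. ?r (1 / Suc n) x \<le> \<bar>1 / real (Suc n)\<bar> * \<bar>x\<bar> ^ Suc 3"
          by (intro always_eventually allI min.cobounded2)
        show "\<forall>\<^sub>F n in sequentially. 0 \<le> ?r (1 / Suc n) x"
          by (intro always_eventually allI min.boundedI) auto
      qed simp
    qed
  qed (auto simp: min_def)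
  then have "\<forall>\<^sub>F n in sequentially. expectation (?r (1 / Suc n)) < \<epsilon>"
    using assms by (intro order_tendstoD) auto
  then obtain n where n: "expectation (?r (1 / Suc n)) < \<epsilon>"
    using eventually_happens'[OF sequentially_bot] by blast
  have m2: "expectation (\<lambda>x. x * x) = 1" using var_1 by (simp add: power2_eq_square)
  have m3: "expectation (\<lambda>x. x * (x * x)) = third_moment" by (simp add: third_moment_def power3_eq_cube ac_simps)
  show thesis
  proof (rule that[of "1 / Suc n"])
    fix s :: real assume s: "\<bar>s\<bar> \<le> 1 / Suc n"
    have "(\<Sum>k\<le>3. ((\<i> * s)^k / fact k) * expectation (\<lambda>x. x^k)) = taylor3 s"
      using m2 m3 mean_0 prob_space by (simp add: eval_nat_numeral algebra_simps)
    then have "norm (f s - taylor3 s) \<le> (\<bar>s\<bar>^3 / fact (Suc 3)) * expectation (?r s)"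
      using char_approx2[of 3 s, OF integrable_moment] by (simp only:)
    also have "\<dots> \<le> \<bar>s\<bar>^3 / 1 * \<epsilon>"
    proof (intro mult_mono divide_left_mono)
      have "expectation (?r s) \<le> expectation (?r (1 / Suc n))"
        by (intro Bochner_Integration.integral_mono int min.mono mult_right_mono) (use s in auto)
      then show "expectation (?r s) \<le> \<epsilon>" using n by linarith
    qed (auto intro!: Bochner_Integration.integral_nonneg)
    finally show "norm (f s - taylor3 s) \<le> \<epsilon> * \<bar>s\<bar>^3"
      by (simp add: mult.commute)
  qed simp
qed

end

lemma norm_power_diff_bound:
  fixes a b :: complex
  assumes "norm a \<le> M" "norm b \<le> M" "M > 0" "n > 0"
  shows "norm (a^n - b^n) \<le> n * M^(n-1) * norm (a - b)"
proof -
  have "norm ((a /\<^sub>R M)^n - (b /\<^sub>R M)^n) \<le> n * norm (a /\<^sub>R M - b /\<^sub>R M)"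
    by (rule norm_power_diff) (use assms in \<open>auto simp: field_simps\<close>)
  also have "(a /\<^sub>R M)^n - (b /\<^sub>R M)^n = (a^n - b^n) /\<^sub>R M^n"
    by (simp add: scaleR_power scaleR_diff_right power_inverse)
  also have "a /\<^sub>R M - b /\<^sub>R M = (a - b) /\<^sub>R M" by (simp add: scaleR_diff_right)
  finally have "norm (a^n - b^n) / M^n \<le> n * (norm (a - b) / M)"
    using assms by (simp only: norm_scaleR) (simp add: divide_inverse ac_simps)
  then have "norm (a^n - b^n) \<le> M^n * (n * (norm (a - b) / M))"
    using assms by (simp add: field_simps)
  also have "M^n = M * M^(n-1)" using assms by (simp flip: power_Suc)
  finally show ?thesis using assms by (simp add: field_simps)
qed

lemma gauss_integral:
  assumes "n > 0"
  shows "integrable lborel (\<lambda>s. exp (- (n * s\<^sup>2) / 16))"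
    and "(\<integral>s. exp (- (n * s\<^sup>2) / 16) \<partial>lborel) = sqrt (16 * pi / n)"
proof -
  have eq: "exp (- (n * s\<^sup>2) / 16) = sqrt (16 * pi / n) * normal_density 0 (sqrt (8 / n)) s" for s
    using assms by (simp add: normal_density_def field_simps real_sqrt_divide real_sqrt_mult)
  show "integrable lborel (\<lambda>s. exp (- (n * s\<^sup>2) / 16))"
    unfolding eq using assms by (intro integrable_mult_right integrable_normal_density) auto
  show "(\<integral>s. exp (- (n * s\<^sup>2) / 16) \<partial>lborel) = sqrt (16 * pi / n)"
    unfolding eq using assms by (subst integral_mult_right_zero, subst integral_normal_density) auto
qed

text \<open>Polynomial factors are absorbed by giving up part of the Gaussian decay, so that all error terms
  can be integrated against the single weight \<open>exp (- v / 16)\<close>.\<close>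

lemma exp_absorb:
  fixes v :: real
  assumes "v \<ge> 0"
  shows "sqrt v * exp (- v / 4) \<le> 6 * exp (- v / 16)"
    and "v * exp (- v / 8) \<le> 16 * exp (- v / 16)"
    and "v^2 * sqrt v * exp (- v / 2) \<le> 400 * exp (- v / 16)"
proof -
  have sq: "sqrt v \<le> 1 + v"
    using assms by (intro real_le_lsqrt) (simp_all add: power2_eq_square algebra_simps)
  have e: "1 + x \<le> exp x" for x :: real by (rule exp_ge_add_one_self)
  have "sqrt v \<le> 6 * exp (3 * v / 16)" using e[of "3 * v / 16"] sq assms by linarith
  then have "sqrt v * exp (- v / 4) \<le> 6 * exp (3 * v / 16) * exp (- v / 4)" by (intro mult_right_mono) auto
  then show "sqrt v * exp (- v / 4) \<le> 6 * exp (- v / 16)" by (simp add: mult.assoc flip: exp_add)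
  have "v \<le> 16 * exp (v / 16)" using e[of "v / 16"] assms by linarith
  then have "v * exp (- v / 8) \<le> 16 * exp (v / 16) * exp (- v / 8)" by (intro mult_right_mono) auto
  then show "v * exp (- v / 8) \<le> 16 * exp (- v / 16)" by (simp add: mult.assoc flip: exp_add)
  have x: "1 + 7 * v / 48 \<le> exp (7 * v / 48)" by (rule e)
  then have "(1 + 7 * v / 48)^3 \<le> exp (7 * v / 48)^3" using assms by (intro power_mono) auto
  also have "\<dots> = exp (7 * v / 16)" by (simp flip: exp_of_nat_mult)
  finally have x3: "(1 + 7 * v / 48)^3 \<le> exp (7 * v / 16)" .
  have "v^2 * sqrt v \<le> v^2 * (1 + v)" using sq by (intro mult_left_mono) auto
  also have "\<dots> \<le> 400 * (1 + 7 * v / 48)^3"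
  proof -
    have "400 * (1 + 7 * v / 48)^3 - v^2 * (1 + v) = 400 + 175 * v + (400 * 3 * (7/48)^2 - 1) * v^2 + (400 * (7/48)^3 - 1) * v^3"
      by (simp add: power3_eq_cube power2_eq_square field_simps)
    moreover have "0 \<le> (400 * 3 * (7/48)^2 - 1) * v^2" "0 \<le> (400 * (7/48)^3 - 1) * v^3"
      using assms by (auto simp: power_divide)
    ultimately show ?thesis using assms by linarith
  qed
  also have "\<dots> \<le> 400 * exp (7 * v / 16)" using x3 by simp
  finally have "v^2 * sqrt v * exp (- v / 2) \<le> 400 * exp (7 * v / 16) * exp (- v / 2)" by (intro mult_right_mono) auto
  then show "v^2 * sqrt v * exp (- v / 2) \<le> 400 * exp (- v / 16)" by (simp add: mult.assoc flip: exp_add)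
qed

context standardized_law begin

text \<open>The exponential of the Taylor polynomial of \<open>ln f\<close>. It agrees with \<open>f\<close> to third order and its
  \<open>n\<close>-th power is explicit, so no complex logarithm of \<open>f\<close> occurs.\<close>

definition cumulant_exp :: "real \<Rightarrow> complex" where
  "cumulant_exp s = exp (Complex (- (s^2) / 2) (- third_moment * s^3 / 6))"

text \<open>The Fourier transform of \<open>edgeworth_density third_moment n\<close>, see \<open>fourier_edgeworth\<close>.\<close>

definition edgeworth_char :: "nat \<Rightarrow> real \<Rightarrow> complex" where
  "edgeworth_char n s = of_real (exp (- (n * s^2) / 2)) * (1 - \<i> * of_real (third_moment * n * s^3 / 6))"

definition char_error :: "real \<Rightarrow> nat \<Rightarrow> real \<Rightarrow> real" where
  "char_error h n s = norm (f s ^ n * char (spread h) s - edgeworth_char n s) / s"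

lemma norm_cumulant_exp: "norm (cumulant_exp s) = exp (- (s^2) / 2)"
  by (simp add: cumulant_exp_def)

lemma char_local:
  assumes "\<epsilon> > 0"
  obtains \<delta> where "\<delta> > 0" "\<delta> \<le> 1"
    "\<And>s. 0 < s \<Longrightarrow> s \<le> \<delta> \<Longrightarrow> norm (f s - cumulant_exp s) \<le> \<epsilon> * s^3"
    "\<And>s. 0 < s \<Longrightarrow> s \<le> \<delta> \<Longrightarrow> norm (f s) \<le> exp (- (s^2) / 4)"
proof -
  define C where "C = 1/2 + \<bar>third_moment\<bar> / 6"
  have C: "C \<ge> 1/2" by (simp add: C_def)
  obtain \<delta>1 where \<delta>1: "\<delta>1 > 0"
    "\<And>s. \<bar>s\<bar> \<le> \<delta>1 \<Longrightarrow> norm (f s - taylor3 s) \<le> \<epsilon> / 2 * \<bar>s\<bar>^3"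
    using char_third_order[of "\<epsilon> / 2"] assms by auto
  \<comment> \<open>The third entry makes the Taylor error of the exponential small against \<open>s\<^sup>3\<close>, the last one makes the cubic terms small against \<open>s\<^sup>2 / 4\<close>.\<close>
  define \<delta> where "\<delta> = min (min \<delta>1 1) (min (\<epsilon> / (4 * (exp 1 * C^2))) (1 / (4 * (\<epsilon> + \<bar>third_moment\<bar>))))"
  have pos: "exp 1 * C^2 > 0" using C by simp
  have \<delta>: "\<delta> > 0" "\<delta> \<le> \<delta>1" "\<delta> \<le> 1" "\<delta> \<le> \<epsilon> / (4 * (exp 1 * C^2))" "\<delta> \<le> 1 / (4 * (\<epsilon> + \<bar>third_moment\<bar>))"
    using \<delta>1(1) assms pos by (auto simp: \<delta>_def intro!: divide_pos_pos)
  have 1: "norm (f s - taylor3 s) \<le> \<epsilon> / 2 * s^3" if "0 < s" "s \<le> \<delta>" for s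
    using \<delta>1(2)[of s] that \<delta> by simp
  have 2: "norm (cumulant_exp s - taylor3 s) \<le> \<epsilon> / 2 * s^3" if s: "0 < s" "s \<le> \<delta>" for s
  proof -
    define z where "z = Complex (- (s^2) / 2) (- third_moment * s^3 / 6)"
    have s1: "s \<le> 1" using s \<delta> by simp
    have s2: "s^2 \<le> 1" using s s1 by (simp add: power_le_one)
    have s3: "s^3 \<le> s^2" using s s1 by (intro power_decreasing) auto
    have "norm z \<le> \<bar>Re z\<bar> + \<bar>Im z\<bar>" by (rule cmod_le)
    also have "\<dots> = s^2 / 2 + \<bar>third_moment\<bar> / 6 * s^3" using s by (simp add: z_def abs_mult)
    also have "\<dots> \<le> s^2 / 2 + \<bar>third_moment\<bar> / 6 * s^2" using s3 by (intro add_left_mono mult_left_mono) auto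
    also have "\<dots> = C * s^2" by (simp add: C_def algebra_simps)
    finally have nz: "norm z \<le> C * s^2" .
    have "cumulant_exp s - taylor3 s = exp z - (\<Sum>k\<le>1. z^k / fact k)"
      by (simp add: cumulant_exp_def z_def complex_eq_iff)
    also have "norm \<dots> \<le> exp \<bar>Re z\<bar> * norm z ^ Suc 1 / fact 1" by (rule Taylor_exp)
    also have "\<dots> = exp (s^2 / 2) * norm z ^ 2" by (simp add: z_def power2_eq_square)
    also have "\<dots> \<le> exp 1 * (C * s^2)^2" using s2 nz by (intro mult_mono power_mono) auto
    also have "\<dots> = (exp 1 * C^2) * s * s^3" by (simp add: power_mult_distrib eval_nat_numeral)
    also have "\<dots> \<le> \<epsilon> / 2 * s^3"
    proof (rule mult_right_mono)
      have "(exp 1 * C^2) * s \<le> (exp 1 * C^2) * (\<epsilon> / (4 * (exp 1 * C^2)))"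
        using s \<delta> pos by (intro mult_left_mono) auto
      also have "\<dots> = \<epsilon> / 4" using C by (simp add: field_simps)
      finally show "(exp 1 * C^2) * s \<le> \<epsilon> / 2" using assms by linarith
    qed (use s in simp)
    finally show ?thesis .
  qed
  show thesis
  proof (rule that[OF \<delta>(1,3)])
    fix s assume s: "0 < s" "s \<le> \<delta>"
    show "norm (f s - cumulant_exp s) \<le> \<epsilon> * s^3"
      using norm_triangle_ineq4[of "f s - taylor3 s" "cumulant_exp s - taylor3 s"] 1[OF s] 2[OF s]
      by simp
    have s2: "s^2 \<le> 1" using s \<delta> by (simp add: power_le_one)
    have "norm (f s) \<le> norm (f s - taylor3 s) + norm (taylor3 s)"
      using norm_triangle_ineq[of "f s - taylor3 s" "taylor3 s"] by simp
    also have "norm (taylor3 s) \<le> norm (of_real (1 - s^2/2) :: complex) + norm (\<i> * of_real (third_moment * s^3 / 6))"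
      using norm_triangle_ineq4[of "of_real (1 - s^2/2)" "\<i> * of_real (third_moment * s^3 / 6)"] by simp
    also have "norm (of_real (1 - s^2/2) :: complex) = 1 - s^2/2" unfolding norm_of_real using s2 by simp
    also have "norm (\<i> * of_real (third_moment * s^3 / 6)) = \<bar>third_moment\<bar> / 6 * s^3"
      using s by (simp add: norm_mult norm_divide norm_power)
    finally have le: "norm (f s) \<le> norm (f s - taylor3 s) + (1 - s^2/2 + \<bar>third_moment\<bar> / 6 * s^3)"
      by simp
    have "\<epsilon> / 2 * s^3 + (1 - s^2/2 + \<bar>third_moment\<bar> / 6 * s^3) \<le> 1 - s^2/4"
    proof -
      have "(\<epsilon> + \<bar>third_moment\<bar>) * s \<le> (\<epsilon> + \<bar>third_moment\<bar>) * (1 / (4 * (\<epsilon> + \<bar>third_moment\<bar>)))"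
        using s \<delta> assms by (intro mult_left_mono) auto
      also have "\<dots> = 1 / 4" using assms by (auto simp: field_simps add_pos_nonneg)
      finally have "(\<epsilon> + \<bar>third_moment\<bar>) * s * s^2 \<le> 1/4 * s^2" by (intro mult_right_mono) auto
      moreover have "(\<epsilon> + \<bar>third_moment\<bar>) * s * s^2 = \<epsilon> * s^3 + \<bar>third_moment\<bar> * s^3"
        by (simp add: algebra_simps eval_nat_numeral)
      moreover have "0 \<le> \<epsilon> * s^3" "0 \<le> \<bar>third_moment\<bar> * s^3" using assms s by auto
      ultimately show ?thesis by linarith
    qed
    then have "norm (f s) \<le> 1 - s^2/4" using 1[OF s] le by linarith
    also have "\<dots> \<le> exp (- (s^2) / 4)" using exp_ge_add_one_self[of "- (s^2)/4"] by simp
    finally show "norm (f s) \<le> exp (- (s^2) / 4)" .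
  qed
qed

text \<open>With \<open>u\<close> for the characteristic function of the smoothing law, the chain \<open>f\<^sup>n u\<close>, \<open>f\<^sup>n\<close>,
  \<open>cumulant_exp\<^sup>n\<close>, \<open>edgeworth_char\<close> produces three errors. The first and the last are of order
  \<open>1 / sqrt n\<close>; the middle one carries the factor \<open>\<epsilon>\<close>, from the \<open>o (s\<^sup>3)\<close> term.\<close>

lemma char_error_inner:
  assumes "\<epsilon> > 0"
  obtains \<delta> K where "\<delta> > 0" "K \<ge> 0"
    "\<And>n s. n \<ge> 2 \<Longrightarrow> 0 < s \<Longrightarrow> s \<le> \<delta> \<Longrightarrow> char_error h n s \<le> (\<epsilon> + K / sqrt n) * exp (- (n * s^2) / 16)"
proof -
  obtain \<delta> where \<delta>: "\<delta> > 0" "\<delta> \<le> 1"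
    "\<And>s. 0 < s \<Longrightarrow> s \<le> \<delta> \<Longrightarrow> norm (f s - cumulant_exp s) \<le> \<epsilon> / 16 * s^3"
    "\<And>s. 0 < s \<Longrightarrow> s \<le> \<delta> \<Longrightarrow> norm (f s) \<le> exp (- (s^2) / 4)"
    using char_local[of "\<epsilon> / 16"] assms by auto
  define K where "K = 6 * h^2 + 400 * third_moment^2"
  show thesis
  proof (rule that[OF \<delta>(1)])
    show "K \<ge> 0" by (simp add: K_def)
    fix n :: nat and s :: real assume n: "n \<ge> 2" and s: "0 < s" "s \<le> \<delta>"
    define v where "v = n * s^2"
    have v: "v \<ge> 0" by (simp add: v_def)
    have sv: "sqrt v = sqrt n * s" using s by (simp add: v_def real_sqrt_mult)
    have n0: "sqrt n > 0" using n by simp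
    let ?e = "exp (- v / 16)"
    let ?u = "char (spread h) s"
    have fn: "norm (f s ^ n) \<le> exp (- v / 4)"
    proof -
      have "norm (f s) ^ n \<le> exp (- (s^2) / 4) ^ n" using \<delta>(4)[OF s] by (intro power_mono) auto
      also have "\<dots> = exp (- v / 4)" by (simp add: v_def flip: exp_of_nat_mult)
      finally show ?thesis by (simp add: norm_power)
    qed
    have A: "norm (f s ^ n * ?u - f s ^ n) \<le> s * (6 * h^2 / sqrt n * ?e)"
    proof -
      have "norm (f s ^ n * ?u - f s ^ n) = norm (f s ^ n) * norm (?u - 1)"
        by (simp add: norm_mult[symmetric] right_diff_distrib)
      also have "\<dots> \<le> exp (- v / 4) * (h * s)^2"
        using fn char_unit_uniform_approx[of "h * s"] by (intro mult_mono) (auto simp: char_spread)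
      also have "\<dots> = s * h^2 / sqrt n * (sqrt v * exp (- v / 4))"
        using n0 by (simp add: sv power2_eq_square)
      also have "\<dots> \<le> s * h^2 / sqrt n * (6 * ?e)"
        using exp_absorb(1)[OF v] s n0 by (intro mult_left_mono) auto
      finally show ?thesis by (simp add: ac_simps)
    qed
    have B: "norm (f s ^ n - cumulant_exp s ^ n) \<le> s * (\<epsilon> * ?e)"
    proof -
      have "norm (cumulant_exp s) \<le> exp (- (s^2) / 4)" by (simp add: norm_cumulant_exp)
      then have "norm (f s ^ n - cumulant_exp s ^ n) \<le> n * exp (- (s^2) / 4) ^ (n - 1) * norm (f s - cumulant_exp s)"
        using \<delta>(4)[OF s] n by (intro norm_power_diff_bound) auto
      also have "\<dots> \<le> n * exp (- v / 8) * (\<epsilon> / 16 * s^3)"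
      proof (intro mult_mono \<delta>(3) s)
        have "real n / 2 \<le> real (n - 1)" using n by (simp add: of_nat_diff)
        then have "real n / 2 * s^2 \<le> real (n - 1) * s^2" by (intro mult_right_mono) auto
        then have "real (n - 1) * (- (s^2) / 4) \<le> - v / 8" by (simp add: v_def)
        then show "exp (- (s^2) / 4) ^ (n - 1) \<le> exp (- v / 8)"
          unfolding exp_of_nat_mult[symmetric] by simp
      qed auto
      also have "\<dots> = s * \<epsilon> / 16 * (v * exp (- v / 8))" by (simp add: v_def eval_nat_numeral)
      also have "\<dots> \<le> s * \<epsilon> / 16 * (16 * ?e)"
        using exp_absorb(2)[OF v] s assms by (intro mult_left_mono) auto
      finally show ?thesis by simp
    qed
    have D: "norm (cumulant_exp s ^ n - edgeworth_char n s) \<le> s * (400 * third_moment^2 / sqrt n * ?e)"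
    proof -
      define y where "y = - third_moment * n * s^3 / 6"
      have "cumulant_exp s ^ n = exp (of_nat n * Complex (- (s^2) / 2) (- third_moment * s^3 / 6))"
        by (simp add: cumulant_exp_def exp_of_nat_mult)
      also have "of_nat n * Complex (- (s^2) / 2) (- third_moment * s^3 / 6) = of_real (- v / 2) + \<i> * of_real y"
        by (simp add: complex_eq_iff v_def y_def)
      also have "exp \<dots> = of_real (exp (- v / 2)) * iexp y"
        by (simp only: exp_add exp_of_real)
      finally have bn: "cumulant_exp s ^ n = of_real (exp (- v / 2)) * iexp y" .
      have "edgeworth_char n s = of_real (exp (- v / 2)) * (1 + \<i> * of_real y)"
        by (simp add: edgeworth_char_def v_def y_def)
      with bn have "norm (cumulant_exp s ^ n - edgeworth_char n s) = norm (of_real (exp (- v / 2)) * (iexp y - (1 + \<i> * of_real y)))"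
        by (simp add: right_diff_distrib)
      also have "\<dots> = exp (- v / 2) * norm (iexp y - (1 + \<i> * of_real y))"
        by (simp add: norm_mult)
      also have "\<dots> \<le> exp (- v / 2) * y^2"
      proof (rule mult_left_mono)
        have "norm (iexp y - (1 + \<i> * of_real y)) \<le> y^2 / 2"
          using iexp_approx1[of y 1] by (simp add: power2_eq_square)
        moreover have "0 \<le> y^2" by simp
        ultimately show "norm (iexp y - (1 + \<i> * of_real y)) \<le> y^2" by linarith
      qed simp
      also have "y^2 = s * third_moment^2 / 36 / sqrt n * (v^2 * sqrt v)"
        unfolding sv using n0 by (simp add: y_def v_def power_mult_distrib power_divide eval_nat_numeral)
      also have "exp (- v / 2) * (s * third_moment^2 / 36 / sqrt n * (v^2 * sqrt v)) = s * third_moment^2 / 36 / sqrt n * (v^2 * sqrt v * exp (- v / 2))"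
        by simp
      also have "\<dots> \<le> s * third_moment^2 / 36 / sqrt n * (400 * ?e)"
        using exp_absorb(3)[OF v] s n0 by (intro mult_left_mono) auto
      also have "\<dots> \<le> s * third_moment^2 / 1 / sqrt n * (400 * ?e)"
        using s n0 by (intro mult_right_mono divide_right_mono divide_left_mono) auto
      finally show ?thesis by (simp add: ac_simps)
    qed
    have "norm (f s ^ n * ?u - edgeworth_char n s) \<le> norm (f s ^ n * ?u - f s ^ n) + norm (f s ^ n - cumulant_exp s ^ n) + norm (cumulant_exp s ^ n - edgeworth_char n s)"
      using norm_triangle_ineq[of "f s ^ n * ?u - f s ^ n" "f s ^ n - cumulant_exp s ^ n"]
        norm_triangle_ineq[of "f s ^ n * ?u - cumulant_exp s ^ n" "cumulant_exp s ^ n - edgeworth_char n s"] by simp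
    also have "\<dots> \<le> s * (6 * h^2 / sqrt n * ?e) + s * (\<epsilon> * ?e) + s * (400 * third_moment^2 / sqrt n * ?e)"
      using A B D by linarith
    also have "\<dots> = s * ((\<epsilon> + K / sqrt n) * ?e)"
      by (simp add: K_def algebra_simps add_divide_distrib)
    finally show "char_error h n s \<le> (\<epsilon> + K / sqrt n) * exp (- (n * s^2) / 16)"
      using s by (simp add: char_error_def v_def field_simps)
  qed
qed

end

section \<open>Characteristic functions away from the origin\<close>

context standardized_law begin

text \<open>At a frequency where \<open>\<bar>f\<bar> = 1\<close> the powers of \<open>f\<close> do not decay, so the smoothing law must vanish there;
  the inequality asks for this at the rate at which \<open>\<bar>f\<bar>\<close> leaves \<open>1\<close>. For \<open>h = 0\<close> it says that \<open>\<bar>f\<bar>\<close> stays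
  below \<open>1\<close> away from the origin.\<close>

definition smoothing_span :: "real \<Rightarrow> bool" where
  "smoothing_span h \<longleftrightarrow> h \<ge> 0 \<and> (\<forall>\<delta>>0. \<forall>A. \<exists>C. \<forall>s. \<delta> \<le> s \<and> s \<le> A \<longrightarrow>
     norm (char (spread h) s) ^ 2 \<le> C * (1 - norm (f s) ^ 2))"

lemma norm_spread_le_1: "norm (char (spread h) s) \<le> 1"
  by (rule real_distribution.cmod_char_le_1[OF real_distribution_spread])

lemma spread_measurable [measurable]: "char (spread h) \<in> borel_measurable borel"
  by (rule real_distribution.char_measurable[OF real_distribution_spread])

lemma f_measurable [measurable]: "f \<in> borel_measurable borel"
  by (rule char_measurable)

lemma edgeworth_char_measurable [measurable]: "edgeworth_char n \<in> borel_measurable borel"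
  unfolding edgeworth_char_def by measurable

lemma char_error_measurable [measurable]: "char_error h n \<in> borel_measurable borel"
  unfolding char_error_def by measurable

text \<open>With \<open>y = 1 - \<bar>f\<bar>\<^sup>2\<close> the square of the integrand is at most \<open>C n y (1 - y)\<^sup>n \<le> C n y exp (- n y) \<le> C\<close>. So the
  integrand is bounded, and it tends to \<open>0\<close> pointwise: exponentially if \<open>\<bar>f\<bar> < 1\<close>, trivially if
  \<open>\<bar>f\<bar> = 1\<close>.\<close>

lemma outer_f:
  assumes h: "smoothing_span h" and \<delta>: "\<delta> > 0"
  shows "(\<lambda>n. \<integral>s. sqrt n * (indicator {\<delta>..A} s * (norm (f s) ^ n * norm (char (spread h) s))) \<partial>lborel) \<longlonglongrightarrow> 0"
proof -
  let ?u = "\<lambda>s. norm (char (spread h) s)"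
  obtain C where C: "\<And>s. \<delta> \<le> s \<Longrightarrow> s \<le> A \<Longrightarrow> ?u s ^ 2 \<le> C * (1 - norm (f s) ^ 2)"
    using h \<delta> unfolding smoothing_span_def by meson
  have f1: "norm (f s) ^ 2 \<le> 1" for s using cmod_char_le_1[of s] by (simp add: power_le_one)
  have bound: "sqrt n * (norm (f s) ^ n * ?u s) \<le> sqrt \<bar>C\<bar>" if s: "\<delta> \<le> s" "s \<le> A" for n s
  proof (rule real_le_rsqrt)
    define y where "y = 1 - norm (f s) ^ 2"
    have y: "0 \<le> y" using f1 by (simp add: y_def)
    have "(sqrt n * (norm (f s) ^ n * ?u s))^2 = n * ((norm (f s) ^ 2) ^ n * ?u s ^ 2)"
    proof -
      have "(norm (f s) ^ n)^2 = (norm (f s) ^ 2) ^ n"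
        by (simp only: power_mult[symmetric] mult.commute)
      then show ?thesis by (simp only: power_mult_distrib) simp
    qed
    also have "\<dots> \<le> n * (exp (- y) ^ n * (\<bar>C\<bar> * y))"
    proof (intro mult_left_mono mult_mono power_mono)
      show "norm (f s) ^ 2 \<le> exp (- y)" using exp_ge_add_one_self[of "-y"] by (simp add: y_def)
      have "?u s ^ 2 \<le> C * y" using C[OF s] by (simp add: y_def)
      also have "\<dots> \<le> \<bar>C\<bar> * y" using y by (intro mult_right_mono) auto
      finally show "?u s ^ 2 \<le> \<bar>C\<bar> * y" .
    qed auto
    also have "\<dots> = \<bar>C\<bar> * (n * y * exp (- (n * y)))" by (simp flip: exp_of_nat_mult)
    also have "\<dots> \<le> \<bar>C\<bar> * 1"
    proof (rule mult_left_mono)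
      have "n * y \<le> exp (n * y)" using exp_ge_add_one_self[of "n * y"] by linarith
      then show "n * y * exp (- (n * y)) \<le> 1" by (simp add: exp_minus field_simps)
    qed simp
    finally show "(sqrt n * (norm (f s) ^ n * ?u s))^2 \<le> \<bar>C\<bar>" by simp
  qed
  have lim: "(\<lambda>n. sqrt n * (norm (f s) ^ n * ?u s)) \<longlonglongrightarrow> 0" if s: "\<delta> \<le> s" "s \<le> A" for s
  proof (cases "norm (f s) < 1")
    case True
    have *: "(\<lambda>n. real n * norm (f s) ^ n) \<longlonglongrightarrow> 0"
      using powser_times_n_limit_0[of "norm (f s)"] True by simp
    show ?thesis
    proof (rule tendsto_sandwich[of "\<lambda>_. 0", OF _ _ tendsto_const *])
      show "\<forall>\<^sub>F n in sequentially. sqrt (real n) * (norm (f s) ^ n * ?u s) \<le> real n * norm (f s) ^ n"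
        using eventually_ge_at_top[of 1]
      proof eventually_elim
        case (elim n)
        have "sqrt n \<le> n" using elim by (intro real_le_lsqrt) (auto simp: power2_eq_square)
        moreover have "norm (f s) ^ n * ?u s \<le> norm (f s) ^ n"
          using norm_spread_le_1[of h s] by (intro mult_left_le) auto
        ultimately show ?case by (intro mult_mono) auto
      qed
    qed auto
  next
    case False
    then have "norm (f s) = 1" using cmod_char_le_1[of s] by linarith
    then have "?u s ^ 2 \<le> 0" using C[OF s] by simp
    then show ?thesis by simp
  qed
  have "(\<lambda>n. \<integral>s. sqrt n * (indicator {\<delta>..A} s * (norm (f s) ^ n * ?u s)) \<partial>lborel) \<longlonglongrightarrow> (\<integral>s. 0 \<partial>(lborel :: real measure))"
  proof (rule integral_dominated_convergence[where w="\<lambda>s. indicator {\<delta>..A} s * sqrt \<bar>C\<bar>"])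
    show "AE s in lborel. (\<lambda>n. sqrt n * (indicator {\<delta>..A} s * (norm (f s) ^ n * ?u s))) \<longlonglongrightarrow> 0"
      using lim by (intro AE_I2) (auto simp: indicator_def)
    show "AE s in lborel. norm (sqrt n * (indicator {\<delta>..A} s * (norm (f s) ^ n * ?u s))) \<le> indicator {\<delta>..A} s * sqrt \<bar>C\<bar>" for n
      using bound by (intro AE_I2) (auto simp: indicator_def abs_mult)
  qed auto
  then show ?thesis by simp
qed

lemma outer_g:
  assumes \<delta>: "\<delta> > 0"
  shows "(\<lambda>n. \<integral>s. sqrt n * (indicator {\<delta>..A} s * norm (edgeworth_char n s)) \<partial>lborel) \<longlonglongrightarrow> 0"
proof -
  define c where "c = \<bar>third_moment\<bar> * \<bar>A\<bar>^3 / 6"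
  define d where "d = \<delta>^2 / 2"
  have d: "d > 0" using \<delta> by (simp add: d_def)
  have c: "c \<ge> 0" by (simp add: c_def)
  have le: "norm (edgeworth_char n s) \<le> exp (- (n * d)) * (1 + n * c)" if s: "\<delta> \<le> s" "s \<le> A" for n s
  proof -
    have "norm (edgeworth_char n s) = exp (- (n * s^2) / 2) * norm (1 - \<i> * of_real (third_moment * n * s^3 / 6))"
      by (simp add: edgeworth_char_def norm_mult)
    also have "\<dots> \<le> exp (- (n * d)) * (1 + n * c)"
    proof (rule mult_mono)
      have "\<delta>^2 \<le> s^2" using s \<delta> by (intro power_mono) auto
      then have "n * (\<delta>^2 / 2) \<le> n * (s^2 / 2)" by (intro mult_left_mono) auto
      then show "exp (- (n * s^2) / 2) \<le> exp (- (n * d))" by (simp add: d_def)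
      have "norm (1 - \<i> * of_real (third_moment * n * s^3 / 6)) \<le> norm (1::complex) + norm (\<i> * of_real (third_moment * n * s^3 / 6))"
        by (rule norm_triangle_ineq4)
      also have "\<dots> = 1 + n * (\<bar>third_moment\<bar> * \<bar>s\<bar>^3 / 6)"
        by (simp add: norm_mult norm_divide norm_power)
      also have "\<dots> \<le> 1 + n * c"
        unfolding c_def using s \<delta> by (intro add_left_mono mult_left_mono divide_right_mono power_mono) auto
      finally show "norm (1 - \<i> * of_real (third_moment * n * s^3 / 6)) \<le> 1 + n * c" .
    qed auto
    finally show ?thesis .
  qed
  have "(\<lambda>n. \<integral>s. sqrt n * (indicator {\<delta>..A} s * norm (edgeworth_char n s)) \<partial>lborel) \<longlonglongrightarrow> 0"
  proof (rule tendsto_sandwich[of "\<lambda>_. 0" _ _ "\<lambda>n::nat. sqrt n * (exp (- (n * d)) * (1 + n * c)) * \<bar>A\<bar>"])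
    show "\<forall>\<^sub>F n in sequentially. (\<integral>s. sqrt n * (indicator {\<delta>..A} s * norm (edgeworth_char n s)) \<partial>lborel) \<le> sqrt n * (exp (- (n * d)) * (1 + n * c)) * \<bar>A\<bar>"
    proof (intro always_eventually allI)
      fix n :: nat
      have "(\<integral>s. sqrt n * (indicator {\<delta>..A} s * norm (edgeworth_char n s)) \<partial>lborel) \<le> (\<integral>s. (sqrt n * (exp (- (n * d)) * (1 + n * c))) * indicator {\<delta>..A} s \<partial>lborel)"
      proof (rule Bochner_Integration.integral_mono')
        show "sqrt n * (indicator {\<delta>..A} s * norm (edgeworth_char n s)) \<le> (sqrt n * (exp (- (n * d)) * (1 + n * c))) * indicator {\<delta>..A} s" for s
          using le[of s n] by (auto simp: indicator_def intro!: mult_left_mono)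
      qed (use c in auto)
      also have "\<dots> = (sqrt n * (exp (- (n * d)) * (1 + n * c))) * measure lborel {\<delta>..A}" by simp
      also have "\<dots> \<le> (sqrt n * (exp (- (n * d)) * (1 + n * c))) * \<bar>A\<bar>"
        using c \<delta> by (intro mult_left_mono) (cases "\<delta> \<le> A", auto)
      finally show "(\<integral>s. sqrt n * (indicator {\<delta>..A} s * norm (edgeworth_char n s)) \<partial>lborel) \<le> sqrt n * (exp (- (n * d)) * (1 + n * c)) * \<bar>A\<bar>" .
    qed
    have "(\<lambda>n::nat. sqrt n * (exp (- (n * d)) * (1 + n * c))) \<longlonglongrightarrow> 0" using d c by real_asymp
    from tendsto_mult_right[OF this, of "\<bar>A\<bar>"]
    show "(\<lambda>n. sqrt n * (exp (- (n * d)) * (1 + n * c)) * \<bar>A\<bar>) \<longlonglongrightarrow> 0" by simp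
  qed auto
  then show ?thesis .
qed

lemma char_error_dominated:
  assumes "\<epsilon> > 0"
  obtains \<delta> K where "\<delta> > 0" "K \<ge> 0"
    "\<And>n s. n \<ge> 2 \<Longrightarrow> indicator {0..A} s * char_error h n s \<le> (\<epsilon> + K / sqrt n) * exp (- (n * s\<^sup>2) / 16)
       + 1 / \<delta> * (indicator {\<delta>..A} s * (norm (f s) ^ n * norm (char (spread h) s)) + indicator {\<delta>..A} s * norm (edgeworth_char n s))"
proof -
  obtain \<delta> K where \<delta>: "\<delta> > 0" "K \<ge> 0"
    "\<And>n s. n \<ge> 2 \<Longrightarrow> 0 < s \<Longrightarrow> s \<le> \<delta> \<Longrightarrow> char_error h n s \<le> (\<epsilon> + K / sqrt n) * exp (- (n * s^2) / 16)"
    using char_error_inner[OF assms] by metis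
  show thesis
  proof (rule that[OF \<delta>(1,2)])
    fix n :: nat and s :: real assume n: "n \<ge> 2"
    let ?a = "(\<epsilon> + K / sqrt n) * exp (- (n * s\<^sup>2) / 16)"
    let ?b = "1 / \<delta> * (indicator {\<delta>..A} s * (norm (f s) ^ n * norm (char (spread h) s)) + indicator {\<delta>..A} s * norm (edgeworth_char n s))"
    have a: "?a \<ge> 0" using assms \<delta> by (intro mult_nonneg_nonneg add_nonneg_nonneg) auto
    have b: "?b \<ge> 0" using \<delta> by (intro mult_nonneg_nonneg add_nonneg_nonneg) auto
    consider "s \<le> 0 \<or> s > A" | "0 < s" "s \<le> \<delta>" "s \<le> A" | "\<delta> < s" "s \<le> A" by linarith
    then show "indicator {0..A} s * char_error h n s \<le> ?a + ?b"
    proof cases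
      case 1
      then have "indicator {0..A} s * char_error h n s = 0" by (auto simp: indicator_def char_error_def)
      then show ?thesis using a b by linarith
    next
      case 2
      then have "indicator {0..A} s * char_error h n s = char_error h n s" by (auto simp: indicator_def)
      then show ?thesis using \<delta>(3)[OF n, of s] 2 b by linarith
    next
      case 3
      have "char_error h n s \<le> (norm (f s) ^ n * norm (char (spread h) s) + norm (edgeworth_char n s)) / \<delta>"
        unfolding char_error_def using 3 \<delta> norm_triangle_ineq4[of "f s ^ n * char (spread h) s" "edgeworth_char n s"]
        by (intro frac_le) (auto simp: norm_mult norm_power)
      then show ?thesis using 3 \<delta> a by (auto simp: indicator_def)
    qed
  qed
qed

lemma
  assumes h: "smoothing_span h"
  shows char_error_integrable: "n \<ge> 2 \<Longrightarrow> integrable lborel (\<lambda>s. indicator {0..A} s * char_error h n s)"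
    and char_error_integral_tendsto: "(\<lambda>n. sqrt n * (\<integral>s. indicator {0..A} s * char_error h n s \<partial>lborel)) \<longlonglongrightarrow> 0"
proof -
  define Q1 where "Q1 \<delta> n s = indicator {\<delta>..A} s * (norm (f s) ^ n * norm (char (spread h) s))" for \<delta> n s
  define Q2 where "Q2 \<delta> n s = indicator {\<delta>..A} s * norm (edgeworth_char n s)" for \<delta> n s
  have q0: "0 \<le> indicator {0..A} s * char_error h n s" for n s by (auto simp: indicator_def char_error_def)
  have iQ1: "integrable lborel (Q1 \<delta> n)" for \<delta> n
  proof (rule Bochner_Integration.integrable_bound[OF integrable_indicator_Icc[of \<delta> A]])
    show "AE s in lborel. norm (Q1 \<delta> n s) \<le> norm (indicat_real {\<delta>..A} s)"
      by (intro AE_I2) (auto simp: Q1_def indicator_def abs_mult intro!: mult_le_one power_le_one cmod_char_le_1 norm_spread_le_1)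
  qed (simp add: Q1_def[abs_def])
  have iQ2: "integrable lborel (Q2 \<delta> n)" for \<delta> n
  proof -
    have "integrable lborel (\<lambda>s. indicator {\<delta>..A} s *\<^sub>R norm (edgeworth_char n s))"
      unfolding edgeworth_char_def by (intro borel_integrable_compact continuous_intros) auto
    then show ?thesis by (simp add: Q2_def[abs_def])
  qed
  have iG: "integrable lborel (\<lambda>s. exp (- (n * s\<^sup>2) / 16))" if "n \<ge> 2" for n :: nat
    using gauss_integral(1)[of "real n"] that by simp
  show int: "integrable lborel (\<lambda>s. indicator {0..A} s * char_error h n s)" if n: "n \<ge> 2" for n
  proof -
    obtain \<delta> K where \<delta>: "\<delta> > 0" "K \<ge> 0"
      "\<And>n s. n \<ge> 2 \<Longrightarrow> indicator {0..A} s * char_error h n s \<le> (1 + K / sqrt n) * exp (- (n * s\<^sup>2) / 16)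
         + 1 / \<delta> * (Q1 \<delta> n s + Q2 \<delta> n s)"
      unfolding Q1_def Q2_def using char_error_dominated[of 1 A h] zero_less_one by metis
    show ?thesis
    proof (rule Bochner_Integration.integrable_bound)
      show "integrable lborel (\<lambda>s. (1 + K / sqrt n) * exp (- (n * s\<^sup>2) / 16) + 1 / \<delta> * (Q1 \<delta> n s + Q2 \<delta> n s))"
        by (intro Bochner_Integration.integrable_add integrable_mult_right iG n iQ1 iQ2)
      show "AE s in lborel. norm (indicator {0..A} s * char_error h n s) \<le> norm ((1 + K / sqrt n) * exp (- (n * s\<^sup>2) / 16) + 1 / \<delta> * (Q1 \<delta> n s + Q2 \<delta> n s))"
        unfolding real_norm_def using \<delta>(3)[OF n] q0 by (intro AE_I2) (auto intro: order_trans[OF _ abs_ge_self])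
    qed simp
  qed
  show "(\<lambda>n. sqrt n * (\<integral>s. indicator {0..A} s * char_error h n s \<partial>lborel)) \<longlonglongrightarrow> 0"
  proof (rule LIMSEQ_I)
    fix r :: real assume r: "r > 0"
    obtain \<delta> K where \<delta>: "\<delta> > 0" "K \<ge> 0"
      "\<And>n s. n \<ge> 2 \<Longrightarrow> indicator {0..A} s * char_error h n s \<le> (r / 16 + K / sqrt n) * exp (- (n * s\<^sup>2) / 16)
         + 1 / \<delta> * (Q1 \<delta> n s + Q2 \<delta> n s)"
      unfolding Q1_def Q2_def using char_error_dominated[of "r / 16" A h] r by (metis zero_less_divide_iff zero_less_numeral)
    have le: "sqrt n * (\<integral>s. indicator {0..A} s * char_error h n s \<partial>lborel)
        \<le> (r / 16 + K / sqrt n) * sqrt (16 * pi) + 1 / \<delta> * ((\<integral>s. sqrt n * Q1 \<delta> n s \<partial>lborel) + (\<integral>s. sqrt n * Q2 \<delta> n s \<partial>lborel))"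
      if n: "n \<ge> 2" for n
    proof -
      have "(\<integral>s. indicator {0..A} s * char_error h n s \<partial>lborel) \<le> (\<integral>s. (r / 16 + K / sqrt n) * exp (- (n * s\<^sup>2) / 16) + 1 / \<delta> * (Q1 \<delta> n s + Q2 \<delta> n s) \<partial>lborel)"
        by (intro Bochner_Integration.integral_mono int n Bochner_Integration.integrable_add integrable_mult_right iG iQ1 iQ2 \<delta>(3))
      also have "\<dots> = (r / 16 + K / sqrt n) * sqrt (16 * pi / n) + 1 / \<delta> * ((\<integral>s. Q1 \<delta> n s \<partial>lborel) + (\<integral>s. Q2 \<delta> n s \<partial>lborel))"
        using iG[OF n] iQ1[of \<delta> n] iQ2[of \<delta> n] gauss_integral(2)[of "real n"] n by simp
      finally have "sqrt n * (\<integral>s. indicator {0..A} s * char_error h n s \<partial>lborel) \<le> sqrt n * ((r / 16 + K / sqrt n) * sqrt (16 * pi / n) + 1 / \<delta> * ((\<integral>s. Q1 \<delta> n s \<partial>lborel) + (\<integral>s. Q2 \<delta> n s \<partial>lborel)))"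
        by (intro mult_left_mono) auto
      also have "\<dots> = (r / 16 + K / sqrt n) * (sqrt n * sqrt (16 * pi / n)) + 1 / \<delta> * (sqrt n * (\<integral>s. Q1 \<delta> n s \<partial>lborel) + sqrt n * (\<integral>s. Q2 \<delta> n s \<partial>lborel))"
        by (simp only: distrib_left mult.left_commute)
      also have "sqrt n * sqrt (16 * pi / n) = sqrt (16 * pi)" using n by (simp flip: real_sqrt_mult)
      finally show ?thesis by (simp only: integral_mult_right_zero)
    qed
    have "(\<lambda>n. (r / 16 + K / sqrt n) * sqrt (16 * pi) + 1 / \<delta> * ((\<integral>s. sqrt n * Q1 \<delta> n s \<partial>lborel) + (\<integral>s. sqrt n * Q2 \<delta> n s \<partial>lborel)))
       \<longlonglongrightarrow> (r / 16 + 0) * sqrt (16 * pi) + 1 / \<delta> * (0 + 0)"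
    proof (intro tendsto_add tendsto_mult tendsto_const)
      show "(\<lambda>n. K / sqrt (real n)) \<longlonglongrightarrow> 0" by real_asymp
      show "(\<lambda>n. \<integral>s. sqrt n * Q1 \<delta> n s \<partial>lborel) \<longlonglongrightarrow> 0"
        unfolding Q1_def by (rule outer_f[OF h \<delta>(1)])
      show "(\<lambda>n. \<integral>s. sqrt n * Q2 \<delta> n s \<partial>lborel) \<longlonglongrightarrow> 0"
        unfolding Q2_def by (rule outer_g[OF \<delta>(1)])
    qed
    moreover have "(r / 16 + 0) * sqrt (16 * pi) + 1 / \<delta> * (0 + 0) < r"
    proof -
      have "sqrt (16 * pi) \<le> 8" using pi_less_4 by (intro real_le_lsqrt) auto
      then have "r / 16 * sqrt (16 * pi) \<le> r / 16 * 8" using r by (intro mult_left_mono) auto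
      then show ?thesis using r by simp
    qed
    ultimately have "\<forall>\<^sub>F n in sequentially. (r / 16 + K / sqrt n) * sqrt (16 * pi) + 1 / \<delta> * ((\<integral>s. sqrt n * Q1 \<delta> n s \<partial>lborel) + (\<integral>s. sqrt n * Q2 \<delta> n s \<partial>lborel)) < r"
      by (rule order_tendstoD)
    then have "\<forall>\<^sub>F n in sequentially. norm (sqrt n * (\<integral>s. indicator {0..A} s * char_error h n s \<partial>lborel) - 0) < r"
      using eventually_ge_at_top[of 2]
    proof eventually_elim
      case (elim n)
      have "0 \<le> sqrt n * (\<integral>s. indicator {0..A} s * char_error h n s \<partial>lborel)"
        by (rule mult_nonneg_nonneg[OF _ Bochner_Integration.integral_nonneg]) (simp_all only: q0 real_sqrt_ge_zero of_nat_0_le_iff)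
      then show ?case using le[OF elim(2)] elim(1) by simp
    qed
    then show "\<exists>no. \<forall>n\<ge>no. norm (sqrt n * (\<integral>s. indicator {0..A} s * char_error h n s \<partial>lborel) - 0) < r"
      by (simp only: eventually_sequentially)
  qed
qed

end

section \<open>Expansion of the smoothed sum\<close>

lemma
  fixes M N :: "real measure"
  assumes M: "real_distribution M" and N: "real_distribution N"
  shows real_distribution_convolution: "real_distribution (M \<star> N)"
    and char_convolution: "char (M \<star> N) t = char M t * char N t"
    and AE_convolution: "\<And>P R S. AE x in M. P x \<Longrightarrow> AE y in N. R y \<Longrightarrow> (\<And>x y. P x \<Longrightarrow> R y \<Longrightarrow> S (x + y)) \<Longrightarrow>
       Measurable.pred borel S \<Longrightarrow> AE z in M \<star> N. S z"
proof -
  interpret M: real_distribution M by fact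
  interpret N: real_distribution N by fact
  interpret MN: pair_prob_space M N ..
  have [measurable_cong]: "sets M = sets borel" "sets N = sets borel" by simp_all
  show "real_distribution (M \<star> N)"
    unfolding convolution_def by (rule MN.real_distribution_distr) measurable
  have int: "integrable (M \<Otimes>\<^sub>M N) (\<lambda>z. case z of (x, y) \<Rightarrow> iexp (t * x) * iexp (t * y))"
    by (rule MN.P.integrable_const_bound[where B=1]) (auto simp: norm_mult simp del: of_real_mult)
  have "char (M \<star> N) t = (\<integral>z. (case z of (x, y) \<Rightarrow> iexp (t * x) * iexp (t * y)) \<partial>(M \<Otimes>\<^sub>M N))"
    unfolding char_def convolution_def
    by (subst integral_distr) (auto intro!: Bochner_Integration.integral_cong simp: algebra_simps simp flip: exp_add)
  also have "\<dots> = (\<integral>x. (\<integral>y. iexp (t * x) * iexp (t * y) \<partial>N) \<partial>M)"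
    using MN.integral_fst'[OF int] by simp
  also have "\<dots> = char M t * char N t"
    unfolding char_def by (simp del: of_real_mult)
  finally show "char (M \<star> N) t = char M t * char N t" .
  fix P R S assume P: "AE x in M. P x" and R: "AE y in N. R y" and S: "\<And>x y. P x \<Longrightarrow> R y \<Longrightarrow> S (x + y)"
    and [measurable]: "Measurable.pred borel S"
  have "AE x in M. AE y in N. S (x + y)"
    using P
  proof eventually_elim
    case (elim x)
    show ?case using R by eventually_elim (rule S[OF elim])
  qed
  have "AE z in M \<Otimes>\<^sub>M N. S (case z of (x, y) \<Rightarrow> x + y)"
  proof (rule MN.AE_pair_measure)
    show "{z \<in> space (M \<Otimes>\<^sub>M N). S (case z of (x, y) \<Rightarrow> x + y)} \<in> sets (M \<Otimes>\<^sub>M N)" by measurable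
    show "AE x in M. AE y in N. S (case (x, y) of (x, y) \<Rightarrow> x + y)"
      using \<open>AE x in M. AE y in N. S (x + y)\<close> by simp
  qed
  then show "AE z in M \<star> N. S z"
    unfolding convolution_def by (subst AE_distr_iff) auto
qed

lemma
  assumes "real_distribution P"
  shows real_distribution_conv_power: "real_distribution (conv_power P n)"
    and char_conv_power: "char (conv_power P n) t = char P t ^ n"
proof -
  have "real_distribution (conv_power P n) \<and> char (conv_power P n) t = char P t ^ n"
  proof (induction n)
    case 0
    have "real_distribution (return borel (0::real))"
      by (auto simp: real_distribution_def real_distribution_axioms_def intro: prob_space_return)
    moreover have "char (return borel 0) t = 1"
      unfolding char_def by (subst integral_return) auto
    ultimately show ?case by simp
  next
    case (Suc n)
    then show ?case
      using assms by (auto intro: real_distribution_convolution simp: char_convolution)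
  qed
  then show "real_distribution (conv_power P n)" "char (conv_power P n) t = char P t ^ n" by auto
qed

context standardized_law begin

definition smoothed_sum :: "real \<Rightarrow> nat \<Rightarrow> real measure" where
  "smoothed_sum h n = (conv_power Q n \<star> spread h)"

lemma real_distribution_Q: "real_distribution Q" ..

lemma real_distribution_smoothed_sum: "real_distribution (smoothed_sum h n)"
  unfolding smoothed_sum_def
  by (intro real_distribution_convolution real_distribution_conv_power real_distribution_spread real_distribution_Q)

lemma char_smoothed_sum: "char (smoothed_sum h n) t = f t ^ n * char (spread h) t"
  unfolding smoothed_sum_def
  by (simp add: char_convolution real_distribution_conv_power real_distribution_Q real_distribution_spread char_conv_power)

text \<open>The frequency bound \<open>T\<close> is chosen so that the term \<open>m / T\<close> of the smoothing inequality takes half of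
  \<open>\<epsilon>\<close>; the frequency integral takes the other half as \<open>n\<close> grows.\<close>

theorem smoothed_edgeworth_expansion:
  assumes h: "smoothing_span h" and \<epsilon>: "\<epsilon> > 0"
  shows "\<forall>\<^sub>F n in sequentially. \<forall>x. sqrt n * \<bar>cdf (smoothed_sum h n) x - edgeworth_cdf third_moment n (x / sqrt n)\<bar> \<le> \<epsilon>"
proof -
  obtain K where K: "K > 0"
    "\<And>H \<gamma> m T q x. \<lbrakk>real_distribution H; integrable lborel \<gamma>; \<And>x. \<bar>\<gamma> x\<bar> \<le> m; T > 0;
       integrable lborel (\<lambda>t. indicator {0..T} t * q t);
       \<And>t. 0 < t \<Longrightarrow> t \<le> T \<Longrightarrow> norm (char H t - (\<integral>x. \<gamma> x *\<^sub>R iexp (t * x) \<partial>lborel)) \<le> t * q t\<rbrakk>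
      \<Longrightarrow> \<bar>cdf H x - (\<integral>z. \<gamma> z * indicator {..x} z \<partial>lborel)\<bar> \<le> K * ((\<integral>t. indicator {0..T} t * q t \<partial>lborel) + m / T)"
    by (rule esseen_smoothing) blast
  define c where "c = 1 + 6 * \<bar>third_moment\<bar>"
  define T where "T = 2 * K * c / \<epsilon>"
  have c: "c > 0" by (simp add: c_def add_pos_nonneg)
  have T: "T > 0" using K c \<epsilon> by (simp add: T_def)
  have "(\<lambda>n. K * (sqrt n * (\<integral>s. indicator {0..T} s * char_error h n s \<partial>lborel))) \<longlonglongrightarrow> K * 0"
    by (intro tendsto_mult tendsto_const char_error_integral_tendsto h)
  then have "\<forall>\<^sub>F n in sequentially. K * (sqrt n * (\<integral>s. indicator {0..T} s * char_error h n s \<partial>lborel)) < \<epsilon> / 2"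
    by (rule order_tendstoD) (use \<epsilon> in simp)
  then show ?thesis
    using eventually_ge_at_top[of 2]
  proof eventually_elim
    case (elim n)
    have n: "n > 0" "sqrt n > 0" using elim by auto
    show ?case
    proof
      fix x :: real
      have "\<bar>cdf (smoothed_sum h n) x - (\<integral>z. edgeworth_density third_moment n z * indicator {..x} z \<partial>lborel)\<bar>
          \<le> K * ((\<integral>s. indicator {0..T} s * char_error h n s \<partial>lborel) + (c / sqrt n) / T)"
      proof (rule K(2))
        show "real_distribution (smoothed_sum h n)" by (rule real_distribution_smoothed_sum)
        show "integrable lborel (edgeworth_density third_moment n)" by (rule edgeworth_density_integrable[OF n(1)])
        show "\<bar>edgeworth_density third_moment n x\<bar> \<le> c / sqrt n" for x
          unfolding c_def by (rule edgeworth_density_bound[OF n(1)])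
        show "integrable lborel (\<lambda>t. indicator {0..T} t * char_error h n t)" by (rule char_error_integrable[OF h elim(2)])
        show "norm (char (smoothed_sum h n) t - (\<integral>x. edgeworth_density third_moment n x *\<^sub>R iexp (t * x) \<partial>lborel)) \<le> t * char_error h n t" if "0 < t" "t \<le> T" for t
          unfolding char_smoothed_sum fourier_edgeworth[OF n(1)] edgeworth_char_def[symmetric] using that by (simp add: char_error_def)
      qed fact
      then have "\<bar>cdf (smoothed_sum h n) x - edgeworth_cdf third_moment n (x / sqrt n)\<bar>
          \<le> K * ((\<integral>s. indicator {0..T} s * char_error h n s \<partial>lborel) + (c / sqrt n) / T)"
        by (simp only: integral_edgeworth_density[OF n(1)])
      then have "sqrt n * \<bar>cdf (smoothed_sum h n) x - edgeworth_cdf third_moment n (x / sqrt n)\<bar>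
          \<le> sqrt n * (K * ((\<integral>s. indicator {0..T} s * char_error h n s \<partial>lborel) + (c / sqrt n) / T))"
        using n by (intro mult_left_mono) auto
      also have "\<dots> = K * (sqrt n * (\<integral>s. indicator {0..T} s * char_error h n s \<partial>lborel)) + K * c / T"
        using n by (simp add: algebra_simps)
      also have "K * c / T = \<epsilon> / 2" using K c \<epsilon> by (simp add: T_def field_simps)
      finally show "sqrt n * \<bar>cdf (smoothed_sum h n) x - edgeworth_cdf third_moment n (x / sqrt n)\<bar> \<le> \<epsilon>"
        using elim(1) by linarith
    qed
  qed
qed

end

section \<open>The limit functional\<close>

text \<open>The first order error of an interval with end points \<open>a\<close> and \<open>b\<close>: the skewness term, plus half an atom at
  each end point, gained by including or lost by excluding it.\<close>

definition interval_defect :: "real \<Rightarrow> real \<Rightarrow> real \<Rightarrow> real \<Rightarrow> real" where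
  "interval_defect m h a b = \<bar>m / 6 * (psi b - psi a)\<bar> + h / 2 * (std_normal_density a + std_normal_density b)"

definition limit_const :: "real \<Rightarrow> real \<Rightarrow> real" where
  "limit_const m h = (SUP p. interval_defect m h (fst p) (snd p))"

lemma std_normal_density_le_peak: "std_normal_density x \<le> std_normal_density 0"
  by (simp add: std_normal_density_def divide_right_mono)

lemma psi_le_peak: "(2/3 - x^2 / 6) * std_normal_density x \<le> 2/3 * std_normal_density 0"
proof -
  have "(2/3 - x^2 / 6) * std_normal_density x \<le> 2/3 * std_normal_density x"
    by (intro mult_right_mono) auto
  also have "\<dots> \<le> 2/3 * std_normal_density 0"
    using std_normal_density_le_peak[of x] by simp
  finally show ?thesis .
qed

lemma psi_ge_trough: "(1/3 + x^2 / 6) * std_normal_density x \<le> 1/3 * std_normal_density 0"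
proof -
  have "1 + x^2 / 2 \<le> exp (x^2 / 2)" by (rule exp_ge_add_one_self)
  then have "(1 + x^2 / 2) * exp (- x\<^sup>2 / 2) \<le> 1" by (simp add: exp_minus field_simps)
  then have "1 / 3 * (1 / sqrt (2 * pi)) * ((1 + x^2 / 2) * exp (- x\<^sup>2 / 2)) \<le> 1 / 3 * (1 / sqrt (2 * pi)) * 1"
    by (intro mult_left_mono) auto
  then show ?thesis by (simp add: std_normal_density_def algebra_simps add_divide_distrib)
qed

text \<open>Replacing both \<open>h\<close> and \<open>\<bar>m\<bar>\<close> by their maximum decouples the end points: the bound becomes a multiple of a
  function of \<open>a\<close>, at most \<open>2/3 \<phi> 0\<close>, plus a function of \<open>b\<close>, at most \<open>1/3 \<phi> 0\<close>.\<close>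

lemma interval_defect_le:
  assumes h: "h \<ge> 0"
  shows "interval_defect m h a b \<le> max h \<bar>m\<bar> * std_normal_density 0"
proof -
  let ?M = "max h \<bar>m\<bar>"
  have main: "\<bar>m\<bar> / 6 * (psi a - psi b) + h / 2 * (std_normal_density a + std_normal_density b) \<le> ?M * std_normal_density 0"
    if "psi b \<le> psi a" for a b
  proof -
    have "\<bar>m\<bar> / 6 * (psi a - psi b) + h / 2 * (std_normal_density a + std_normal_density b)
        \<le> ?M / 6 * (psi a - psi b) + ?M / 2 * (std_normal_density a + std_normal_density b)"
      using that h by (intro add_mono mult_right_mono) (auto intro!: add_nonneg_nonneg)
    also have "\<dots> = ?M * ((2/3 - a^2 / 6) * std_normal_density a + (1/3 + b^2 / 6) * std_normal_density b)"
      by (simp add: algebra_simps add_divide_distrib diff_divide_distrib)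
    also have "\<dots> \<le> ?M * std_normal_density 0"
      using psi_le_peak[of a] psi_ge_trough[of b] h by (intro mult_left_mono) auto
    finally show ?thesis .
  qed
  show ?thesis
  proof (cases "psi b \<le> psi a")
    case True
    then show ?thesis using main[of b a] by (simp add: interval_defect_def abs_mult)
  next
    case False
    then show ?thesis using main[of a b] by (simp add: interval_defect_def abs_mult add.commute)
  qed
qed

lemma interval_defect_le_limit_const:
  assumes "h \<ge> 0" shows "interval_defect m h a b \<le> limit_const m h"
proof -
  have "bdd_above (range (\<lambda>p. interval_defect m h (fst p) (snd p)))"
    using interval_defect_le[OF assms] by (auto intro!: bdd_aboveI)
  from cSUP_upper[OF UNIV_I this, of "(a, b)"] show ?thesis by (simp add: limit_const_def)
qed

lemma limit_const_le:
  assumes "h \<ge> 0" shows "limit_const m h \<le> max h \<bar>m\<bar> * std_normal_density 0"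
  unfolding limit_const_def by (intro cSUP_least interval_defect_le[OF assms]) auto

lemma limit_const_ge:
  assumes "h \<ge> 0" shows "h * std_normal_density 0 \<le> limit_const m h"
  using interval_defect_le_limit_const[OF assms, of m 0 0] by (simp add: interval_defect_def)

lemma limit_const_approx:
  assumes "h \<ge> 0" "\<epsilon> > 0"
  obtains a b where "a \<le> b" "interval_defect m h a b > limit_const m h - \<epsilon>"
proof -
  have "bdd_above (range (\<lambda>p. interval_defect m h (fst p) (snd p)))"
    using interval_defect_le[OF assms(1)] by (auto intro!: bdd_aboveI)
  then obtain p where p: "interval_defect m h (fst p) (snd p) > limit_const m h - \<epsilon>"
    using less_cSUP_iff[of UNIV "\<lambda>p. interval_defect m h (fst p) (snd p)" "limit_const m h - \<epsilon>"] assms(2)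
    by (auto simp: limit_const_def)
  have "interval_defect m h (fst p) (snd p) = interval_defect m h (snd p) (fst p)"
    by (simp add: interval_defect_def add.commute abs_minus_commute right_diff_distrib)
  with p show thesis
    by (cases "fst p \<le> snd p") (auto intro: that[of "fst p" "snd p"] that[of "snd p" "fst p"])
qed

lemma std_normal_density_lipschitz: "\<bar>std_normal_density y - std_normal_density x\<bar> \<le> \<bar>y - x\<bar>"
proof -
  have "\<exists>z. std_normal_density y - std_normal_density x = (y - x) * (- z * std_normal_density z)"
    if "x < y" for x y :: real
    using MVT2[of x y std_normal_density "\<lambda>z. - z * std_normal_density z"] that
      DERIV_std_normal_density[OF DERIV_ident] by auto
  moreover have "\<bar>- z * std_normal_density z\<bar> \<le> 1" for z
  proof -
    have "\<bar>z\<bar> \<le> 1 + z^2 / 2" using zero_le_power2[of "\<bar>z\<bar> - 1"] by (simp add: power2_eq_square algebra_simps)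
    also have "\<dots> \<le> exp (z^2 / 2)" by (rule exp_ge_add_one_self)
    finally have "\<bar>z\<bar> * exp (- z\<^sup>2 / 2) \<le> 1" by (simp add: exp_minus field_simps)
    then have "1 / sqrt (2 * pi) * (\<bar>z\<bar> * exp (- z\<^sup>2 / 2)) \<le> 1 * 1"
      using pi_gt3 by (intro mult_mono) auto
    then show ?thesis by (simp add: std_normal_density_def abs_mult)
  qed
  ultimately have *: "\<bar>std_normal_density y - std_normal_density x\<bar> \<le> \<bar>y - x\<bar>" if "x < y" for x y
    using that by (metis abs_mult abs_ge_zero mult_left_le)
  show ?thesis
    using *[of x y] *[of y x] by (cases x y rule: linorder_cases) (auto simp: abs_minus_commute)
qed

lemma psi_lipschitz: "\<bar>psi y - psi x\<bar> \<le> 32 * \<bar>y - x\<bar>"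
proof -
  have *: "\<bar>psi y - psi x\<bar> \<le> 32 * \<bar>y - x\<bar>" if xy: "x < y" for x y
  proof -
    obtain z where "psi y - psi x = (y - x) * ((z^3 - 3 * z) * std_normal_density z)"
      using MVT2[OF xy, of psi "\<lambda>z. (z^3 - 3 * z) * std_normal_density z", OF DERIV_psi] by blast
    then have "\<bar>psi y - psi x\<bar> = \<bar>y - x\<bar> * \<bar>(z^3 - 3 * z) * std_normal_density z\<bar>" by (simp only: abs_mult)
    also have "\<dots> \<le> \<bar>y - x\<bar> * 32" by (intro mult_left_mono psi_deriv_bound) auto
    finally show ?thesis by simp
  qed
  show ?thesis
    using *[of x y] *[of y x] by (cases x y rule: linorder_cases) (auto simp: abs_minus_commute)
qed

abbreviation Phi :: "real \<Rightarrow> real" where "Phi \<equiv> cdf std_normal_distribution"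

lemma Phi_diff: "x \<le> y \<Longrightarrow> Phi y - Phi x = (\<integral>z. std_normal_density z * indicator {x<..y} z \<partial>lborel)"
proof -
  assume "x \<le> y"
  have i: "integrable lborel (\<lambda>z. std_normal_density z * indicator {..x} z)" for x :: real
    by (rule Bochner_Integration.integrable_bound[of _ std_normal_density]) (auto simp: indicator_def)
  show ?thesis
    unfolding cdf_std_normal using \<open>x \<le> y\<close>
    by (subst Bochner_Integration.integral_diff[OF i i, symmetric])
       (auto intro!: Bochner_Integration.integral_cong simp: indicator_def)
qed

lemma Phi_increment: "\<bar>Phi (x + \<eta>) - Phi x - \<eta> * std_normal_density x\<bar> \<le> \<eta>^2"
proof -
  have *: "\<bar>Phi v - Phi u - (v - u) * std_normal_density w\<bar> \<le> (v - u)^2" if uv: "u \<le> v" and w: "w = u \<or> w = v" for u v w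
  proof -
    have i: "integrable lborel (\<lambda>z. std_normal_density z * indicator {u<..v} z)"
      by (rule Bochner_Integration.integrable_bound[of _ std_normal_density]) (auto simp: indicator_def)
    have eq: "Phi v - Phi u - (v - u) * std_normal_density w
       = (\<integral>z. std_normal_density z * indicator {u<..v} z - std_normal_density w * indicator {u<..v} z \<partial>lborel)"
      using uv i by (simp add: Phi_diff)
    have "\<bar>Phi v - Phi u - (v - u) * std_normal_density w\<bar> \<le> (\<integral>z. norm (std_normal_density z * indicator {u<..v} z - std_normal_density w * indicator {u<..v} z) \<partial>lborel)"
      unfolding eq real_norm_def[symmetric] by (rule integral_norm_bound)
    also have "\<dots> \<le> (\<integral>z. (v - u) * indicator {u<..v} z \<partial>lborel)"
    proof (rule Bochner_Integration.integral_mono')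
      fix z
      show "norm (std_normal_density z * indicator {u<..v} z - std_normal_density w * indicator {u<..v} z) \<le> (v - u) * indicator {u<..v} z"
        using std_normal_density_lipschitz[of z w] w uv by (auto simp: indicator_def)
    qed (use uv in auto)
    also have "\<dots> = (v - u)^2" using uv by (simp add: power2_eq_square)
    finally show ?thesis .
  qed
  show ?thesis
    using *[of x "x + \<eta>" x] *[of "x + \<eta>" x x] by (cases "\<eta> \<ge> 0") (auto simp: abs_le_iff)
qed

lemma Phi_cont: "isCont Phi x"
proof -
  interpret real_distribution std_normal_distribution by (rule real_dist_normal_dist)
  have "emeasure std_normal_distribution {x} = 0"
    by (subst emeasure_density) (auto simp: nn_integral_0_iff_AE AE_lborel_singleton elim: eventually_mono)
  then show ?thesis by (simp add: isCont_cdf measure_def)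
qed

text \<open>Moving the argument by \<open>c / sqrt n\<close> shifts \<open>\<Phi>\<close> by \<open>c / sqrt n\<close> times the density and \<open>\<psi>\<close> by \<open>O (1 / sqrt n)\<close> only.\<close>

lemma edgeworth_cdf_shift:
  assumes n: "n > 0"
  shows "\<bar>sqrt n * (edgeworth_cdf m n (y + c / sqrt n) - Phi y) - (m / 6 * psi y + c * std_normal_density y)\<bar>
    \<le> (c^2 + 6 * \<bar>m\<bar> * \<bar>c\<bar>) / sqrt n"
proof -
  let ?r = "sqrt n"
  let ?\<eta> = "c / ?r"
  have r: "?r > 0" using n by simp
  have "?r * (edgeworth_cdf m n (y + ?\<eta>) - Phi y) - (m / 6 * psi y + c * std_normal_density y)
    = ?r * (Phi (y + ?\<eta>) - Phi y - ?\<eta> * std_normal_density y) + m / 6 * (psi (y + ?\<eta>) - psi y)"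
    using r unfolding edgeworth_cdf_def by (simp add: field_simps)
  also have "\<bar>\<dots>\<bar> \<le> ?r * ?\<eta>^2 + \<bar>m\<bar> / 6 * (32 * \<bar>?\<eta>\<bar>)"
  proof (rule order_trans[OF abs_triangle_ineq add_mono])
    show "\<bar>?r * (Phi (y + ?\<eta>) - Phi y - ?\<eta> * std_normal_density y)\<bar> \<le> ?r * ?\<eta>^2"
      unfolding abs_mult using r Phi_increment[of y ?\<eta>] by (intro mult_mono) auto
    show "\<bar>m / 6 * (psi (y + ?\<eta>) - psi y)\<bar> \<le> \<bar>m\<bar> / 6 * (32 * \<bar>?\<eta>\<bar>)"
      unfolding abs_mult using psi_lipschitz[of "y + ?\<eta>" y] by (intro mult_mono) auto
  qed
  also have "?r * ?\<eta>^2 = c^2 / ?r" using r by (simp add: power2_eq_square del: real_sqrt_mult_self)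
  also have "c^2 / ?r + \<bar>m\<bar> / 6 * (32 * \<bar>?\<eta>\<bar>) \<le> (c^2 + 6 * \<bar>m\<bar> * \<bar>c\<bar>) / ?r"
  proof -
    have "\<bar>m\<bar> / 6 * (32 * \<bar>?\<eta>\<bar>) = 16 / 3 * (\<bar>m\<bar> * \<bar>c\<bar> / ?r)" using r by (simp add: abs_divide)
    also have "\<dots> \<le> 6 * (\<bar>m\<bar> * \<bar>c\<bar> / ?r)" using r by (intro mult_right_mono) auto
    finally show ?thesis by (simp add: add_divide_distrib)
  qed
  finally show ?thesis .
qed

section \<open>Intervals, convolutions and lattices\<close>

text \<open>Each interval contains a countable set \<open>C\<close> with points on either side of each of its points: its
  rational points, together with its least and greatest point if they exist. The compact intervals
  spanned by the first members of an enumeration of \<open>C\<close> exhaust the interval.\<close>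

lemma interval_compact_exhaustion:
  fixes I :: "real set"
  assumes I: "is_interval I" "I \<noteq> {}"
  obtains a b :: "nat \<Rightarrow> real"
  where "\<And>k. a k \<le> b k" "incseq (\<lambda>k. {a k..b k})" "(\<Union>k. {a k..b k}) = I"
proof -
  define C where "C = (I \<inter> \<rat>) \<union> ({x\<in>I. \<forall>y\<in>I. x \<le> y} \<union> {x\<in>I. \<forall>y\<in>I. y \<le> x})"
  have CI: "C \<subseteq> I" by (auto simp: C_def)
  have conv: "z \<in> I" if "x \<in> I" "y \<in> I" "x \<le> z" "z \<le> y" for x y z
    using I(1) that unfolding is_interval_1 by blast
  have lo: "\<exists>c\<in>C. c \<le> x" if x: "x \<in> I" for x
  proof (cases "\<forall>y\<in>I. x \<le> y")
    case True
    then show ?thesis using x by (auto simp: C_def)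
  next
    case False
    then obtain y where y: "y \<in> I" "y < x" by force
    obtain r where "r \<in> \<rat>" "y < r" "r < x" using Rats_dense_in_real[OF y(2)] by blast
    then show ?thesis using conv[OF y(1) x, of r] by (intro bexI[of _ r]) (auto simp: C_def)
  qed
  have hi: "\<exists>c\<in>C. x \<le> c" if x: "x \<in> I" for x
  proof (cases "\<forall>y\<in>I. y \<le> x")
    case True
    then show ?thesis using x by (auto simp: C_def)
  next
    case False
    then obtain y where y: "y \<in> I" "x < y" by force
    obtain r where "r \<in> \<rat>" "x < r" "r < y" using Rats_dense_in_real[OF y(2)] by blast
    then show ?thesis using conv[OF x y(1), of r] by (intro bexI[of _ r]) (auto simp: C_def)
  qed
  have "{x\<in>I. \<forall>y\<in>I. x \<le> y} \<subseteq> {Inf I}" "{x\<in>I. \<forall>y\<in>I. y \<le> x} \<subseteq> {Sup I}"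
    by (auto intro!: cInf_eq_minimum[symmetric] cSup_eq_maximum[symmetric])
  then have "countable {x\<in>I. \<forall>y\<in>I. x \<le> y}" "countable {x\<in>I. \<forall>y\<in>I. y \<le> x}"
    by (auto intro: countable_finite dest: finite_subset)
  then have C: "countable C" unfolding C_def using countable_rat by (auto intro: countable_subset[of _ \<rat>])
  have "C \<noteq> {}" using I(2) lo by blast
  define e where "e = from_nat_into C"
  have e: "range e = C" unfolding e_def using C \<open>C \<noteq> {}\<close> by (rule range_from_nat_into[rotated])
  define a where "a k = Min (e ` {..k})" for k
  define b where "b k = Max (e ` {..k})" for k
  have aI: "a k \<in> I" and bI: "b k \<in> I" for k
  proof -
    have "a k \<in> e ` {..k}" "b k \<in> e ` {..k}" unfolding a_def b_def by (intro Min_in Max_in; simp)+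
    then show "a k \<in> I" "b k \<in> I" using e CI by blast+
  qed
  have ae: "a k \<le> e j" and be: "e j \<le> b k" if "j \<le> k" for j k
    using that by (auto simp: a_def b_def)
  show thesis
  proof (rule that[of a b])
    show "a k \<le> b k" for k using ae[of 0 k] be[of 0 k] by simp
    show "incseq (\<lambda>k. {a k..b k})"
    proof (rule monoI)
      fix j k :: nat assume "j \<le> k"
      then have "a k \<le> a j" "b j \<le> b k"
        unfolding a_def b_def by (intro Min_antimono Max_mono image_mono; auto)+
      then show "{a j..b j} \<subseteq> {a k..b k}" by auto
    qed
    show "(\<Union>k. {a k..b k}) = I"
    proof (intro equalityI subsetI)
      fix x assume x: "x \<in> I"
      obtain i where i: "e i \<le> x" using lo[OF x] e by blast
      obtain j where j: "x \<le> e j" using hi[OF x] e by blast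
      have "a (max i j) \<le> x" "x \<le> b (max i j)"
        using ae[of i "max i j"] be[of j "max i j"] i j by auto
      then show "x \<in> (\<Union>k. {a k..b k})" by auto
    next
      fix x assume "x \<in> (\<Union>k. {a k..b k})"
      then obtain k where "a k \<le> x" "x \<le> b k" by auto
      then show "x \<in> I" by (rule conv[OF aI bI])
    qed
  qed
qed

lemma interval_measure_diff_le:
  assumes P: "real_distribution P" and N: "real_distribution N"
    and le: "\<And>a b. a \<le> b \<Longrightarrow> \<bar>measure P {a..b} - measure N {a..b}\<bar> \<le> D"
    and I: "is_interval I"
  shows "\<bar>measure P I - measure N I\<bar> \<le> D"
proof (cases "I = {}")
  case True
  have "0 \<le> D" using order_trans[OF abs_ge_zero le[of 0 0]] by simp
  then show ?thesis using True by simp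
next
  case False
  interpret P: real_distribution P by fact
  interpret N: real_distribution N by fact
  obtain a b where ab: "\<And>k. a k \<le> b k" "incseq (\<lambda>k. {a k..b k})" "(\<Union>k. {a k..b k}) = I"
    using interval_compact_exhaustion[OF I False] by blast
  have "(\<lambda>k. \<bar>measure P {a k..b k} - measure N {a k..b k}\<bar>) \<longlonglongrightarrow> \<bar>measure P I - measure N I\<bar>"
    unfolding ab(3)[symmetric]
    by (intro tendsto_rabs tendsto_diff P.finite_Lim_measure_incseq N.finite_Lim_measure_incseq ab(2)) auto
  then show ?thesis by (rule Lim_bounded) (use le ab(1) in auto)
qed

lemma
  fixes M N :: "real measure"
  assumes M: "real_distribution M" and N: "real_distribution N"
    and P: "AE x in M. P x" and R: "AE y in N. R y"
    and [measurable]: "A \<in> sets borel" "B \<in> sets borel"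
  shows convolution_measure_le: "(\<And>x y. P x \<Longrightarrow> R y \<Longrightarrow> x + y \<in> A \<Longrightarrow> x \<in> B) \<Longrightarrow> measure (M \<star> N) A \<le> measure M B"
    and convolution_measure_ge: "(\<And>x y. P x \<Longrightarrow> R y \<Longrightarrow> x \<in> B \<Longrightarrow> x + y \<in> A) \<Longrightarrow> measure M B \<le> measure (M \<star> N) A"
proof -
  interpret M: real_distribution M by fact
  interpret N: real_distribution N by fact
  interpret MN: pair_prob_space M N ..
  have [measurable_cong]: "sets M = sets borel" "sets N = sets borel" by simp_all
  have AE1: "AE z in M \<Otimes>\<^sub>M N. P (fst z)"
  proof (rule AE_distrD[of fst _ M])
    show "AE x in distr (M \<Otimes>\<^sub>M N) M fst. P x" unfolding N.distr_pair_fst by (rule P)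
  qed simp
  have "distr (M \<Otimes>\<^sub>M N) N snd = N"
  proof (rule measure_eqI)
    fix X assume "X \<in> sets (distr (M \<Otimes>\<^sub>M N) N snd)"
    then have [measurable]: "X \<in> sets N" and [simp]: "X \<in> sets borel" by simp_all
    have "emeasure (distr (M \<Otimes>\<^sub>M N) N snd) X = emeasure (M \<Otimes>\<^sub>M N) (UNIV \<times> X)"
      by (subst emeasure_distr) (auto simp: space_pair_measure intro!: arg_cong[where f="emeasure _"])
    also have "\<dots> = emeasure M UNIV * emeasure N X" by (rule N.emeasure_pair_measure_Times) auto
    finally show "emeasure (distr (M \<Otimes>\<^sub>M N) N snd) X = emeasure N X"
      using M.emeasure_space_1 by simp
  qed simp
  then have "AE x in distr (M \<Otimes>\<^sub>M N) N snd. R x" using R by (simp only:)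
  then have AE2: "AE z in M \<Otimes>\<^sub>M N. R (snd z)"
    by (rule AE_distrD[rotated]) simp
  have mA: "measure (M \<star> N) A = measure (M \<Otimes>\<^sub>M N) {z \<in> space (M \<Otimes>\<^sub>M N). fst z + snd z \<in> A}"
    unfolding convolution_def by (subst measure_distr) (auto simp: case_prod_beta intro!: arg_cong[where f="measure _"])
  have mB: "measure M B = measure (M \<Otimes>\<^sub>M N) {z \<in> space (M \<Otimes>\<^sub>M N). fst z \<in> B}"
    by (subst N.distr_pair_fst[of M, symmetric], subst measure_distr) (auto intro!: arg_cong[where f="measure _"])
  show "measure (M \<star> N) A \<le> measure M B" if "\<And>x y. P x \<Longrightarrow> R y \<Longrightarrow> x + y \<in> A \<Longrightarrow> x \<in> B"
    unfolding mA mB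
  proof (rule MN.P.finite_measure_mono_AE)
    show "AE z in M \<Otimes>\<^sub>M N. z \<in> {z \<in> space (M \<Otimes>\<^sub>M N). fst z + snd z \<in> A} \<longrightarrow> z \<in> {z \<in> space (M \<Otimes>\<^sub>M N). fst z \<in> B}"
      using AE1 AE2 by eventually_elim (use that in auto)
  qed measurable
  show "measure M B \<le> measure (M \<star> N) A" if "\<And>x y. P x \<Longrightarrow> R y \<Longrightarrow> x \<in> B \<Longrightarrow> x + y \<in> A"
    unfolding mA mB
  proof (rule MN.P.finite_measure_mono_AE)
    show "AE z in M \<Otimes>\<^sub>M N. z \<in> {z \<in> space (M \<Otimes>\<^sub>M N). fst z \<in> B} \<longrightarrow> z \<in> {z \<in> space (M \<Otimes>\<^sub>M N). fst z + snd z \<in> A}"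
      using AE1 AE2 by eventually_elim (use that in auto)
  qed measurable
qed

definition lattice_law :: "real measure \<Rightarrow> real \<Rightarrow> real \<Rightarrow> bool" where
  "lattice_law M c h \<longleftrightarrow> (AE x in M. \<exists>k::int. x = c + h * of_int k)"

lemma lattice_law_conv_power:
  assumes "real_distribution P" "lattice_law P c h"
  shows "lattice_law (conv_power P n) (n * c) h"
proof (induction n)
  case 0
  have "Measurable.pred borel (\<lambda>x. \<exists>k::int. x = h * of_int k)" by measurable
  then have "AE x in return borel (0::real). \<exists>k::int. x = h * of_int k"
    by (subst AE_return) (auto intro: exI[of _ 0])
  then show ?case by (simp add: lattice_law_def)
next
  case (Suc n)
  have "AE z in P \<star> conv_power P n. \<exists>k::int. z = (real (Suc n) * c) + h * of_int k"
  proof (rule AE_convolution[OF assms(1) real_distribution_conv_power[OF assms(1)]])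
    show "AE x in P. \<exists>k::int. x = c + h * of_int k" using assms(2) by (simp add: lattice_law_def)
    show "AE x in conv_power P n. \<exists>k::int. x = n * c + h * of_int k" using Suc by (simp add: lattice_law_def)
    show "\<exists>k::int. x + y = (real (Suc n) * c) + h * of_int k"
      if kl: "\<exists>k::int. x = c + h * of_int k" "\<exists>k::int. y = real n * c + h * of_int k" for x y :: real
    proof -
      obtain k l :: int where "x = c + h * of_int k" "y = n * c + h * of_int l" using kl by blast
      then show "\<exists>k::int. x + y = (real (Suc n) * c) + h * of_int k" by (intro exI[of _ "k + l"]) (simp add: algebra_simps)
    qed
    show "Measurable.pred borel (\<lambda>z. \<exists>k::int. z = (real (Suc n) * c) + h * of_int k)" by measurable
  qed
  then show ?case by (simp add: lattice_law_def)
qed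

text \<open>No mass in the open intervals of length \<open>h\<close> on either side of \<open>x\<close>. This holds for every real \<open>x\<close> if \<open>h = 0\<close>
  and for the lattice points of a lattice law of span \<open>h\<close>, which lets both kinds of law share one proof.\<close>

definition isolated_point :: "real measure \<Rightarrow> real \<Rightarrow> real \<Rightarrow> bool" where
  "isolated_point M h x \<longleftrightarrow> (AE s in M. (s < x + h \<longrightarrow> s \<le> x) \<and> (x - h < s \<longrightarrow> x \<le> s))"

lemma isolated_point_0: "isolated_point M 0 x"
  by (auto simp: isolated_point_def)

lemma isolated_point_lattice:
  assumes "lattice_law M c h" "h > 0"
  shows "isolated_point M h (c + h * of_int k)"
  using assms(1) unfolding isolated_point_def lattice_law_def
proof eventually_elim
  case (elim x)
  then obtain l :: int where l: "x = c + h * of_int l" by blast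
  have "l \<le> k" if "x < c + h * of_int k + h"
  proof -
    have "h * of_int l < h * (of_int k + 1)" using that l by (simp add: algebra_simps)
    then have "real_of_int l < of_int k + 1" using assms(2) by simp
    then show ?thesis by linarith
  qed
  moreover have "k \<le> l" if "c + h * of_int k - h < x"
  proof -
    have "h * of_int k < h * (of_int l + 1)" using that l by (simp add: algebra_simps)
    then have "real_of_int k < of_int l + 1" using assms(2) by simp
    then show ?thesis by linarith
  qed
  ultimately show ?case using assms(2) l by auto
qed

lemma isolated_rounding:
  assumes "h = 0 \<or> (h > 0 \<and> lattice_law M c h)"
  obtains G :: "real \<Rightarrow> real" where "mono G" "\<And>x. \<bar>G x - x\<bar> \<le> h" "\<And>x. isolated_point M h (G x)"
proof (cases "h = 0")
  case True
  then show ?thesis by (intro that[of "\<lambda>x. x"]) (auto simp: isolated_point_0 mono_def)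
next
  case False
  then have h: "h > 0" "lattice_law M c h" using assms by auto
  let ?G = "\<lambda>x. c + h * of_int \<lfloor>(x - c) / h\<rfloor>"
  show ?thesis
  proof (rule that[of ?G])
    show "mono ?G" using h by (auto simp: mono_def divide_right_mono intro!: mult_left_mono floor_mono)
    fix x
    have "h * of_int \<lfloor>(x - c) / h\<rfloor> \<le> h * ((x - c) / h)" using h by (intro mult_left_mono) auto
    moreover have "h * ((x - c) / h) \<le> h * (of_int \<lfloor>(x - c) / h\<rfloor> + 1)" using h by (intro mult_left_mono) linarith+
    moreover have "h * ((x - c) / h) = x - c" using h by simp
    ultimately show "\<bar>?G x - x\<bar> \<le> h" using h by (simp only: distrib_left abs_le_iff) linarith
    show "isolated_point M h (?G x)" by (rule isolated_point_lattice[OF h(2,1)])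
  qed
qed

section \<open>The limit of the interval distance\<close>

lemma std_normal_Icc:
  assumes "a \<le> b" shows "measure std_normal_distribution {a..b} = Phi b - Phi a"
proof -
  interpret real_distribution std_normal_distribution by (rule real_dist_normal_dist)
  have "measure std_normal_distribution {a} = 0" using isCont_cdf[of a] Phi_cont[of a] by simp
  moreover have "{a..b} = {a} \<union> {a<..b}" using assms by auto
  moreover have "measure std_normal_distribution ({a} \<union> {a<..b}) = measure std_normal_distribution {a} + measure std_normal_distribution {a<..b}"
    by (rule finite_measure_Union) auto
  moreover have "measure std_normal_distribution {a<..b} = Phi b - Phi a"
    using assms by (cases "a = b") (auto simp: cdf_diff_eq)
  ultimately show ?thesis by (simp del: Un_insert_left)
qed

lemma std_normal_Ioo:
  assumes "a < b" shows "measure std_normal_distribution {a<..<b} = Phi b - Phi a"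
proof -
  interpret real_distribution std_normal_distribution by (rule real_dist_normal_dist)
  have "measure std_normal_distribution {b} = 0" using isCont_cdf[of b] Phi_cont[of b] by simp
  moreover have "{a<..b} = {b} \<union> {a<..<b}" using assms by auto
  moreover have "measure std_normal_distribution ({b} \<union> {a<..<b}) = measure std_normal_distribution {b} + measure std_normal_distribution {a<..<b}"
    by (rule finite_measure_Union) auto
  moreover have "measure std_normal_distribution {a<..b} = Phi b - Phi a"
    using assms by (auto simp: cdf_diff_eq)
  ultimately show ?thesis by (simp del: Un_insert_left)
qed

lemma (in real_distribution)
  shows measure_Icc_eq: "a \<le> b \<Longrightarrow> measure M {a..b} = measure M {..b} - measure M {..<a}"
    and measure_Ioo_eq: "a < b \<Longrightarrow> measure M {a<..<b} = measure M {..<b} - measure M {..a}"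
proof -
  show "measure M {a..b} = measure M {..b} - measure M {..<a}" if "a \<le> b"
  proof -
    have "measure M ({..<a} \<union> {a..b}) = measure M {..<a} + measure M {a..b}"
      by (rule finite_measure_Union) auto
    moreover have "{..<a} \<union> {a..b} = {..b}" using that by auto
    ultimately show ?thesis by (metis add_diff_cancel_left')
  qed
  show "measure M {a<..<b} = measure M {..<b} - measure M {..a}" if "a < b"
  proof -
    have "measure M ({..a} \<union> {a<..<b}) = measure M {..a} + measure M {a<..<b}"
      by (rule finite_measure_Union) auto
    moreover have "{..a} \<union> {a<..<b} = {..<b}" using that by auto
    ultimately show ?thesis by (metis add_diff_cancel_left')
  qed
qed

text \<open>The smoothing moves points by at most \<open>h/2\<close>, which gives the first four bounds. At an isolated point,
  moving by at most \<open>h/2\<close> cannot reach past the middle of an adjacent gap; this turns the one-sided bounds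
  around.\<close>

lemma convolution_spread_bounds:
  assumes M: "real_distribution M" and h: "h \<ge> 0"
  shows "measure (M \<star> spread h) {..x - h/2} \<le> measure M {..x}"
    and "measure M {..x} \<le> measure (M \<star> spread h) {..x + h/2}"
    and "measure (M \<star> spread h) {..<x - h/2} \<le> measure M {..<x}"
    and "measure M {..<x} \<le> measure (M \<star> spread h) {..<x + h/2}"
    and "isolated_point M h x \<Longrightarrow> measure (M \<star> spread h) {..<x + h/2} \<le> measure M {..x}"
    and "isolated_point M h x \<Longrightarrow> measure M {..<x} \<le> measure (M \<star> spread h) {..x - h/2}"
proof -
  note le = convolution_measure_le[OF M real_distribution_spread _ AE_spread[OF h]]
  note ge = convolution_measure_ge[OF M real_distribution_spread _ AE_spread[OF h]]
  have T: "AE x in M. True" by simp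
  show "measure (M \<star> spread h) {..x - h/2} \<le> measure M {..x}" by (rule le[OF T]) auto
  show "measure M {..x} \<le> measure (M \<star> spread h) {..x + h/2}" by (rule ge[OF T]) auto
  show "measure (M \<star> spread h) {..<x - h/2} \<le> measure M {..<x}" by (rule le[OF T]) auto
  show "measure M {..<x} \<le> measure (M \<star> spread h) {..<x + h/2}" by (rule ge[OF T]) auto
  show "measure (M \<star> spread h) {..<x + h/2} \<le> measure M {..x}" if "isolated_point M h x"
  proof (rule le[OF that[unfolded isolated_point_def]])
    fix s u :: real
    assume s: "(s < x + h \<longrightarrow> s \<le> x) \<and> (x - h < s \<longrightarrow> x \<le> s)" and u: "\<bar>u\<bar> \<le> h / 2" and "s + u \<in> {..<x + h/2}"
    then have "s < x + h" using u by (auto simp: abs_le_iff)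
    then show "s \<in> {..x}" using s by simp
  qed auto
  show "measure M {..<x} \<le> measure (M \<star> spread h) {..x - h/2}" if "isolated_point M h x"
  proof (rule ge[OF that[unfolded isolated_point_def]])
    fix s u :: real
    assume s: "(s < x + h \<longrightarrow> s \<le> x) \<and> (x - h < s \<longrightarrow> x \<le> s)" and u: "\<bar>u\<bar> \<le> h / 2" and "s \<in> {..<x}"
    then have "s \<le> x - h" by auto
    then show "s + u \<in> {..x - h/2}" using u by (auto simp: abs_le_iff)
  qed auto
qed

context standardized_law begin

definition standardized_sum :: "nat \<Rightarrow> real measure" where
  "standardized_sum n = distr (conv_power Q n) borel (\<lambda>x. x / sqrt n)"

lemma real_distribution_standardized_sum: "real_distribution (standardized_sum n)"
proof -
  interpret C: real_distribution "conv_power Q n" by (intro real_distribution_conv_power real_distribution_Q)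
  show ?thesis unfolding standardized_sum_def by (rule C.real_distribution_distr) simp
qed

lemma measure_standardized_sum:
  assumes n: "n > 0"
  shows "measure (standardized_sum n) {a..b} = measure (conv_power Q n) {sqrt n * a..sqrt n * b}"
    and "measure (standardized_sum n) {a<..<b} = measure (conv_power Q n) {sqrt n * a<..<sqrt n * b}"
proof -
  interpret C: real_distribution "conv_power Q n" by (intro real_distribution_conv_power real_distribution_Q)
  have r: "sqrt n > 0" using n by simp
  show "measure (standardized_sum n) {a..b} = measure (conv_power Q n) {sqrt n * a..sqrt n * b}"
    unfolding standardized_sum_def using r
    by (subst measure_distr) (auto intro!: arg_cong[where f="measure _"] simp: field_simps)
  show "measure (standardized_sum n) {a<..<b} = measure (conv_power Q n) {sqrt n * a<..<sqrt n * b}"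
    unfolding standardized_sum_def using r
    by (subst measure_distr) (auto intro!: arg_cong[where f="measure _"] simp: field_simps)
qed

text \<open>The open half-lines follow from the closed ones by left limits, since the approximation is continuous.\<close>

lemma smoothed_shift_expansion:
  assumes h: "smoothing_span h" and \<epsilon>: "\<epsilon> > 0"
  shows "\<forall>\<^sub>F n in sequentially. \<forall>y. \<forall>c\<in>{-h/2, h/2}.
     \<bar>sqrt n * (measure (smoothed_sum h n) {..sqrt n * y + c} - Phi y) - (third_moment / 6 * psi y + c * std_normal_density y)\<bar> \<le> \<epsilon>
   \<and> \<bar>sqrt n * (measure (smoothed_sum h n) {..<sqrt n * y + c} - Phi y) - (third_moment / 6 * psi y + c * std_normal_density y)\<bar> \<le> \<epsilon>"
proof -
  define K where "K = (h/2)^2 + 6 * \<bar>third_moment\<bar> * \<bar>h/2\<bar>"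
  have "(\<lambda>n. K / sqrt (real n)) \<longlonglongrightarrow> 0" by real_asymp
  then have "\<forall>\<^sub>F n in sequentially. K / sqrt (real n) < \<epsilon> / 2"
    by (rule order_tendstoD) (use \<epsilon> in simp)
  moreover have "\<forall>\<^sub>F n in sequentially. \<forall>x. sqrt n * \<bar>cdf (smoothed_sum h n) x - edgeworth_cdf third_moment n (x / sqrt n)\<bar> \<le> \<epsilon> / 2"
    by (rule smoothed_edgeworth_expansion[OF h]) (use \<epsilon> in simp)
  ultimately show ?thesis
    using eventually_gt_at_top[of 0]
  proof eventually_elim
    case (elim n)
    interpret H: real_distribution "smoothed_sum h n" by (rule real_distribution_smoothed_sum)
    have r: "sqrt n > 0" using elim by simp
    let ?E = "\<lambda>x. edgeworth_cdf third_moment n (x / sqrt n)"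
    have cE: "isCont ?E x" for x
    proof -
      have "isCont (edgeworth_cdf third_moment n) y" for y
        unfolding edgeworth_cdf_def[abs_def] by (intro continuous_intros Phi_cont)
      moreover have "isCont (\<lambda>x. x / sqrt n) x" using r by (intro continuous_intros) auto
      ultimately show ?thesis using isCont_o2 by blast
    qed
    have 1: "\<bar>sqrt n * (measure (smoothed_sum h n) {..x} - ?E x)\<bar> \<le> \<epsilon> / 2" for x
      using elim(2)[rule_format, of x] r by (simp add: abs_mult cdf_def2)
    have 2: "\<bar>sqrt n * (measure (smoothed_sum h n) {..<x} - ?E x)\<bar> \<le> \<epsilon> / 2" for x
    proof (rule tendsto_upperbound)
      have "(?E \<longlongrightarrow> ?E x) (at_left x)"
        using cE[of x] unfolding isCont_def by (rule tendsto_mono[rotated]) (simp add: at_le)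
      then show "((\<lambda>y. \<bar>sqrt n * (cdf (smoothed_sum h n) y - ?E y)\<bar>) \<longlongrightarrow> \<bar>sqrt n * (measure (smoothed_sum h n) {..<x} - ?E x)\<bar>) (at_left x)"
        by (intro tendsto_intros H.cdf_at_left)
      show "\<forall>\<^sub>F y in at_left x. \<bar>sqrt n * (cdf (smoothed_sum h n) y - ?E y)\<bar> \<le> \<epsilon> / 2"
        using 1 by (simp add: cdf_def2)
    qed simp
    have 3: "\<bar>sqrt n * (?E (sqrt n * y + c) - Phi y) - (third_moment / 6 * psi y + c * std_normal_density y)\<bar> \<le> \<epsilon> / 2"
      if c: "c \<in> {-h/2, h/2}" for y c
    proof -
      have e1: "(sqrt n * y + c) / sqrt n = y + c / sqrt n" using r by (simp add: add_divide_distrib)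
      have e2: "c^2 + 6 * \<bar>third_moment\<bar> * \<bar>c\<bar> = K" using c by (auto simp: K_def)
      show ?thesis
        using edgeworth_cdf_shift[OF elim(3), of third_moment y c] elim(1) unfolding e1 e2 by linarith
    qed
    have comb: "\<bar>r * (X - P) - Z\<bar> \<le> \<epsilon>" if "\<bar>r * (X - E)\<bar> \<le> \<epsilon> / 2" "\<bar>r * (E - P) - Z\<bar> \<le> \<epsilon> / 2" for r X P Z E
    proof -
      have "r * (X - P) - Z = r * (X - E) + (r * (E - P) - Z)" by (simp add: algebra_simps)
      then show ?thesis using that by linarith
    qed
    show ?case using comb[OF 1 3] comb[OF 2 3] by blast
  qed
qed

text \<open>A compact interval has at most the smoothed mass of the interval enlarged by \<open>h/2\<close> at both ends, and at least
  that of the shrunken one; the two estimates differ from the normal mass by \<open>\<plusminus> interval_defect\<close> at most. General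
  intervals are limits of compact ones.\<close>

lemma interval_error_upper:
  assumes h: "smoothing_span h" and \<epsilon>: "\<epsilon> > 0"
  shows "\<forall>\<^sub>F n in sequentially. sqrt n * interval_distance (standardized_sum n) std_normal_distribution
     \<le> limit_const third_moment h + \<epsilon>"
proof -
  have h0: "h \<ge> 0" using h by (simp add: smoothing_span_def)
  from smoothed_shift_expansion[OF h, of "\<epsilon> / 2"] \<epsilon>
  have "\<forall>\<^sub>F n in sequentially. \<forall>y. \<forall>c\<in>{-h/2, h/2}.
     \<bar>sqrt n * (measure (smoothed_sum h n) {..sqrt n * y + c} - Phi y) - (third_moment / 6 * psi y + c * std_normal_density y)\<bar> \<le> \<epsilon> / 2
   \<and> \<bar>sqrt n * (measure (smoothed_sum h n) {..<sqrt n * y + c} - Phi y) - (third_moment / 6 * psi y + c * std_normal_density y)\<bar> \<le> \<epsilon> / 2" by simp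
  then show ?thesis
    using eventually_gt_at_top[of 0]
  proof eventually_elim
    case (elim n)
    interpret C: real_distribution "conv_power Q n" by (intro real_distribution_conv_power real_distribution_Q)
    have r: "sqrt n > 0" using elim by simp
    note bounds = convolution_spread_bounds[OF C.real_distribution_axioms h0, folded smoothed_sum_def]
    have compact: "\<bar>measure (standardized_sum n) {a..b} - measure std_normal_distribution {a..b}\<bar>
        \<le> (limit_const third_moment h + \<epsilon>) / sqrt n" if ab: "a \<le> b" for a b
    proof -
      let ?M = "measure (conv_power Q n)" and ?H = "measure (smoothed_sum h n)"
      have sab: "sqrt n * a \<le> sqrt n * b" using ab r by simp
      define t where "t y = third_moment / 6 * psi y" for y
      define d where "d y = h / 2 * std_normal_density y" for y
      note E = elim(1)[rule_format, folded t_def, unfolded right_diff_distrib]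
      have E': "\<bar>sqrt n * ?H {..sqrt n * b + h/2} - sqrt n * Phi b - (t b + d b)\<bar> \<le> \<epsilon> / 2"
        "\<bar>sqrt n * ?H {..<sqrt n * a - h/2} - sqrt n * Phi a - (t a - d a)\<bar> \<le> \<epsilon> / 2"
        "\<bar>sqrt n * ?H {..sqrt n * b - h/2} - sqrt n * Phi b - (t b - d b)\<bar> \<le> \<epsilon> / 2"
        "\<bar>sqrt n * ?H {..<sqrt n * a + h/2} - sqrt n * Phi a - (t a + d a)\<bar> \<le> \<epsilon> / 2"
        using E[of "h/2" b] E[of "-h/2" a] E[of "-h/2" b] E[of "h/2" a] by (simp_all add: d_def)
      have up: "sqrt n * ?M {..sqrt n * b} \<le> sqrt n * ?H {..sqrt n * b + h/2}"
               "sqrt n * ?H {..<sqrt n * a - h/2} \<le> sqrt n * ?M {..<sqrt n * a}"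
               "sqrt n * ?H {..sqrt n * b - h/2} \<le> sqrt n * ?M {..sqrt n * b}"
               "sqrt n * ?M {..<sqrt n * a} \<le> sqrt n * ?H {..<sqrt n * a + h/2}"
        using bounds(1-4) r by (auto intro!: mult_left_mono)
      have "sqrt n * (measure (standardized_sum n) {a..b} - measure std_normal_distribution {a..b})
         = sqrt n * ?M {..sqrt n * b} - sqrt n * ?M {..<sqrt n * a} - sqrt n * Phi b + sqrt n * Phi a"
        using ab elim(2) sab by (simp add: measure_standardized_sum C.measure_Icc_eq std_normal_Icc algebra_simps)
      moreover have "\<bar>sqrt n * ?M {..sqrt n * b} - sqrt n * ?M {..<sqrt n * a} - sqrt n * Phi b + sqrt n * Phi a\<bar>
         \<le> \<bar>t b - t a\<bar> + (d a + d b) + \<epsilon>"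
        using up E' by linarith
      moreover have "interval_defect third_moment h a b = \<bar>t b - t a\<bar> + (d a + d b)"
        by (simp add: interval_defect_def t_def d_def right_diff_distrib distrib_left)
      ultimately have "\<bar>sqrt n * (measure (standardized_sum n) {a..b} - measure std_normal_distribution {a..b})\<bar>
         \<le> interval_defect third_moment h a b + \<epsilon>" by (simp only:)
      also have "\<dots> \<le> limit_const third_moment h + \<epsilon>"
        using interval_defect_le_limit_const[OF h0] by simp
      finally show ?thesis using r unfolding abs_mult by (simp add: pos_le_divide_eq mult.commute)
    qed
    have "interval_distance (standardized_sum n) std_normal_distribution \<le> (limit_const third_moment h + \<epsilon>) / sqrt n"
      unfolding interval_distance_def
    proof (rule cSUP_least)
      fix I :: "real set" assume "I \<in> {I. is_interval I}"
      then show "\<bar>measure (standardized_sum n) I - measure std_normal_distribution I\<bar> \<le> (limit_const third_moment h + \<epsilon>) / sqrt n"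
        using interval_measure_diff_le[OF real_distribution_standardized_sum real_dist_normal_dist compact] by simp
    qed (use is_interval_empty in blast)
    then show ?case using r by (simp add: field_simps)
  qed
qed

lemma interval_distance_ge:
  assumes "is_interval I" "real_distribution P" "real_distribution N"
  shows "\<bar>measure P I - measure N I\<bar> \<le> interval_distance P N"
proof -
  interpret P: real_distribution P by fact
  interpret N: real_distribution N by fact
  show ?thesis
    unfolding interval_distance_def
  proof (rule cSUP_upper)
    have "\<bar>measure P I - measure N I\<bar> \<le> 1" for I
      using P.prob_le_1[of I] N.prob_le_1[of I] measure_nonneg[of P I] measure_nonneg[of N I] by linarith
    then show "bdd_above ((\<lambda>I. \<bar>measure P I - measure N I\<bar>) ` {I. is_interval I})"
      by (intro bdd_aboveI[of _ 1]) auto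
  qed (use assms in simp)
qed

lemma rounded_points_tendsto:
  fixes G :: "nat \<Rightarrow> real \<Rightarrow> real"
  assumes "\<And>n x. \<bar>G n x - x\<bar> \<le> h"
  shows "(\<lambda>n. G n (sqrt n * a) / sqrt n) \<longlonglongrightarrow> a"
proof (rule LIMSEQ_I)
  fix r :: real assume r: "r > 0"
  have "(\<lambda>n. h / sqrt (real n)) \<longlonglongrightarrow> 0" by real_asymp
  then have "\<forall>\<^sub>F n in sequentially. h / sqrt (real n) < r" by (rule order_tendstoD) (rule r)
  then have "\<forall>\<^sub>F n in sequentially. norm (G n (sqrt n * a) / sqrt n - a) < r"
    using eventually_gt_at_top[of 0]
  proof eventually_elim
    case (elim n)
    have "G n (sqrt n * a) / sqrt n - a = (G n (sqrt n * a) - sqrt n * a) / sqrt n"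
      using elim(2) by (simp add: diff_divide_distrib)
    also have "norm \<dots> \<le> h / sqrt n"
      unfolding real_norm_def abs_divide using assms[of n "sqrt n * a"] by (simp add: divide_right_mono)
    finally show ?case using elim(1) by linarith
  qed
  then show "\<exists>no. \<forall>n\<ge>no. norm (G n (sqrt n * a) / sqrt n - a) < r"
    by (simp only: eventually_sequentially)
qed

text \<open>End points that nearly maximize \<open>interval_defect\<close> are rounded to isolated points. There the closed interval
  has the full smoothed mass of the enlarged interval, and the open interval no more than that of the shrunken
  one. The closed interval realizes the defect when the skewness term is nonnegative, the open one otherwise.\<close>

lemma interval_error_lower:
  assumes h: "smoothing_span h" and lattice: "h = 0 \<or> (\<exists>c. lattice_law Q c h)" and \<epsilon>: "\<epsilon> > 0"
  shows "\<forall>\<^sub>F n in sequentially. sqrt n * interval_distance (standardized_sum n) std_normal_distribution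
     \<ge> limit_const third_moment h - \<epsilon>"
proof -
  have h0: "h \<ge> 0" using h by (simp add: smoothing_span_def)
  have "\<exists>G :: real \<Rightarrow> real. mono G \<and> (\<forall>x. \<bar>G x - x\<bar> \<le> h) \<and> (\<forall>x. isolated_point (conv_power Q n) h (G x))" for n
  proof -
    have "\<exists>c. h = 0 \<or> (h > 0 \<and> lattice_law (conv_power Q n) c h)"
      using lattice h0 lattice_law_conv_power[OF real_distribution_Q] by (metis less_eq_real_def)
    then show ?thesis using isolated_rounding by metis
  qed
  then obtain G :: "nat \<Rightarrow> real \<Rightarrow> real" where G: "\<And>n. mono (G n)" "\<And>n x. \<bar>G n x - x\<bar> \<le> h"
    "\<And>n x. isolated_point (conv_power Q n) h (G n x)" by metis
  obtain a b where ab: "a \<le> b" "interval_defect third_moment h a b > limit_const third_moment h - \<epsilon> / 2"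
    using limit_const_approx[OF h0, of "\<epsilon> / 2"] \<epsilon> by auto
  define u where "u n = G n (sqrt n * a) / sqrt n" for n :: nat
  define v where "v n = G n (sqrt n * b) / sqrt n" for n :: nat
  have u: "u \<longlonglongrightarrow> a" and v: "v \<longlonglongrightarrow> b"
    unfolding u_def v_def using rounded_points_tendsto[of G, OF G(2)] by auto
  have "(\<lambda>n. interval_defect third_moment h (u n) (v n)) \<longlonglongrightarrow> interval_defect third_moment h a b"
  proof -
    have 1: "(\<lambda>n. std_normal_density (w n)) \<longlonglongrightarrow> std_normal_density z" if "w \<longlonglongrightarrow> z" for w z
      using isCont_tendsto_compose[OF isCont_std_normal_density that] .
    show ?thesis unfolding interval_defect_def by (intro tendsto_intros u v 1)
  qed
  then have ev1: "\<forall>\<^sub>F n in sequentially. interval_defect third_moment h (u n) (v n) > limit_const third_moment h - \<epsilon> / 2"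
    by (rule order_tendstoD) (rule ab(2))
  have psiv: "(\<lambda>n. psi (v n) - psi (u n)) \<longlonglongrightarrow> psi b - psi a"
    using isCont_tendsto_compose[OF DERIV_isCont[OF DERIV_psi] u] isCont_tendsto_compose[OF DERIV_isCont[OF DERIV_psi] v]
    by (rule_tac tendsto_diff)
  \<comment> \<open>For \<open>a = b\<close> both points are rounded to the same point, and the skewness term is \<open>0\<close>.\<close>
  have ev2: "\<forall>\<^sub>F n in sequentially. third_moment * (psi (v n) - psi (u n)) \<ge> 0 \<or> u n < v n"
  proof (cases "a < b")
    case True
    have "\<forall>\<^sub>F n in sequentially. 0 < v n - u n"
      by (rule order_tendstoD[OF tendsto_diff[OF v u]]) (use True in simp)
    then show ?thesis by eventually_elim auto
  next
    case False
    then have "u n = v n" for n using ab(1) by (simp add: u_def v_def)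
    then show ?thesis by simp
  qed
  from smoothed_shift_expansion[OF h, of "\<epsilon> / 4"] \<epsilon>
  have "\<forall>\<^sub>F n in sequentially. \<forall>y. \<forall>c\<in>{-h/2, h/2}.
     \<bar>sqrt n * (measure (smoothed_sum h n) {..sqrt n * y + c} - Phi y) - (third_moment / 6 * psi y + c * std_normal_density y)\<bar> \<le> \<epsilon> / 4
   \<and> \<bar>sqrt n * (measure (smoothed_sum h n) {..<sqrt n * y + c} - Phi y) - (third_moment / 6 * psi y + c * std_normal_density y)\<bar> \<le> \<epsilon> / 4" by simp
  then show ?thesis
    using ev1 ev2 eventually_gt_at_top[of 0]
  proof eventually_elim
    case (elim n)
    interpret C: real_distribution "conv_power Q n" by (intro real_distribution_conv_power real_distribution_Q)
    have r: "sqrt n > 0" using elim by simp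
    note bounds = convolution_spread_bounds[OF C.real_distribution_axioms h0, folded smoothed_sum_def]
    let ?M = "measure (conv_power Q n)" and ?H = "measure (smoothed_sum h n)"
    let ?a = "u n" and ?b = "v n"
    let ?D = "interval_distance (standardized_sum n) std_normal_distribution"
    have ia: "isolated_point (conv_power Q n) h (sqrt n * ?a)" and ib: "isolated_point (conv_power Q n) h (sqrt n * ?b)"
      using G(3) r by (simp_all add: u_def v_def)
    have uv: "?a \<le> ?b"
      unfolding u_def v_def using ab(1) r by (intro divide_right_mono monoD[OF G(1)] mult_left_mono) auto
    define t where "t y = third_moment / 6 * psi y" for y
    define d where "d y = h / 2 * std_normal_density y" for y
    note E = elim(1)[rule_format, folded t_def, unfolded right_diff_distrib]
    have E': "\<bar>sqrt n * ?H {..sqrt n * ?b - h/2} - sqrt n * Phi ?b - (t ?b - d ?b)\<bar> \<le> \<epsilon> / 4"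
      "\<bar>sqrt n * ?H {..<sqrt n * ?a + h/2} - sqrt n * Phi ?a - (t ?a + d ?a)\<bar> \<le> \<epsilon> / 4"
      "\<bar>sqrt n * ?H {..<sqrt n * ?b + h/2} - sqrt n * Phi ?b - (t ?b + d ?b)\<bar> \<le> \<epsilon> / 4"
      "\<bar>sqrt n * ?H {..sqrt n * ?a - h/2} - sqrt n * Phi ?a - (t ?a - d ?a)\<bar> \<le> \<epsilon> / 4"
      using E[of "-h/2" ?b] E[of "h/2" ?a] E[of "h/2" ?b] E[of "-h/2" ?a] by (simp_all add: d_def)
    have up: "sqrt n * ?H {..<sqrt n * ?b + h/2} \<le> sqrt n * ?M {..sqrt n * ?b}"
             "sqrt n * ?M {..<sqrt n * ?a} \<le> sqrt n * ?H {..sqrt n * ?a - h/2}"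
             "sqrt n * ?M {..<sqrt n * ?b} \<le> sqrt n * ?H {..sqrt n * ?b - h/2}"
             "sqrt n * ?H {..<sqrt n * ?a + h/2} \<le> sqrt n * ?M {..sqrt n * ?a}"
      using bounds(5,6)[OF ia] bounds(5,6)[OF ib] r by (auto intro!: mult_left_mono)
    have def: "interval_defect third_moment h ?a ?b = \<bar>t ?b - t ?a\<bar> + (d ?a + d ?b)"
      by (simp add: interval_defect_def t_def d_def right_diff_distrib distrib_left)
    have tt: "t ?b - t ?a = third_moment * (psi ?b - psi ?a) / 6" by (simp add: t_def right_diff_distrib diff_divide_distrib)
    have "interval_defect third_moment h ?a ?b - \<epsilon> / 2 \<le> sqrt n * ?D"
    proof (cases "t ?b - t ?a \<ge> 0")
      case True
      have "sqrt n * (measure (standardized_sum n) {?a..?b} - measure std_normal_distribution {?a..?b})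
         = sqrt n * ?M {..sqrt n * ?b} - sqrt n * ?M {..<sqrt n * ?a} - sqrt n * Phi ?b + sqrt n * Phi ?a"
        using uv elim(4) r by (simp add: measure_standardized_sum C.measure_Icc_eq std_normal_Icc algebra_simps)
      moreover have "\<dots> \<ge> interval_defect third_moment h ?a ?b - \<epsilon> / 2"
        unfolding def using up E' True by linarith
      moreover have "sqrt n * (measure (standardized_sum n) {?a..?b} - measure std_normal_distribution {?a..?b}) \<le> sqrt n * ?D"
      proof (rule mult_left_mono)
        have "\<bar>measure (standardized_sum n) {?a..?b} - measure std_normal_distribution {?a..?b}\<bar> \<le> ?D"
          by (rule interval_distance_ge[OF is_interval_cc real_distribution_standardized_sum real_dist_normal_dist])
        then show "measure (standardized_sum n) {?a..?b} - measure std_normal_distribution {?a..?b} \<le> ?D" by linarith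
      qed (use r in simp)
      ultimately show ?thesis by linarith
    next
      case False
      then have "\<not> third_moment * (psi ?b - psi ?a) \<ge> 0" unfolding tt by auto
      then have uv': "?a < ?b" using elim(3) by blast
      have "sqrt n * (measure (standardized_sum n) {?a<..<?b} - measure std_normal_distribution {?a<..<?b})
         = sqrt n * ?M {..<sqrt n * ?b} - sqrt n * ?M {..sqrt n * ?a} - sqrt n * Phi ?b + sqrt n * Phi ?a"
        using uv' elim(4) r by (simp add: measure_standardized_sum C.measure_Ioo_eq std_normal_Ioo algebra_simps)
      moreover have "\<dots> \<le> - (interval_defect third_moment h ?a ?b - \<epsilon> / 2)"
        unfolding def using up E' False by linarith
      moreover have "sqrt n * (measure std_normal_distribution {?a<..<?b} - measure (standardized_sum n) {?a<..<?b}) \<le> sqrt n * ?D"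
      proof (rule mult_left_mono)
        have "\<bar>measure (standardized_sum n) {?a<..<?b} - measure std_normal_distribution {?a<..<?b}\<bar> \<le> ?D"
          by (rule interval_distance_ge[OF is_interval_oo real_distribution_standardized_sum real_dist_normal_dist])
        then show "measure std_normal_distribution {?a<..<?b} - measure (standardized_sum n) {?a<..<?b} \<le> ?D" by linarith
      qed (use r in simp)
      ultimately show ?thesis by (simp only: right_diff_distrib)
    qed
    then show ?case using elim(2) by linarith
  qed
qed

theorem interval_error_tendsto:
  assumes h: "smoothing_span h" and lattice: "h = 0 \<or> (\<exists>c. lattice_law Q c h)"
  shows "(\<lambda>n. sqrt n * interval_distance (standardized_sum n) std_normal_distribution) \<longlonglongrightarrow> limit_const third_moment h"
proof (rule LIMSEQ_I)
  fix r :: real assume r: "r > 0"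
  have "\<forall>\<^sub>F n in sequentially. norm (sqrt n * interval_distance (standardized_sum n) std_normal_distribution - limit_const third_moment h) < r"
    using interval_error_upper[OF h half_gt_zero[OF r]] interval_error_lower[OF h lattice half_gt_zero[OF r]]
  proof eventually_elim
    case (elim n)
    then show ?case using r unfolding real_norm_def abs_less_iff by linarith
  qed
  then show "\<exists>no. \<forall>n\<ge>no. norm (sqrt n * interval_distance (standardized_sum n) std_normal_distribution - limit_const third_moment h) < r"
    by (simp only: eventually_sequentially)
qed

end

section \<open>Existence of the smoothing span\<close>

context standardized_law begin

lemma char_spread_0: "char (spread 0) s = 1"
  using real_distribution.char_zero[OF real_distribution_unit_uniform] by (simp add: char_spread)

lemma smoothing_span_0:
  assumes "\<And>s. s > 0 \<Longrightarrow> norm (f s) < 1"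
  shows "smoothing_span 0"
  unfolding smoothing_span_def
proof (intro conjI allI impI)
  fix \<delta> A :: real assume \<delta>: "\<delta> > 0"
  show "\<exists>C. \<forall>s. \<delta> \<le> s \<and> s \<le> A \<longrightarrow> norm (char (spread 0) s) ^ 2 \<le> C * (1 - norm (f s) ^ 2)"
  proof (cases "\<delta> \<le> A")
    case True
    have "continuous_on {\<delta>..A} (\<lambda>s. norm (f s))"
      by (intro continuous_at_imp_continuous_on ballI continuous_norm isCont_char)
    then obtain s0 where s0: "s0 \<in> {\<delta>..A}" "\<And>s. s \<in> {\<delta>..A} \<Longrightarrow> norm (f s) \<le> norm (f s0)"
      using continuous_attains_sup[of "{\<delta>..A}" "\<lambda>s. norm (f s)"] True by auto
    define y where "y = 1 - norm (f s0) ^ 2"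
    have y: "y > 0" using assms[of s0] s0(1) \<delta> by (simp add: y_def power_less_one_iff)
    show ?thesis
    proof (intro exI[of _ "1 / y"] allI impI)
      fix s assume s: "\<delta> \<le> s \<and> s \<le> A"
      have "norm (f s) ^ 2 \<le> norm (f s0) ^ 2" using s0(2)[of s] s by (intro power_mono) auto
      then have "1 / y * y \<le> 1 / y * (1 - norm (f s) ^ 2)" using y by (intro mult_left_mono) (auto simp: y_def)
      then show "norm (char (spread 0) s) ^ 2 \<le> 1 / y * (1 - norm (f s) ^ 2)" using y by (simp add: char_spread_0)
    qed
  qed auto
qed simp

lemma lattice_law_if_norm_char_eq_1:
  assumes s: "s > 0" and one: "norm (f s) = 1"
  shows "\<exists>c. lattice_law Q c (2 * pi / s)"
proof -
  define \<theta> where "\<theta> = Arg2pi (f s)"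
  have \<theta>: "f s = iexp \<theta>"
    using complex_norm_eq_1_exp[of "f s"] one by (simp add: \<theta>_def)
  have int: "integrable Q (\<lambda>x. iexp (s * x - \<theta>))"
    by (rule integrable_const_bound[where B=1]) (auto simp del: of_real_diff of_real_mult)
  have "expectation (\<lambda>x. cos (s * x - \<theta>)) = Re (\<integral>x. iexp (s * x - \<theta>) \<partial>Q)"
    by (subst integral_Re[OF int, symmetric]) (simp add: Re_exp del: of_real_diff of_real_mult)
  also have "(\<integral>x. iexp (s * x - \<theta>) \<partial>Q) = (\<integral>x. iexp (- \<theta>) * iexp (s * x) \<partial>Q)"
    by (intro Bochner_Integration.integral_cong) (auto simp: algebra_simps simp flip: exp_add)
  also have "\<dots> = iexp (- \<theta>) * f s" unfolding char_def by (rule integral_mult_right_zero)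
  also have "\<dots> = 1" unfolding \<theta> by (simp flip: exp_add)
  finally have E: "expectation (\<lambda>x. cos (s * x - \<theta>)) = 1" by simp
  have ic: "integrable Q (\<lambda>x. cos (s * x - \<theta>))" by (rule integrable_const_bound[where B=1]) auto
  have "expectation (\<lambda>x. 1 - cos (s * x - \<theta>)) = 0" using E ic prob_space by simp
  then have "AE x in Q. 1 - cos (s * x - \<theta>) = 0"
    using ic by (subst (asm) integral_nonneg_eq_0_iff_AE) auto
  then have "AE x in Q. \<exists>k::int. x = \<theta> / s + 2 * pi / s * of_int k"
  proof eventually_elim
    case (elim x)
    then obtain k :: int where "s * x - \<theta> = of_int k * 2 * pi" using cos_one_2pi_int[of "s * x - \<theta>"] by auto
    then show ?case using s by (intro exI[of _ k]) (simp add: field_simps)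
  qed
  then show ?thesis unfolding lattice_law_def by blast
qed

text \<open>The two atoms contribute \<open>p iexp (s x) + r iexp (s y)\<close> to the characteristic function, whose modulus falls short of
  \<open>p + r\<close> by at least \<open>2 p r sin\<^sup>2 (s (x - y) / 2)\<close>; the remaining mass contributes at most itself.\<close>

lemma char_norm_two_atoms:
  assumes xy: "x \<noteq> y"
  shows "2 * measure Q {x} * measure Q {y} * sin (s * (x - y) / 2) ^ 2 \<le> 1 - norm (f s) ^ 2"
proof -
  define p where "p = measure Q {x}"
  define r where "r = measure Q {y}"
  define S where "S = sin (s * (x - y) / 2) ^ 2"
  define R where "R = UNIV - {x, y}"
  have pr: "p \<ge> 0" "r \<ge> 0" by (simp_all add: p_def r_def)
  have S: "0 \<le> S" "S \<le> 1" by (simp_all add: S_def abs_square_le_1)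
  have [measurable]: "R \<in> sets Q" by (simp add: R_def)
  have "measure Q {x, y} = p + r"
    unfolding p_def r_def using xy finite_measure_Union[of "{x}" "{y}"] by (simp add: insert_commute Un_commute)
  then have R: "measure Q R = 1 - (p + r)"
    unfolding R_def using prob_compl[of "{x, y}"] by (simp add: Compl_eq_Diff_UNIV)
  then have pr1: "p + r \<le> 1" using measure_nonneg[of Q R] by linarith
  have i: "integrable Q (\<lambda>z. indicator X z *\<^sub>R iexp (s * z))" if "X \<in> sets borel" for X
    by (rule integrable_const_bound[where B=1]) (use that in \<open>auto simp: indicator_def simp del: of_real_mult\<close>)
  have atom: "(\<integral>z. indicator {w} z *\<^sub>R iexp (s * z) \<partial>Q) = measure Q {w} *\<^sub>R iexp (s * w)" for w
  proof -
    have "(\<integral>z. indicator {w} z *\<^sub>R iexp (s * z) \<partial>Q) = (\<integral>z. indicator {w} z *\<^sub>R iexp (s * w) \<partial>Q)"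
      by (rule Bochner_Integration.integral_cong) (auto simp: indicator_def)
    also have "\<dots> = (\<integral>z. indicator {w} z \<partial>Q) *\<^sub>R iexp (s * w)"
      by (rule integral_scaleR_left) (simp add: integrable_real_indicator emeasure_eq_measure)
    finally show ?thesis by simp
  qed
  have "f s = (\<integral>z. indicator {x} z *\<^sub>R iexp (s * z) + indicator {y} z *\<^sub>R iexp (s * z) + indicator R z *\<^sub>R iexp (s * z) \<partial>Q)"
    unfolding char_def using xy by (intro Bochner_Integration.integral_cong) (auto simp: indicator_def R_def)
  also have "\<dots> = p *\<^sub>R iexp (s * x) + r *\<^sub>R iexp (s * y) + (\<integral>z. indicator R z *\<^sub>R iexp (s * z) \<partial>Q)"
  proof -
    have ix: "integrable Q (\<lambda>z. indicator {w} z *\<^sub>R iexp (s * z))" for w by (rule i) simp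
    have iR: "integrable Q (\<lambda>z. indicator R z *\<^sub>R iexp (s * z))" by (rule i) (simp add: R_def)
    show ?thesis
      unfolding Bochner_Integration.integral_add[OF Bochner_Integration.integrable_add[OF ix ix] iR]
        Bochner_Integration.integral_add[OF ix ix] atom p_def r_def ..
  qed
  finally have "norm (f s) \<le> norm (p *\<^sub>R iexp (s * x) + r *\<^sub>R iexp (s * y)) + norm (\<integral>z. indicator R z *\<^sub>R iexp (s * z) \<partial>Q)"
    by (simp only: norm_triangle_ineq)
  also have "norm (\<integral>z. indicator R z *\<^sub>R iexp (s * z) \<partial>Q) \<le> 1 - (p + r)"
  proof -
    have "norm (\<integral>z. indicator R z *\<^sub>R iexp (s * z) \<partial>Q) \<le> (\<integral>z. norm (indicator R z *\<^sub>R iexp (s * z)) \<partial>Q)" by (rule integral_norm_bound)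
    also have "\<dots> = measure Q R" by (simp del: of_real_mult)
    finally show ?thesis using R by simp
  qed
  also have "norm (p *\<^sub>R iexp (s * x) + r *\<^sub>R iexp (s * y)) \<le> p + r - 2 * p * r * S"
  proof (rule power2_le_imp_le)
    have "norm (p *\<^sub>R iexp (s * x) + r *\<^sub>R iexp (s * y)) ^ 2
       = (p * cos (s * x) + r * cos (s * y)) ^ 2 + (p * sin (s * x) + r * sin (s * y)) ^ 2"
      by (simp add: cmod_power2 Re_exp Im_exp)
    also have "\<dots> = p^2 * (cos (s * x)^2 + sin (s * x)^2) + r^2 * (cos (s * y)^2 + sin (s * y)^2)
        + 2 * p * r * (cos (s * x) * cos (s * y) + sin (s * x) * sin (s * y))"
      by algebra
    also have "cos (s * x) * cos (s * y) + sin (s * x) * sin (s * y) = cos (s * x - s * y)"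
      by (simp add: cos_diff)
    also have "s * x - s * y = 2 * (s * (x - y) / 2)" by (simp add: algebra_simps)
    also have "cos \<dots> = 1 - 2 * S" unfolding S_def by (rule cos_double_sin)
    finally have n2: "norm (p *\<^sub>R iexp (s * x) + r *\<^sub>R iexp (s * y)) ^ 2 = (p + r)^2 - 4 * (p * r * S)"
      by (simp add: power2_eq_square algebra_simps)
    have "(p + r - 2 * p * r * S)^2 = (p + r)^2 - 4 * (p * r * S) * (p + r) + (2 * p * r * S)^2"
      by (simp add: power2_eq_square algebra_simps)
    moreover have "4 * (p * r * S) * (p + r) \<le> 4 * (p * r * S) * 1" using pr S pr1 by (intro mult_left_mono) auto
    ultimately show "norm (p *\<^sub>R iexp (s * x) + r *\<^sub>R iexp (s * y)) ^ 2 \<le> (p + r - 2 * p * r * S)^2"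
      using n2 by (smt (verit) zero_le_power2)
    have "p * r \<le> p * 1" using pr pr1 by (intro mult_left_mono) auto
    moreover have "p * r \<le> 1 * r" using pr pr1 by (intro mult_right_mono) auto
    moreover have "p * r * S \<le> p * r * 1" using pr S by (intro mult_left_mono) auto
    ultimately show "0 \<le> p + r - 2 * p * r * S" by simp
  qed
  finally have "2 * p * r * S \<le> 1 - norm (f s)" by simp
  also have "\<dots> \<le> 1 - norm (f s) ^ 2"
    using cmod_char_le_1[of s] by (simp add: power2_eq_square mult_left_le)
  finally show ?thesis by (simp add: p_def r_def S_def)
qed

text \<open>Up to a factor that is bounded away from \<open>s = 0\<close>, the left-hand side is the squared modulus of the
  characteristic function of \<open>spread w\<close>. The controlled numbers form an additive group, by subadditivity of
  \<open>\<bar>sin\<bar>\<close>, and this group contains the differences of atoms.\<close>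

definition controlled :: "real \<Rightarrow> bool" where
  "controlled w \<longleftrightarrow> (\<exists>C\<ge>0. \<forall>s. sin (s * w / 2) ^ 2 \<le> C * (1 - norm (f s) ^ 2))"

lemma one_minus_norm_nonneg: "0 \<le> 1 - norm (f s) ^ 2"
  using cmod_char_le_1[of s] by (simp add: power_le_one)

lemma controlled_0: "controlled 0"
  by (auto simp: controlled_def intro!: exI[of _ 0])

lemma controlled_minus: "controlled w \<Longrightarrow> controlled (- w)"
  by (simp add: controlled_def)

lemma controlled_add:
  assumes "controlled v" "controlled w" shows "controlled (v + w)"
proof -
  obtain C D where C: "C \<ge> 0" "\<And>s. sin (s * v / 2) ^ 2 \<le> C * (1 - norm (f s) ^ 2)"
    and D: "D \<ge> 0" "\<And>s. sin (s * w / 2) ^ 2 \<le> D * (1 - norm (f s) ^ 2)"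
    using assms unfolding controlled_def by blast
  have "sin (s * (v + w) / 2) ^ 2 \<le> (2 * C + 2 * D) * (1 - norm (f s) ^ 2)" for s
  proof -
    let ?a = "s * v / 2" and ?b = "s * w / 2"
    have "\<bar>sin (?a + ?b)\<bar> \<le> \<bar>sin ?a * cos ?b\<bar> + \<bar>cos ?a * sin ?b\<bar>"
      unfolding sin_add by (rule abs_triangle_ineq)
    also have "\<dots> \<le> \<bar>sin ?a\<bar> + \<bar>sin ?b\<bar>"
      unfolding abs_mult by (intro add_mono mult_left_le mult_left_le_one_le) auto
    finally have "\<bar>sin (?a + ?b)\<bar>^2 \<le> (\<bar>sin ?a\<bar> + \<bar>sin ?b\<bar>)^2" by (intro power_mono) auto
    also have "\<dots> \<le> 2 * sin ?a ^ 2 + 2 * sin ?b ^ 2"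
      using zero_le_power2[of "\<bar>sin ?a\<bar> - \<bar>sin ?b\<bar>"] by (simp add: power2_sum power2_diff)
    also have "\<dots> \<le> (2 * C + 2 * D) * (1 - norm (f s) ^ 2)"
      using C(2)[of s] D(2)[of s] unfolding distrib_right by linarith
    also have "?a + ?b = s * (v + w) / 2" by (simp add: algebra_simps add_divide_distrib)
    finally show ?thesis by simp
  qed
  then show ?thesis unfolding controlled_def using C(1) D(1) by (intro exI[of _ "2 * C + 2 * D"]) auto
qed

lemma controlled_int_mult: 
  assumes "controlled w" shows "controlled (of_int k * w)"
proof -
  have nat: "controlled (of_nat n * w)" for n
    by (induction n) (auto simp: controlled_0 distrib_right intro: controlled_add assms)
  show ?thesis
  proof (cases k rule: int_cases2)
    case (nonneg n)
    then show ?thesis using nat[of n] by simp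
  next
    case (nonpos n)
    then show ?thesis using controlled_minus[OF nat[of n]] by simp
  qed
qed

lemma controlled_atoms:
  assumes "measure Q {x} > 0" "measure Q {y} > 0"
  shows "controlled (x - y)"
proof (cases "x = y")
  case True
  then show ?thesis by (simp add: controlled_0)
next
  case False
  define c where "c = 2 * measure Q {x} * measure Q {y}"
  have c: "c > 0" using assms by (simp add: c_def)
  have "sin (s * (x - y) / 2) ^ 2 \<le> 1 / c * (1 - norm (f s) ^ 2)" for s
    using char_norm_two_atoms[OF False, of s] c unfolding c_def[symmetric] by (simp add: field_simps)
  then show ?thesis unfolding controlled_def using c by (intro exI[of _ "1 / c"]) auto
qed

lemma smoothing_span_controlled:
  assumes h: "h > 0" and ctrl: "controlled h"
  shows "smoothing_span h"
  unfolding smoothing_span_def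
proof (intro conjI allI impI)
  fix \<delta> A :: real assume \<delta>: "\<delta> > 0"
  obtain C where C: "C \<ge> 0" "\<And>s. sin (s * h / 2) ^ 2 \<le> C * (1 - norm (f s) ^ 2)"
    using ctrl unfolding controlled_def by blast
  show "\<exists>C. \<forall>s. \<delta> \<le> s \<and> s \<le> A \<longrightarrow> norm (char (spread h) s) ^ 2 \<le> C * (1 - norm (f s) ^ 2)"
  proof (intro exI[of _ "C / (h * \<delta> / 2)^2"] allI impI)
    fix s assume s: "\<delta> \<le> s \<and> s \<le> A"
    have pos: "h * \<delta> / 2 > 0" using h \<delta> by simp
    have ne: "h * s \<noteq> 0" using h s \<delta> by simp
    have "norm (char (spread h) s) ^ 2 = sin (s * h / 2) ^ 2 / (h * s / 2) ^ 2"
      by (simp only: char_spread char_unit_uniform[OF ne] norm_of_real power2_abs power_divide mult.commute[of s h])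
    also have "\<dots> \<le> (C * (1 - norm (f s) ^ 2)) / (h * \<delta> / 2) ^ 2"
      using C s h \<delta> pos one_minus_norm_nonneg[of s] by (intro frac_le power_mono divide_right_mono mult_left_mono) auto
    finally show "norm (char (spread h) s) ^ 2 \<le> C / (h * \<delta> / 2)^2 * (1 - norm (f s) ^ 2)" by simp
  qed
qed (use h in simp)

lemma not_AE_const: "\<not> (AE x in Q. x = c)"
proof
  assume ae: "AE x in Q. x = c"
  have "expectation (\<lambda>x. x) = expectation (\<lambda>x. c)" by (rule integral_cong_AE) (use ae in auto)
  then have "c = 0" using mean_0 prob_space by simp
  have "expectation (\<lambda>x. x^2) = expectation (\<lambda>x. c^2)" by (rule integral_cong_AE) (use ae in auto)
  then show False using var_1 \<open>c = 0\<close> by simp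
qed

text \<open>The multiples of \<open>d\<close> that are controlled correspond to a nonzero subgroup of the integers. It is generated by its least positive
  element \<open>m\<close>; as it contains the differences of atoms, the law lives on a lattice of span \<open>m d\<close>, and \<open>m d\<close> is
  itself controlled.\<close>

lemma lattice_smoothing_span:
  assumes d: "d > 0" and lat: "lattice_law Q c d"
  obtains h c' where "h > 0" "smoothing_span h" "lattice_law Q c' h"
proof -
  define atom where "atom k \<longleftrightarrow> measure Q {c + d * of_int k} > 0" for k :: int
  have "AE x in Q. \<forall>k::int. \<not> atom k \<longrightarrow> x \<noteq> c + d * of_int k"
    unfolding AE_all_countable
  proof
    fix k :: int
    show "AE x in Q. \<not> atom k \<longrightarrow> x \<noteq> c + d * of_int k"
    proof (cases "atom k")
      case False
      then have "measure Q {c + d * of_int k} = 0" by (simp add: atom_def zero_less_measure_iff)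
      then show ?thesis by (subst AE_iff_measurable[where N="{c + d * of_int k}"]) (auto simp: emeasure_eq_measure False)
    qed simp
  qed
  with lat[unfolded lattice_law_def] have ae: "AE x in Q. \<exists>k. atom k \<and> x = c + d * of_int k"
    by eventually_elim blast
  obtain k0 where k0: "atom k0"
  proof (rule ccontr)
    assume "\<not> thesis"
    then have "\<And>k. \<not> atom k" using that by blast
    with ae have "AE x in Q. False" by simp
    then show False by simp
  qed
  obtain k1 where k1: "atom k1" "k1 \<noteq> k0"
  proof (rule ccontr)
    assume "\<not> thesis"
    then have *: "\<And>k. atom k \<Longrightarrow> k = k0" using that by blast
    have "AE x in Q. x = c + d * of_int k0" using ae by eventually_elim (use * in blast)
    then show False using not_AE_const by blast
  qed
  define L where "L z \<longleftrightarrow> controlled (of_int z * d)" for z :: int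
  have L_diff: "L (k - k0)" if "atom k" for k
    using controlled_atoms[of "c + d * of_int k" "c + d * of_int k0"] that k0
    by (simp add: L_def atom_def algebra_simps)
  have "\<exists>m::nat. m > 0 \<and> L (int m)"
  proof (cases "k1 > k0")
    case True
    then show ?thesis using L_diff[OF k1(1)] by (intro exI[of _ "nat (k1 - k0)"]) auto
  next
    case False
    then show ?thesis using controlled_minus[OF L_diff[OF k1(1), unfolded L_def]] k1(2)
      by (intro exI[of _ "nat (k0 - k1)"]) (auto simp: L_def algebra_simps)
  qed
  then obtain m :: nat where m: "m > 0" "L (int m)" and least: "\<And>j. 0 < j \<Longrightarrow> j < m \<Longrightarrow> \<not> L (int j)"
    using exists_least_iff[of "\<lambda>m. m > 0 \<and> L (int m)"] by blast
  have dvd: "int m dvd z" if z: "L z" for z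
  proof -
    have "z mod int m = z + (- (z div int m)) * int m"
      by (simp add: minus_div_mult_eq_mod[symmetric])
    then have "of_int (z mod int m) * d = of_int z * d + of_int (- (z div int m)) * (of_int (int m) * d)"
      by (simp only: of_int_add of_int_mult distrib_right mult.assoc)
    then have "L (z mod int m)"
      using controlled_add[OF z[unfolded L_def] controlled_int_mult[OF m(2)[unfolded L_def], of "- (z div int m)"]]
      by (simp only: L_def)
    moreover have "0 \<le> z mod int m" "z mod int m < int m" using m(1) by auto
    moreover from this have "nat (z mod int m) < m" by (simp add: nat_less_iff)
    ultimately have "nat (z mod int m) = 0" using least[of "nat (z mod int m)"] by (cases "nat (z mod int m) = 0") auto
    then show ?thesis using \<open>0 \<le> z mod int m\<close> by (simp add: dvd_eq_mod_eq_0)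
  qed
  show thesis
  proof (rule that[of "real m * d" "c + d * of_int k0"])
    show pos: "real m * d > 0" using m d by simp
    show "smoothing_span (real m * d)" using smoothing_span_controlled[OF pos] m(2) by (simp add: L_def)
    show "lattice_law Q (c + d * of_int k0) (real m * d)"
      unfolding lattice_law_def using ae
    proof eventually_elim
      case (elim x)
      then obtain k where k: "atom k" "x = c + d * of_int k" by blast
      obtain j where "k - k0 = int m * j" using dvd[OF L_diff[OF k(1)]] by (auto elim: dvdE)
      then have "k = k0 + int m * j" by simp
      then show ?case using k(2) by (intro exI[of _ j]) (simp add: algebra_simps)
    qed
  qed
qed

text \<open>Either \<open>\<bar>f\<bar> < 1\<close> away from the origin, and compactness gives the inequality for \<open>h = 0\<close>, or \<open>\<bar>f s\<bar> = 1\<close> for some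
  \<open>s > 0\<close>, and the law is a lattice law.\<close>

theorem exists_smoothing_span:
  obtains h where "smoothing_span h" "h = 0 \<or> (h > 0 \<and> (\<exists>c. lattice_law Q c h))"
proof (cases "\<forall>s>0. norm (f s) < 1")
  case True
  then show ?thesis using that[of 0] smoothing_span_0 by blast
next
  case False
  then obtain s where s: "s > 0" "norm (f s) = 1" using cmod_char_le_1 by (meson order_le_less)
  obtain c where "lattice_law Q c (2 * pi / s)" using lattice_law_if_norm_char_eq_1[OF s] by blast
  then show ?thesis using lattice_smoothing_span[of "2 * pi / s" c] s that by (metis divide_pos_pos pi_gt_zero zero_less_mult_iff zero_less_numeral)
qed

end

section \<open>Span and third absolute moment\<close>

text \<open>The right-hand side is \<open>h / 2\<close> times the parabola with zeros \<open>- u\<close> and \<open>v\<close>, plus the chord of \<open>\<bar>x\<bar>\<^sup>3\<close> between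
  these points. The difference of the two sides has the factor \<open>x - v\<close>, and the cofactor is nonnegative one step beyond \<open>v\<close>.\<close>

lemma cubic_above_chord_parabola:
  fixes x u v h :: real
  assumes h: "u + v = h" "h > 0" and u: "0 \<le> u" and v: "0 \<le> v" and x: "v + h \<le> x"
  shows "x^3 \<ge> h / 2 * ((x + u) * (x - v)) + (v^3 * (x + u) + u^3 * (v - x)) / h"
proof -
  define s where "s = (v^3 - u^3) / h"
  have sh: "s * h = v^3 - u^3" using h by (simp add: s_def)
  have "v^3 * (x + u) + u^3 * (v - x) = v^3 * h + (v^3 - u^3) * (x - v)"
    unfolding h(1)[symmetric] by (simp add: algebra_simps)
  then have chord: "(v^3 * (x + u) + u^3 * (v - x)) / h = v^3 + s * (x - v)"
    using h by (simp add: sh[symmetric] field_simps)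
  have "s \<le> v^2"
  proof -
    have "v^3 - u^3 \<le> v^2 * v" using u by (simp add: power2_eq_square power3_eq_cube)
    also have "\<dots> \<le> v^2 * h" using h u by (intro mult_left_mono) auto
    finally show ?thesis using h by (simp add: s_def field_simps)
  qed
  moreover have "h / 2 * (x + u) \<le> x^2"
  proof -
    have "x + u \<le> 2 * x" using h u v x by linarith
    then have "h / 2 * (x + u) \<le> h / 2 * (2 * x)" using h by (intro mult_left_mono) auto
    also have "\<dots> = h * x" by simp
    also have "\<dots> \<le> x * x" using h v x by (intro mult_right_mono) auto
    finally show ?thesis by (simp add: power2_eq_square)
  qed
  moreover have "0 \<le> x * v" using x v h by auto
  ultimately have "0 \<le> x^2 + x * v + v^2 - s - h / 2 * (x + u)" by linarith
  then have "0 \<le> (x - v) * (x^2 + x * v + v^2 - s - h / 2 * (x + u))" using x h by (intro mult_nonneg_nonneg) auto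
  also have "\<dots> = x^3 - (h / 2 * ((x + u) * (x - v)) + (v^3 + s * (x - v)))"
    by (simp add: power2_eq_square power3_eq_cube field_simps)
  finally show ?thesis unfolding chord by simp
qed

text \<open>Equality holds at the lattice points \<open>- u\<close> and \<open>v\<close> next to the origin; points further to the left are reflected.\<close>

lemma abs_cube_lattice_minorant:
  fixes u v h :: real and k :: int
  assumes h: "u + v = h" "h > 0" and u: "0 \<le> u" and v: "0 \<le> v"
  defines "x \<equiv> v + h * of_int k"
  shows "\<bar>x\<bar>^3 \<ge> h / 2 * ((x + u) * (x - v)) + (v^3 * (x + u) + u^3 * (v - x)) / h"
proof -
  consider "k \<ge> 1" | "k = 0" | "k = -1" | "k \<le> -2" by linarith
  then show ?thesis
  proof cases
    case 1
    then have "h * 1 \<le> h * of_int k" using h by (intro mult_left_mono) auto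
    then have "v + h \<le> x" by (simp add: x_def)
    then show ?thesis using cubic_above_chord_parabola[OF h u v] v h by simp
  next
    case 2
    then have "x = v" by (simp add: x_def)
    then show ?thesis using h v by (simp add: add.commute)
  next
    case 3
    then have "x = - u" using h by (simp add: x_def)
    then show ?thesis using h u by (simp add: add.commute)
  next
    case 4
    then have "of_int k \<le> (-2 :: real)" by linarith
    then have "h * of_int k \<le> h * -2" using h by (intro mult_left_mono) auto
    then have *: "u + h \<le> - x" using h by (simp add: x_def)
    have "h / 2 * ((- x + v) * (- x - u)) + (u^3 * (- x + v) + v^3 * (u - - x)) / h \<le> (- x)^3"
      using h by (intro cubic_above_chord_parabola[OF _ h(2) v u *]) auto
    moreover have "\<bar>x\<bar>^3 = (- x)^3" using * u h by simp
    ultimately show ?thesis by (simp add: algebra_simps)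
  qed
qed

context standardized_law begin

definition beta3 :: real where "beta3 = expectation (\<lambda>x. \<bar>x\<bar>^3)"

lemma third_moment_le_beta3: "\<bar>third_moment\<bar> \<le> beta3"
proof -
  have "\<bar>third_moment\<bar> \<le> expectation (\<lambda>x. norm (x^3))"
    unfolding third_moment_def real_norm_def[symmetric] by (rule integral_norm_bound)
  then show ?thesis by (simp add: beta3_def power_abs)
qed

lemma beta3_pos: "beta3 > 0"
proof (rule ccontr)
  assume "\<not> ?thesis"
  moreover have "beta3 \<ge> 0" unfolding beta3_def by (rule Bochner_Integration.integral_nonneg) simp
  ultimately have "beta3 = 0" by simp
  then have "AE x in Q. \<bar>x\<bar>^3 = 0"
    unfolding beta3_def using integrable_cube by (subst (asm) integral_nonneg_eq_0_iff_AE) auto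
  then have "AE x in Q. x = 0" by eventually_elim simp
  then show False using not_AE_const by blast
qed

lemma lattice_representation:
  assumes lat: "lattice_law Q c h" and h: "h > 0"
  obtains v where "0 \<le> v" "v < h" "lattice_law Q v h"
proof -
  define j where "j = \<lfloor>c / h\<rfloor>"
  have "of_int j \<le> c / h" "c / h < of_int j + 1" unfolding j_def by linarith+
  then have "h * of_int j \<le> c" "c < h * (of_int j + 1)" using h by (simp_all add: field_simps)
  then have "0 \<le> c - h * of_int j" "c - h * of_int j < h" by (simp_all add: algebra_simps)
  moreover have "lattice_law Q (c - h * of_int j) h"
    using lat unfolding lattice_law_def
  proof eventually_elim
    case (elim x)
    then obtain k :: int where "x = c + h * of_int k" by blast
    then show ?case by (intro exI[of _ "k + j"]) (simp add: algebra_simps)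
  qed
  ultimately show thesis by (rule that)
qed

text \<open>Integrating the minorant only involves the first two moments, which are \<open>0\<close> and \<open>1\<close>.\<close>

lemma beta3_lattice_bound:
  assumes h: "h > 0" and v: "0 \<le> v" "v < h" and lat: "lattice_law Q v h"
  shows "beta3 \<ge> h / 2 + 2 * (v * (h - v)) / h * (h / 2 - v)^2"
proof -
  define u where "u = h - v"
  have u: "u + v = h" "0 \<le> u" using v by (simp_all add: u_def)
  have i1: "integrable Q (\<lambda>x. x)" using integrable_moment[of 1] by simp
  have i2: "integrable Q (\<lambda>x. x^2)" using integrable_moment[of 2] by simp
  have i3: "integrable Q (\<lambda>x. \<bar>x\<bar>^3)" by (rule integrable_cube)
  let ?p = "\<lambda>x. h / 2 * x^2 + (h / 2 * (u - v) + (v^3 - u^3) / h) * x + ((v^3 * u + u^3 * v) / h - h / 2 * (u * v))"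
  have p_eq: "?p x = h / 2 * ((x + u) * (x - v)) + (v^3 * (x + u) + u^3 * (v - x)) / h" for x
    by (simp add: power2_eq_square algebra_simps add_divide_distrib diff_divide_distrib)
  have "expectation ?p = h / 2 + ((v^3 * u + u^3 * v) / h - h / 2 * (u * v))"
    using i1 i2 mean_0 var_1 prob_space by simp
  moreover have "expectation ?p \<le> beta3"
    unfolding beta3_def
  proof (rule integral_mono_AE)
    show "integrable Q ?p" using i1 i2 by simp
    show "AE x in Q. ?p x \<le> \<bar>x\<bar>^3"
      using lat unfolding lattice_law_def
    proof eventually_elim
      case (elim x)
      then obtain k :: int where "x = v + h * of_int k" by blast
      then show ?case unfolding p_eq using abs_cube_lattice_minorant[OF u(1) h u(2) v(1)] by simp
    qed
  qed (rule i3)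
  moreover have "(v^3 * u + u^3 * v) / h - h / 2 * (u * v) = 2 * (v * (h - v)) / h * (h / 2 - v)^2"
    using h by (simp add: u_def field_simps power2_eq_square power3_eq_cube)
  ultimately show ?thesis by simp
qed

text \<open>In the case of equality the correction term of the previous bound vanishes, so the lattice contains \<open>0\<close> or has \<open>0\<close> midway between
  two points. In the first case \<open>\<bar>x\<bar>\<^sup>3 \<ge> h x\<^sup>2\<close> on the lattice gives \<open>\<beta> \<ge> h\<close>, a contradiction. In the second case
  \<open>\<bar>x\<bar>\<^sup>3 \<ge> h / 2 x\<^sup>2\<close>, with equality only for \<open>\<bar>x\<bar> = h / 2\<close>, and the variance forces \<open>h = 2\<close>.\<close>

lemma lattice_span_le_beta3:
  assumes lat: "lattice_law Q c h" and h: "h > 0"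
  shows "h \<le> 2 * beta3"
    and "h = 2 * beta3 \<Longrightarrow> AE x in Q. \<bar>x\<bar> = 1"
proof -
  obtain v where v: "0 \<le> v" "v < h" and latv: "lattice_law Q v h" using lattice_representation[OF lat h] by blast
  note bound = beta3_lattice_bound[OF h v latv]
  have "0 \<le> 2 * (v * (h - v)) / h * (h / 2 - v)^2" using h v by (intro mult_nonneg_nonneg divide_nonneg_nonneg) auto
  then show "h \<le> 2 * beta3" using bound by linarith
  assume eq: "h = 2 * beta3"
  then have "2 * (v * (h - v)) / h * (h / 2 - v)^2 \<le> 0" using bound by linarith
  then have "2 * (v * (h - v)) / h * (h / 2 - v)^2 = 0"
    using \<open>0 \<le> 2 * (v * (h - v)) / h * (h / 2 - v)^2\<close> by linarith
  then consider "v = 0" | "v = h / 2" using h v by auto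
  then show "AE x in Q. \<bar>x\<bar> = 1"
  proof cases
    case 1
    have "h = expectation (\<lambda>x. h * x^2)" using var_1 by simp
    also have "\<dots> \<le> beta3"
      unfolding beta3_def
    proof (rule integral_mono_AE)
      show "integrable Q (\<lambda>x. h * x^2)" using integrable_moment[of 2] by simp
      show "AE x in Q. h * x^2 \<le> \<bar>x\<bar>^3"
        using latv unfolding lattice_law_def
      proof eventually_elim
        case (elim x)
        then obtain k :: int where k: "x = h * of_int k" using 1 by auto
        show ?case
        proof (cases "k = 0")
          case False
          then have "\<bar>of_int k\<bar> \<ge> (1::real)" by linarith
          then have "h * 1 \<le> \<bar>x\<bar>" unfolding k abs_mult using h by (intro mult_mono) auto
          then have "h * x^2 \<le> \<bar>x\<bar> * x^2" by (intro mult_right_mono) auto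
          then show ?thesis by (simp add: power2_eq_square power3_eq_cube)
        qed (simp add: k)
      qed
    qed (rule integrable_cube)
    finally show ?thesis using eq beta3_pos by simp
  next
    case 2
    have le: "AE x in Q. h / 2 \<le> \<bar>x\<bar>"
      using latv unfolding lattice_law_def
    proof eventually_elim
      case (elim x)
      then obtain k :: int where k: "x = h / 2 + h * of_int k" using 2 by auto
      have "\<bar>2 * k + 1\<bar> \<ge> 1" by presburger
      then have "\<bar>2 * of_int k + 1\<bar> \<ge> (1::real)" by linarith
      then have "h / 2 * 1 \<le> h / 2 * \<bar>2 * of_int k + 1\<bar>" using h by (intro mult_left_mono) auto
      also have "\<dots> = \<bar>h / 2 * (2 * of_int k + 1)\<bar>" using h by (simp add: abs_mult)
      also have "h / 2 * (2 * of_int k + 1) = x" using k by (simp add: algebra_simps)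
      finally show ?case by simp
    qed
    have ip: "integrable Q (\<lambda>x. \<bar>x\<bar>^3 - h / 2 * x^2)"
      using integrable_cube integrable_moment[of 2] by simp
    have "expectation (\<lambda>x. \<bar>x\<bar>^3 - h / 2 * x^2) = 0"
      using integrable_cube integrable_moment[of 2] eq var_1 by (simp add: beta3_def)
    moreover have "AE x in Q. 0 \<le> \<bar>x\<bar>^3 - h / 2 * x^2"
      using le
    proof eventually_elim
      case (elim x)
      then have "h / 2 * x^2 \<le> \<bar>x\<bar> * x^2" by (intro mult_right_mono) auto
      then show ?case by (simp add: power2_eq_square power3_eq_cube)
    qed
    ultimately have "AE x in Q. \<bar>x\<bar>^3 - h / 2 * x^2 = 0"
      using integral_nonneg_eq_0_iff_AE[OF ip] by simp
    with le have abs_eq: "AE x in Q. \<bar>x\<bar> = h / 2"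
    proof eventually_elim
      case (elim x)
      then have "(\<bar>x\<bar> - h / 2) * \<bar>x\<bar>^2 = 0" by (simp add: power2_eq_square power3_eq_cube algebra_simps)
      then show ?case using elim(1) h by auto
    qed
    have "expectation (\<lambda>x. x^2) = expectation (\<lambda>x. (h / 2)^2)"
    proof (rule integral_cong_AE)
      show "AE x in Q. x^2 = (h / 2)^2" using abs_eq by eventually_elim (metis power2_abs)
    qed auto
    then have "(h / 2)^2 = 1" using var_1 prob_space by simp
    then have "h / 2 = 1" using h by (simp add: power2_eq_1_iff)
    then show ?thesis using abs_eq by simp
  qed
qed

end

section \<open>Reduction to standardized laws\<close>

lemma char_distr_affine:
  assumes "real_distribution M"
  shows "char (distr M borel (\<lambda>x. \<alpha> * x + \<beta>)) t = iexp (t * \<beta>) * char M (\<alpha> * t)"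
proof -
  interpret M: real_distribution M by fact
  have "char (distr M borel (\<lambda>x. \<alpha> * x + \<beta>)) t = (\<integral>x. iexp (t * \<beta>) * iexp ((\<alpha> * t) * x) \<partial>M)"
    unfolding char_def
    by (subst integral_distr) (auto intro!: Bochner_Integration.integral_cong simp: algebra_simps simp flip: exp_add)
  then show ?thesis unfolding char_def by (simp only: integral_mult_right_zero)
qed

definition standardize :: "real measure \<Rightarrow> real measure" where
  "standardize P = distr P borel (\<lambda>x. (x - law_mean P) / law_sd P)"

lemma P3_D:
  assumes "P \<in> P3"
  shows "real_distribution P" "integrable P (\<lambda>x. \<bar>x - law_mean P\<bar>^3)" "integrable P (\<lambda>x. x)"
    "integrable P (\<lambda>x. (x - law_mean P)^2)"
    "law_sd P ^ 2 = (\<integral>x. (x - law_mean P)^2 \<partial>P)"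
    "enn2real (abs_central_moment 3 P) = (\<integral>x. \<bar>x - law_mean P\<bar>^3 \<partial>P)"
    "(\<integral>x. \<bar>x - law_mean P\<bar>^3 \<partial>P) > 0" "law_sd P > 0"
proof -
  have rd: "real_distribution P" and pos: "0 < abs_central_moment 3 P" and fin: "abs_central_moment 3 P < \<infinity>"
    using assms by (auto simp: P3_def)
  show "real_distribution P" by (rule rd)
  interpret P: real_distribution P by (rule rd)
  let ?\<mu> = "law_mean P"
  have fin1: "(\<integral>\<^sup>+x. ennreal \<bar>x\<bar> \<partial>P) < \<infinity>"
    using fin unfolding abs_central_moment_def by (auto split: if_splits)
  have powr: "\<bar>x - ?\<mu>\<bar> powr 3 = \<bar>x - ?\<mu>\<bar>^3" "\<bar>x - ?\<mu>\<bar> powr 2 = (x - ?\<mu>)^2" for x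
    by (cases "x = ?\<mu>", simp_all add: powr_numeral)+
  have m3: "abs_central_moment 3 P = (\<integral>\<^sup>+x. ennreal (\<bar>x - ?\<mu>\<bar>^3) \<partial>P)"
    and m2: "abs_central_moment 2 P = (\<integral>\<^sup>+x. ennreal ((x - ?\<mu>)^2) \<partial>P)"
    using fin1 unfolding abs_central_moment_def by (simp_all add: powr)
  show i3: "integrable P (\<lambda>x. \<bar>x - ?\<mu>\<bar>^3)"
    using fin m3 by (intro integrableI_nonneg) auto
  show i1: "integrable P (\<lambda>x. x)"
    using fin1 by (subst integrable_iff_bounded) auto
  show i2: "integrable P (\<lambda>x. (x - ?\<mu>)^2)"
  proof (rule Bochner_Integration.integrable_bound)
    show "integrable P (\<lambda>x. 1 + \<bar>x - ?\<mu>\<bar>^3)" using i3 by simp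
    have "y^2 \<le> 1 + \<bar>y\<bar>^3" for y :: real
    proof (cases "\<bar>y\<bar> \<le> 1")
      case True
      then have "y^2 \<le> 1" by (simp add: abs_square_le_1)
      then show ?thesis by (smt (verit) zero_le_power abs_ge_zero)
    next
      case False
      then have "\<bar>y\<bar>^2 \<le> \<bar>y\<bar>^3" by (intro power_increasing) auto
      then show ?thesis by simp
    qed
    then show "AE x in P. norm ((x - ?\<mu>)^2) \<le> norm (1 + \<bar>x - ?\<mu>\<bar>^3)" by auto
  qed simp
  have "abs_central_moment 2 P = ennreal (\<integral>x. (x - ?\<mu>)^2 \<partial>P)"
    unfolding m2 using i2 by (subst nn_integral_eq_integral) auto
  then show sd: "law_sd P ^ 2 = (\<integral>x. (x - law_mean P)^2 \<partial>P)"
    unfolding law_sd_def by (simp add: Bochner_Integration.integral_nonneg)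
  have e3: "abs_central_moment 3 P = ennreal (\<integral>x. \<bar>x - ?\<mu>\<bar>^3 \<partial>P)"
    unfolding m3 using i3 by (subst nn_integral_eq_integral) auto
  then show "enn2real (abs_central_moment 3 P) = (\<integral>x. \<bar>x - law_mean P\<bar>^3 \<partial>P)"
    by (simp add: Bochner_Integration.integral_nonneg)
  show p3: "(\<integral>x. \<bar>x - law_mean P\<bar>^3 \<partial>P) > 0" using pos e3 by simp
  have "law_sd P \<noteq> 0"
  proof
    assume "law_sd P = 0"
    then have "(\<integral>x. (x - law_mean P)^2 \<partial>P) = 0" using sd by simp
    then have "AE x in P. (x - law_mean P)^2 = 0"
      using i2 by (subst (asm) integral_nonneg_eq_0_iff_AE) auto
    then have "(\<integral>x. \<bar>x - law_mean P\<bar>^3 \<partial>P) = (\<integral>x. 0 \<partial>P)" by (intro integral_cong_AE) (auto elim: eventually_mono)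
    then show False using p3 by simp
  qed
  moreover have "law_sd P \<ge> 0" by (simp add: law_sd_def)
  ultimately show "law_sd P > 0" by simp
qed

lemma standardized_law_standardize:
  assumes P: "P \<in> P3"
  shows "standardized_law (standardize P)"
proof -
  note D = P3_D[OF P]
  interpret P: real_distribution P by (rule D(1))
  let ?s = "\<lambda>x. (x - law_mean P) / law_sd P"
  have sd: "law_sd P > 0" by (rule D(8))
  have meas: "?s \<in> borel_measurable P"
    by (rule P.measurable_finite_borel) measurable
  have rd: "real_distribution (standardize P)"
    unfolding standardize_def by (rule P.real_distribution_distr) simp
  show ?thesis
  proof (intro standardized_law.intro rd standardized_law_axioms.intro)
    show "integrable (standardize P) (\<lambda>x. \<bar>x\<bar>^3)"
      unfolding standardize_def using D(2) sd
      by (subst integrable_distr_eq[OF meas]) (auto simp: power_divide abs_divide)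
    have "(\<integral>x. x \<partial>standardize P) = (\<integral>x. ?s x \<partial>P)"
      unfolding standardize_def by (subst integral_distr[OF meas]) auto
    also have "\<dots> = 0" using D(3) P.prob_space by (simp add: law_mean_def)
    finally show "(\<integral>x. x \<partial>standardize P) = 0" .
    have "(\<integral>x. x^2 \<partial>standardize P) = (\<integral>x. (x - law_mean P)^2 / law_sd P ^ 2 \<partial>P)"
      unfolding standardize_def by (subst integral_distr[OF meas]) (auto simp: power_divide)
    also have "\<dots> = 1" using sd by (simp add: D(5)[symmetric])
    finally show "(\<integral>x. x^2 \<partial>standardize P) = 1" .
  qed
qed

text \<open>Both laws have the same characteristic function.\<close>

lemma standardized_conv_power_eq:
  assumes P: "P \<in> P3"
  shows "standardized_conv_power P n = standardized_law.standardized_sum (standardize P) n"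
proof (rule Levy_uniqueness)
  note D = P3_D[OF P]
  interpret Q: standardized_law "standardize P" by (rule standardized_law_standardize[OF P])
  have C: "real_distribution (conv_power P n)" by (rule real_distribution_conv_power[OF D(1)])
  have CQ: "real_distribution (conv_power (standardize P) n)" by (rule real_distribution_conv_power[OF Q.real_distribution_Q])
  interpret C: real_distribution "conv_power P n" by fact
  show "real_distribution (standardized_conv_power P n)"
    unfolding standardized_conv_power_def by (rule C.real_distribution_distr) simp
  show "real_distribution (Q.standardized_sum n)" by (rule Q.real_distribution_standardized_sum)
  let ?\<sigma> = "law_sd P" and ?\<mu> = "law_mean P"
  show "char (standardized_conv_power P n) = char (Q.standardized_sum n)"
  proof
    fix t
    have eq1: "standardized_conv_power P n = distr (conv_power P n) borel (\<lambda>x. 1 / (?\<sigma> * sqrt n) * x + (- (n * ?\<mu> / (?\<sigma> * sqrt n))))"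
      unfolding standardized_conv_power_def by (simp add: diff_divide_distrib)
    have eq2: "Q.standardized_sum n = distr (conv_power (standardize P) n) borel (\<lambda>x. 1 / sqrt n * x + 0)"
      unfolding Q.standardized_sum_def by simp
    have eq3: "standardize P = distr P borel (\<lambda>x. 1 / ?\<sigma> * x + (- (?\<mu> / ?\<sigma>)))"
      unfolding standardize_def by (simp add: diff_divide_distrib)
    have cQ: "char (standardize P) u = iexp (u * (- (?\<mu> / ?\<sigma>))) * char P (1 / ?\<sigma> * u)" for u
      unfolding eq3 by (rule char_distr_affine[OF D(1)])
    have "char (standardized_conv_power P n) t = iexp (t * (- (n * ?\<mu> / (?\<sigma> * sqrt n)))) * char P (1 / (?\<sigma> * sqrt n) * t) ^ n"
      unfolding eq1 char_distr_affine[OF C] char_conv_power[OF D(1)] ..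
    moreover have "char (Q.standardized_sum n) t = (iexp ((1 / sqrt n * t) * (- (?\<mu> / ?\<sigma>))) * char P (1 / ?\<sigma> * (1 / sqrt n * t))) ^ n"
      unfolding eq2 char_distr_affine[OF CQ] char_conv_power[OF Q.real_distribution_Q] cQ by simp
    moreover have "iexp ((1 / sqrt n * t) * (- (?\<mu> / ?\<sigma>))) ^ n = iexp (t * (- (n * ?\<mu> / (?\<sigma> * sqrt n))))"
      unfolding exp_of_nat_mult[symmetric] by (simp add: field_simps)
    moreover have "1 / ?\<sigma> * (1 / sqrt n * t) = 1 / (?\<sigma> * sqrt n) * t" by simp
    ultimately show "char (standardized_conv_power P n) t = char (Q.standardized_sum n) t"
      by (simp only: power_mult_distrib)
  qed
qed

lemma scaled_interval_error_tendsto: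
  assumes P: "P \<in> P3"
    and h: "standardized_law.smoothing_span (standardize P) h" "h = 0 \<or> (\<exists>c. lattice_law (standardize P) c h)"
  shows "scaled_interval_error P \<longlonglongrightarrow> limit_const (standardized_law.third_moment (standardize P)) h"
proof -
  interpret Q: standardized_law "standardize P" by (rule standardized_law_standardize[OF P])
  have "scaled_interval_error P = (\<lambda>n. sqrt n * interval_distance (Q.standardized_sum n) std_normal_distribution)"
    by (simp add: scaled_interval_error_def[abs_def] standardized_conv_power_eq[OF P])
  then show ?thesis using Q.interval_error_tendsto[OF h] by simp
qed

lemma asymptotic_ratio_eq:
  assumes P: "P \<in> P3"
    and h: "standardized_law.smoothing_span (standardize P) h" "h = 0 \<or> (\<exists>c. lattice_law (standardize P) c h)"
  shows "asymptotic_ratio P = limit_const (standardized_law.third_moment (standardize P)) h / standardized_law.beta3 (standardize P)"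
proof -
  note D = P3_D[OF P]
  interpret Q: standardized_law "standardize P" by (rule standardized_law_standardize[OF P])
  have meas: "(\<lambda>x. (x - law_mean P) / law_sd P) \<in> borel_measurable P"
    by (rule real_distribution.measurable_finite_borel[OF D(1)]) measurable
  have "Q.beta3 = (\<integral>x. \<bar>x - law_mean P\<bar>^3 / law_sd P ^ 3 \<partial>P)"
    unfolding Q.beta3_def unfolding standardize_def using D(8)
    by (subst integral_distr[OF meas]) (auto simp: power_divide abs_divide)
  also have "\<dots> = enn2real (abs_central_moment 3 P) / law_sd P ^ 3"
    by (simp add: D(6))
  finally have "law_sd P ^ 3 / enn2real (abs_central_moment 3 P) = 1 / Q.beta3" by simp
  then show ?thesis
    unfolding asymptotic_ratio_def limI[OF scaled_interval_error_tendsto[OF P h]] by simp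
qed

section \<open>Symmetric two-point laws and the supremum\<close>

lemma two_std_normal_peak: "2 * std_normal_density 0 = 2 / sqrt (2 * pi)"
  by (simp add: std_normal_density_def)

lemma real_distribution_half_sum_dirac: "real_distribution (half_sum_dirac x y)"
proof -
  have sp: "space (half_sum_dirac x y) = UNIV" by (simp add: half_sum_dirac_def)
  have "emeasure (half_sum_dirac x y) UNIV = 1"
    by (subst emeasure_half_sum_dirac) (auto simp: ennreal_divide_self one_add_one)
  then have "prob_space (half_sum_dirac x y)" by (intro prob_spaceI) (simp add: sp)
  then show ?thesis by (simp add: real_distribution_def real_distribution_axioms_def)
qed

lemma measure_half_sum_dirac:
  assumes "A \<in> sets borel"
  shows "measure (half_sum_dirac x y) A = (indicator A x + indicator A y) / 2"
proof -
  interpret real_distribution "half_sum_dirac x y" by (rule real_distribution_half_sum_dirac)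
  have "ennreal (measure (half_sum_dirac x y) A) = ennreal ((indicator A x + indicator A y) / 2)"
    using emeasure_half_sum_dirac[OF assms, of x y] assms
    by (simp add: emeasure_eq_measure indicator_def ennreal_plus[symmetric] divide_ennreal[symmetric] del: ennreal_plus)
  then show ?thesis by (subst (asm) ennreal_inj) auto
qed

lemma (in real_distribution) integral_two_points:
  fixes F :: "real \<Rightarrow> 'a::{banach, second_countable_topology}"
  assumes ae: "AE z in M. z = a \<or> z = b" and ab: "a \<noteq> b" and F: "F \<in> borel_measurable borel"
  shows "(\<integral>z. F z \<partial>M) = measure M {a} *\<^sub>R F a + measure M {b} *\<^sub>R F b"
proof -
  have i: "integrable M (\<lambda>z. indicator {w} z *\<^sub>R F w)" for w
    by (auto simp: emeasure_eq_measure integrable_real_indicator)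
  have "(\<integral>z. F z \<partial>M) = (\<integral>z. indicator {a} z *\<^sub>R F a + indicator {b} z *\<^sub>R F b \<partial>M)"
  proof (rule integral_cong_AE)
    show "AE z in M. F z = indicator {a} z *\<^sub>R F a + indicator {b} z *\<^sub>R F b"
      using ae by eventually_elim (use ab in \<open>auto simp: indicator_def\<close>)
    show "F \<in> borel_measurable M" using F by simp
    show "(\<lambda>z. indicator {a} z *\<^sub>R F a + indicator {b} z *\<^sub>R F b) \<in> borel_measurable M"
      using i by (intro borel_measurable_add borel_measurable_integrable)
  qed
  also have "\<dots> = measure M {a} *\<^sub>R F a + measure M {b} *\<^sub>R F b"
  proof -
    have "(\<integral>z. indicator {w} z *\<^sub>R F w \<partial>M) = measure M {w} *\<^sub>R F w" for w
      by (subst integral_scaleR_left) (auto simp: emeasure_eq_measure integrable_real_indicator)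
    then show ?thesis by (subst Bochner_Integration.integral_add[OF i i]) simp
  qed
  finally show ?thesis .
qed

lemma AE_half_sum_dirac: "AE z in half_sum_dirac x y. z = x \<or> z = y"
proof -
  interpret real_distribution "half_sum_dirac x y" by (rule real_distribution_half_sum_dirac)
  have "measure (half_sum_dirac x y) (UNIV - {x, y}) = 0"
    by (subst measure_half_sum_dirac) auto
  then show ?thesis
    by (subst AE_iff_measurable[where N="UNIV - {x, y}"]) (auto simp: emeasure_eq_measure)
qed

lemma
  fixes F :: "real \<Rightarrow> 'a::{banach, second_countable_topology}"
  assumes xy: "x \<noteq> y" and F: "F \<in> borel_measurable borel"
  shows integrable_half_sum_dirac: "integrable (half_sum_dirac x y) F"
    and integral_half_sum_dirac: "(\<integral>z. F z \<partial>half_sum_dirac x y) = (1/2) *\<^sub>R (F x + F y)"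
proof -
  interpret real_distribution "half_sum_dirac x y" by (rule real_distribution_half_sum_dirac)
  have "AE z in half_sum_dirac x y. norm (F z) \<le> max (norm (F x)) (norm (F y))"
    using AE_half_sum_dirac by eventually_elim auto
  then show "integrable (half_sum_dirac x y) F"
    using F by (intro integrable_const_bound) auto
  show "(\<integral>z. F z \<partial>half_sum_dirac x y) = (1/2) *\<^sub>R (F x + F y)"
    using integral_two_points[OF AE_half_sum_dirac xy F] xy
    by (simp add: measure_half_sum_dirac scaleR_add_right)
qed

lemma two_point_law_eq_half_sum_dirac:
  assumes M: "real_distribution M" and ae: "AE z in M. z = a \<or> z = b" and ab: "a \<noteq> b"
    and mean: "(\<integral>z. z \<partial>M) = (a + b) / 2"
  shows "M = half_sum_dirac a b"
proof -
  interpret M: real_distribution M by (rule M)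
  interpret H: real_distribution "half_sum_dirac a b" by (rule real_distribution_half_sum_dirac)
  define p where "p = measure M {a}"
  define r where "r = measure M {b}"
  have "p + r = 1"
    using M.integral_two_points[OF ae ab, of "\<lambda>_. 1::real"] M.prob_space by (simp add: p_def r_def)
  moreover have "p * a + r * b = (a + b) / 2"
    using M.integral_two_points[OF ae ab, of "\<lambda>z. z"] mean by (simp add: p_def r_def)
  ultimately have "(p - 1/2) * (a - b) = 0" by algebra
  then have pr: "p = 1/2" "r = 1/2" using ab \<open>p + r = 1\<close> by auto
  show ?thesis
  proof (rule measure_eqI)
    fix A assume "A \<in> sets M"
    then have A: "A \<in> sets borel" by simp
    have "measure M A = (\<integral>z. indicator A z \<partial>M)" using A by simp
    also have "\<dots> = (indicator A a + indicator A b) / 2"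
      using M.integral_two_points[OF ae ab, of "indicator A :: real \<Rightarrow> real"] A
      unfolding pr[unfolded p_def r_def] by simp
    finally show "emeasure M A = emeasure (half_sum_dirac a b) A"
      by (simp add: M.emeasure_eq_measure H.emeasure_eq_measure measure_half_sum_dirac[OF A])
  qed simp
qed

lemma abs_central_moment_half_sum_dirac:
  assumes xy: "x \<noteq> y" and s: "s > 0"
  shows "law_mean (half_sum_dirac x y) = (x + y) / 2"
    and "abs_central_moment s (half_sum_dirac x y) = ennreal ((\<bar>x - y\<bar> / 2) powr s)"
proof -
  show mean: "law_mean (half_sum_dirac x y) = (x + y) / 2"
    unfolding law_mean_def by (subst integral_half_sum_dirac[OF xy]) auto
  have "integrable (half_sum_dirac x y) (\<lambda>z. z)" by (rule integrable_half_sum_dirac[OF xy]) simp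
  then have fin: "(\<integral>\<^sup>+z. ennreal \<bar>z\<bar> \<partial>half_sum_dirac x y) < \<infinity>"
    unfolding integrable_iff_bounded by simp
  have i: "integrable (half_sum_dirac x y) (\<lambda>z. \<bar>z - (x + y) / 2\<bar> powr s)"
    by (rule integrable_half_sum_dirac[OF xy]) simp
  have "abs_central_moment s (half_sum_dirac x y) = ennreal (\<integral>z. \<bar>z - (x + y) / 2\<bar> powr s \<partial>half_sum_dirac x y)"
    unfolding abs_central_moment_def mean using fin i by (simp add: nn_integral_eq_integral)
  also have "(\<integral>z. \<bar>z - (x + y) / 2\<bar> powr s \<partial>half_sum_dirac x y)
      = (\<bar>x - (x + y) / 2\<bar> powr s + \<bar>y - (x + y) / 2\<bar> powr s) / 2"
    by (subst integral_half_sum_dirac[OF xy]) auto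
  also have "x - (x + y) / 2 = (x - y) / 2" by (simp add: field_simps)
  also have "y - (x + y) / 2 = - ((x - y) / 2)" by (simp add: field_simps)
  finally show "abs_central_moment s (half_sum_dirac x y) = ennreal ((\<bar>x - y\<bar> / 2) powr s)" by simp
qed

lemma half_sum_dirac_in_P3:
  assumes xy: "x \<noteq> y"
  shows "half_sum_dirac x y \<in> P3" and "law_sd (half_sum_dirac x y) = \<bar>x - y\<bar> / 2"
proof -
  show "half_sum_dirac x y \<in> P3"
    using xy unfolding P3_def
    by (simp add: real_distribution_half_sum_dirac abs_central_moment_half_sum_dirac(2)[OF xy])
  have "(\<bar>x - y\<bar> / 2) powr 2 = (\<bar>x - y\<bar> / 2)^2"
    using xy by (simp add: powr_numeral)
  then show "law_sd (half_sum_dirac x y) = \<bar>x - y\<bar> / 2"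
    unfolding law_sd_def abs_central_moment_half_sum_dirac(2)[OF xy zero_less_numeral] by (simp del: power_divide)
qed

text \<open>The standardized law charges \<open>1\<close> and \<open>-1\<close> equally, so \<open>f = cos\<close>. With \<open>h = 2\<close> the smoothing law has the transform
  \<open>sin s / s\<close>, and \<open>sin\<^sup>2 = 1 - cos\<^sup>2\<close> is the inequality of \<open>smoothing_span\<close>.\<close>

lemma asymptotic_ratio_half_sum_dirac:
  assumes xy: "x \<noteq> y"
  shows "asymptotic_ratio (half_sum_dirac x y) = 2 / sqrt (2 * pi)"
proof -
  let ?P = "half_sum_dirac x y"
  have P: "?P \<in> P3" by (rule half_sum_dirac_in_P3[OF xy])
  interpret Q: standardized_law "standardize ?P" by (rule standardized_law_standardize[OF P])
  define e where "e = sgn (x - y)"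
  have e: "\<bar>e\<bar> = 1" "e = 1 \<or> e = -1" using xy by (auto simp: e_def sgn_real_def)
  let ?s = "\<lambda>z. (z - (x + y) / 2) / (\<bar>x - y\<bar> / 2)"
  have std: "standardize ?P = distr ?P borel ?s"
    unfolding standardize_def abs_central_moment_half_sum_dirac(1)[OF xy zero_less_one] half_sum_dirac_in_P3(2)[OF xy] ..
  have sx: "?s x = e" and sy: "?s y = - e"
    using xy by (auto simp: e_def sgn_real_def field_simps abs_if)
  have int: "(\<integral>z. F z \<partial>standardize ?P) = (1/2) *\<^sub>R (F e + F (- e))"
    if [measurable]: "F \<in> borel_measurable borel" for F :: "real \<Rightarrow> 'b::{banach, second_countable_topology}"
  proof -
    have "?s \<in> borel_measurable ?P"
      by (rule real_distribution.measurable_finite_borel[OF real_distribution_half_sum_dirac]) measurable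
    then have "(\<integral>z. F z \<partial>standardize ?P) = (\<integral>z. F (?s z) \<partial>?P)"
      unfolding std by (subst integral_distr) auto
    also have "\<dots> = (1/2) *\<^sub>R (F (?s x) + F (?s y))"
      by (rule integral_half_sum_dirac[OF xy]) measurable
    finally show ?thesis unfolding sx sy .
  qed
  have char: "Q.f s = of_real (cos s)" for s
  proof -
    have "Q.f s = (1/2) *\<^sub>R (iexp (s * e) + iexp (s * - e))"
      unfolding char_def by (rule int) measurable
    also have "\<dots> = of_real (cos s)" using e(2) by (auto simp: complex_eq_iff Re_exp Im_exp)
    finally show ?thesis .
  qed
  have span: "Q.smoothing_span 2"
    unfolding Q.smoothing_span_def
  proof (intro conjI allI impI)
    fix \<delta> A :: real assume \<delta>: "\<delta> > 0"
    show "\<exists>C. \<forall>s. \<delta> \<le> s \<and> s \<le> A \<longrightarrow> norm (char (spread 2) s) ^ 2 \<le> C * (1 - norm (Q.f s) ^ 2)"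
    proof (intro exI[of _ "1 / \<delta>^2"] allI impI)
      fix s assume s: "\<delta> \<le> s \<and> s \<le> A"
      have ne: "2 * s \<noteq> 0" using s \<delta> by simp
      have "norm (char (spread 2) s) ^ 2 = sin s ^ 2 / s ^ 2"
        unfolding char_spread char_unit_uniform[OF ne] norm_of_real by (simp add: power_divide)
      also have "\<dots> \<le> sin s ^ 2 / \<delta> ^ 2" using s \<delta> by (intro divide_left_mono power_mono) auto
      also have "sin s ^ 2 = 1 - norm (Q.f s) ^ 2" by (simp add: char sin_squared_eq)
      finally show "norm (char (spread 2) s) ^ 2 \<le> 1 / \<delta>^2 * (1 - norm (Q.f s) ^ 2)" by simp
    qed
  qed simp
  have lat: "lattice_law (standardize ?P) 1 2"
  proof -
    have ae: "AE z in ?P. z = x \<or> z = y" by (rule AE_half_sum_dirac)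
    have "AE z in ?P. \<exists>k::int. ?s z = 1 + 2 * of_int k"
      using ae
    proof eventually_elim
      case (elim z)
      then have "?s z = 1 \<or> ?s z = -1" using sx sy e(2) by auto
      moreover have "\<exists>k::int. w = 1 + 2 * of_int k" if "w = 1 \<or> w = -1" for w :: real
        using that by (auto intro: exI[of _ 0] exI[of _ "-1"])
      ultimately show ?case by blast
    qed
    then show ?thesis
      unfolding lattice_law_def std
      by (subst AE_distr_iff) (auto intro!: real_distribution.measurable_finite_borel[OF real_distribution_half_sum_dirac])
  qed
  have m3: "Q.third_moment = 0" and b3: "Q.beta3 = 1"
    unfolding Q.third_moment_def Q.beta3_def using e by (simp_all add: int)
  have "asymptotic_ratio ?P = limit_const 0 2"
    using asymptotic_ratio_eq[OF P span] lat m3 b3 by auto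
  also have "\<dots> = 2 * std_normal_density 0"
    using limit_const_ge[of 2 0] limit_const_le[of 2 0] by simp
  finally show ?thesis by (simp only: two_std_normal_peak)
qed

lemma asymptotic_ratio_bound:
  assumes P: "P \<in> P3"
  shows "asymptotic_ratio P \<le> 2 / sqrt (2 * pi)"
    and "asymptotic_ratio P = 2 / sqrt (2 * pi) \<Longrightarrow> \<exists>x y. x \<noteq> y \<and> P = half_sum_dirac x y"
proof -
  interpret Q: standardized_law "standardize P" by (rule standardized_law_standardize[OF P])
  let ?\<phi> = "std_normal_density 0"
  have \<phi>: "?\<phi> > 0" by (simp add: std_normal_density_def)
  obtain h where span: "Q.smoothing_span h" and lat: "h = 0 \<or> (h > 0 \<and> (\<exists>c. lattice_law (standardize P) c h))"
    by (rule Q.exists_smoothing_span)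
  have h: "h \<ge> 0" using lat by auto
  have ratio: "asymptotic_ratio P = limit_const Q.third_moment h / Q.beta3"
    by (rule asymptotic_ratio_eq[OF P span]) (use lat in auto)
  have h_le: "h \<le> 2 * Q.beta3"
    using lat Q.lattice_span_le_beta3(1) Q.beta3_pos by (auto intro: less_imp_le)
  have m_less: "\<bar>Q.third_moment\<bar> < 2 * Q.beta3"
    using Q.third_moment_le_beta3 Q.beta3_pos by linarith
  have ratio_le: "asymptotic_ratio P \<le> max h \<bar>Q.third_moment\<bar> / Q.beta3 * ?\<phi>"
    using limit_const_le[OF h, of Q.third_moment] Q.beta3_pos unfolding ratio
    by (simp add: divide_right_mono mult.commute)
  have max_le: "max h \<bar>Q.third_moment\<bar> / Q.beta3 \<le> 2"
    using h_le m_less Q.beta3_pos by (simp add: divide_le_eq)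
  then have "max h \<bar>Q.third_moment\<bar> / Q.beta3 * ?\<phi> \<le> 2 * ?\<phi>"
    using \<phi> by (intro mult_right_mono) auto
  with ratio_le show "asymptotic_ratio P \<le> 2 / sqrt (2 * pi)" unfolding two_std_normal_peak[symmetric] by linarith
  assume "asymptotic_ratio P = 2 / sqrt (2 * pi)"
  then have "2 * ?\<phi> \<le> max h \<bar>Q.third_moment\<bar> / Q.beta3 * ?\<phi>" using ratio_le by (simp only: two_std_normal_peak)
  then have "2 \<le> max h \<bar>Q.third_moment\<bar> / Q.beta3" by (rule mult_right_le_imp_le) (rule \<phi>)
  then have "2 * Q.beta3 \<le> max h \<bar>Q.third_moment\<bar>" using Q.beta3_pos by (simp add: le_divide_eq)
  then have h_eq: "h = 2 * Q.beta3" using h_le m_less by (auto simp: max_def split: if_splits)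
  then have "h > 0" using Q.beta3_pos by simp
  then obtain c where "lattice_law (standardize P) c h" using lat by auto
  then have ae: "AE z in standardize P. \<bar>z\<bar> = 1" using Q.lattice_span_le_beta3(2) \<open>h > 0\<close> h_eq by blast
  note D = P3_D[OF P]
  interpret P: real_distribution P by (rule D(1))
  let ?\<sigma> = "law_sd P" and ?\<mu> = "law_mean P"
  have meas: "(\<lambda>x. (x - ?\<mu>) / ?\<sigma>) \<in> borel_measurable P"
    by (rule P.measurable_finite_borel) measurable
  have "AE x in P. \<bar>(x - ?\<mu>) / ?\<sigma>\<bar> = 1"
    using ae unfolding standardize_def by (rule AE_distrD[OF meas])
  then have "AE x in P. x = ?\<mu> + ?\<sigma> \<or> x = ?\<mu> - ?\<sigma>"
  proof eventually_elim
    case (elim x)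
    then have "\<bar>x - ?\<mu>\<bar> = ?\<sigma>" using D(8) by (simp add: abs_divide field_simps)
    then show ?case by linarith
  qed
  moreover have "(\<integral>x. x \<partial>P) = (?\<mu> + ?\<sigma> + (?\<mu> - ?\<sigma>)) / 2" by (simp add: law_mean_def)
  ultimately have "P = half_sum_dirac (?\<mu> + ?\<sigma>) (?\<mu> - ?\<sigma>)"
    using D(8) by (intro two_point_law_eq_half_sum_dirac D(1)) auto
  then show "\<exists>x y. x \<noteq> y \<and> P = half_sum_dirac x y" using D(8) by (intro exI[of _ "?\<mu> + ?\<sigma>"] exI[of _ "?\<mu> - ?\<sigma>"]) auto
qed

theorem corollary2p3:
  shows "(\<forall>P\<in>P3. convergent (scaled_interval_error P))
    \<and> (SUP P\<in>P3. ereal (asymptotic_ratio P)) = ereal (2 / sqrt (2 * pi))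
    \<and> {P\<in>P3. ereal (asymptotic_ratio P) = (SUP Q\<in>P3. ereal (asymptotic_ratio Q))}
        = {half_sum_dirac x y | x y. x \<noteq> y}"
proof -
  have conv: "convergent (scaled_interval_error P)" if P: "P \<in> P3" for P
  proof -
    interpret Q: standardized_law "standardize P" by (rule standardized_law_standardize[OF P])
    obtain h where "Q.smoothing_span h" "h = 0 \<or> (h > 0 \<and> (\<exists>c. lattice_law (standardize P) c h))"
      by (rule Q.exists_smoothing_span)
    then have "scaled_interval_error P \<longlonglongrightarrow> limit_const Q.third_moment h"
      by (intro scaled_interval_error_tendsto[OF P]) auto
    then show ?thesis by (rule convergentI)
  qed
  have sup: "(SUP P\<in>P3. ereal (asymptotic_ratio P)) = ereal (2 / sqrt (2 * pi))"
  proof (rule antisym)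
    show "(SUP P\<in>P3. ereal (asymptotic_ratio P)) \<le> ereal (2 / sqrt (2 * pi))"
      by (rule SUP_least) (simp only: ereal_less_eq asymptotic_ratio_bound(1))
    have "ereal (2 / sqrt (2 * pi)) = ereal (asymptotic_ratio (half_sum_dirac 0 1))"
      by (simp only: asymptotic_ratio_half_sum_dirac[OF zero_neq_one])
    also have "\<dots> \<le> (SUP P\<in>P3. ereal (asymptotic_ratio P))"
      by (rule SUP_upper) (rule half_sum_dirac_in_P3(1)[OF zero_neq_one])
    finally show "ereal (2 / sqrt (2 * pi)) \<le> (SUP P\<in>P3. ereal (asymptotic_ratio P))" .
  qed
  have "{P\<in>P3. ereal (asymptotic_ratio P) = (SUP Q\<in>P3. ereal (asymptotic_ratio Q))}
        = {half_sum_dirac x y | x y. x \<noteq> y}"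
    unfolding sup ereal.inject
  proof (intro equalityI subsetI)
    fix P assume "P \<in> {P \<in> P3. asymptotic_ratio P = 2 / sqrt (2 * pi)}"
    then show "P \<in> {half_sum_dirac x y | x y. x \<noteq> y}" using asymptotic_ratio_bound(2)[of P] by blast
  next
    fix P assume "P \<in> {half_sum_dirac x y | x y. x \<noteq> y}"
    then show "P \<in> {P \<in> P3. asymptotic_ratio P = 2 / sqrt (2 * pi)}"
      using half_sum_dirac_in_P3(1) asymptotic_ratio_half_sum_dirac by blast
  qed
  with conv sup show ?thesis by blast
qed

end
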